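(* Let $n\geq 1$ be an integer. For any $R>0$, $u\in(-R,R)$, $\ell\in\mathbb{Z}$ and $a\in\mathbb{R}\cup\{-\infty\}$, we have $$C(\mathbb{T}^{2n},\mathbb{T}^n;R,u,\ell,a)=\max\{R|\ell|+u\ell,\;a+u\ell\}.$$
   Context: $S^1=\mathbb{R}/\mathbb{Z}$. $A_R=(-R,R)\times\mathbb{R}/\mathbb{Z}$ is the open annulus with coordinates $(p_0,q_0)$, and $L_u=\{u\}\times\mathbb{R}/\mathbb{Z}\subset A_R$. $\mathbb{T}^{2n}=(\mathbb{R}/2\mathbb{Z}\times\mathbb{R}/\mathbb{Z})^n$ with coordinates $(p_1,q_1,\dots,p_n,q_n)$ and standard symplectic form $\omega_{\mathrm{std}}=\sum_{i=1}^n dp_i\wedge dq_i$; as a subset of $\mathbb{T}^{2n}$, $\mathbb{T}^n$ denotes $(\{0\}\times\mathbb{R}/\mathbb{Z})^n$. For a closed connected symplectic manifold $(N,\omega_N)$, $A_R\times N$ carries the symplectic form $(dp_0\wedge dq_0)\oplus\omega_N$. $[S^1,M]$ is the set of free homotopy classes of loops in $M$; $\alpha_\ell=[t\mapsto(0,\ell t)]\in[S^1,A_R]$; $0_N$ is the class of trivial loops in $N$. For $H\colon S^1\times M\to\mathbb{R}$ smooth with compact support on a symplectic manifold $(M,\omega)$, with $H_t=H(t,\cdot)$, the Hamiltonian vector field is defined by $\iota_{X_{H_t}}\omega=-dH_t$, and $\mathcal{P}(H;\alpha)$ is the set of one-periodic trajectories of the resulting Hamiltonian isotopy representing $\alpha\in[S^1,M]$.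 Action functional (when $\int_{\mathbb{T}^2}v^*\omega=0$ for every $v\colon\mathbb{T}^2\to M$ that is a loop of loops in $\alpha$): $$\mathcal{A}_H(x)=-\int_{[0,1]\times S^1}\bar x^*\omega+\int_0^1H_t(x(t))\,dt,$$ where $\bar x\colon[0,1]\times S^1\to M$ is a path of loops in $\alpha$ from a fixed reference loop $z$ (at parameter $0$) to $x$ (at parameter $1$). For $M=A_R\times\mathbb{T}^{2n}$ and $\alpha=(\alpha_\ell,0_{\mathbb{T}^{2n}})$ the reference loop is $z(t)=(0,\ell t;0,\dots,0)$, i.e. $p_0=0$, $q_0=\ell t$, constant in $\mathbb{T}^{2n}$. Biran–Polterovich–Salamon capacity: for an open symplectic manifold $(M,\omega)$, compact $A\subset M$, $\alpha\in[S^1,M]$ and $a\ge-\infty$, $$C_{\mathrm{BPS}}(M,A;\alpha,a)=\inf\{\,c>0\mid\forall H\in\mathcal{H}_c(M,A)\ \exists x\in\mathcal{P}(H;\alpha)\text{ with }\mathcal{A}_H(x)\ge a\,\},$$ where $\mathcal{H}_c(M,A)$ is the set of smooth compactly supported $H\colon S^1\times M\to\mathbb{R}$ with $\inf_{S^1\times A}H\ge c$, and $\inf\emptyset=\infty$. For compact $X\subset N$, $$C(N,X;R,u,\ell,a)=C_{\mathrm{BPS}}(A_R\times N,\,L_u\times X;\,(\alpha_\ell,0_N),\,a).$$ *)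

theory Defs
  imports "HOL-Analysis.Analysis"
begin

section \<open>The circles \<open>\<real>/\<int>\<close> and \<open>\<real>/2\<int>\<close>\<close>

quotient_type circle1 = real / "\<lambda>x y. \<exists>k::int. x - y = of_int k"
  morphisms rep_circle1 to_circle1
proof (rule equivpI)
  show "reflp (\<lambda>x y::real. \<exists>k::int. x - y = of_int k)"
    by (rule reflpI) (auto intro: exI[of _ 0])
  show "symp (\<lambda>x y::real. \<exists>k::int. x - y = of_int k)"
    by (rule sympI) (metis minus_diff_eq of_int_minus)
  show "transp (\<lambda>x y::real. \<exists>k::int. x - y = of_int k)"
    by (rule transpI) (metis diff_add_cancel add_diff_eq of_int_add)
qed

quotient_type circle2 = real / "\<lambda>x y. \<exists>k::int. x - y = 2 * of_int k"
  morphisms rep_circle2 to_circle2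
proof (rule equivpI)
  show "reflp (\<lambda>x y::real. \<exists>k::int. x - y = 2 * of_int k)"
    by (rule reflpI) (auto intro: exI[of _ 0])
  show "symp (\<lambda>x y::real. \<exists>k::int. x - y = 2 * of_int k)"
    by (rule sympI) (metis minus_diff_eq of_int_minus mult_minus_right)
  show "transp (\<lambda>x y::real. \<exists>k::int. x - y = 2 * of_int k)"
    by (rule transpI) (metis diff_add_cancel add_diff_eq of_int_add distrib_left)
qed

text \<open>Both carry the quotient topology.\<close>

instantiation circle1 :: topological_space
begin

definition open_circle1 :: "circle1 set \<Rightarrow> bool" where
  "open_circle1 U \<longleftrightarrow> open (to_circle1 -` U)"

instance
  by standard (auto simp: open_circle1_def vimage_Union intro!: open_UN)

end

instantiation circle2 :: topological_space
begin

definition open_circle2 :: "circle2 set \<Rightarrow> bool" where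
  "open_circle2 U \<longleftrightarrow> open (to_circle2 -` U)"

instance
  by standard (auto simp: open_circle2_def vimage_Union intro!: open_UN)

end

lift_definition wind :: "int \<Rightarrow> circle1 \<Rightarrow> circle1" is "\<lambda>l t. of_int l * t"
  by (metis of_int_mult right_diff_distrib)


section \<open>Smooth maps on open sets\<close>

fun Ck_on :: "nat \<Rightarrow> ('a::real_normed_vector \<Rightarrow> 'b::real_normed_vector) \<Rightarrow> 'a set \<Rightarrow> bool" where
  "Ck_on 0 f S \<longleftrightarrow> continuous_on S f"
| "Ck_on (Suc k) f S \<longleftrightarrow> (\<forall>x\<in>S. f differentiable (at x)) \<and>
     (\<forall>v. Ck_on k (\<lambda>x. frechet_derivative f (at x) v) S)"

definition smooth_on :: "('a::real_normed_vector \<Rightarrow> 'b::real_normed_vector) \<Rightarrow> 'a set \<Rightarrow> bool" where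
  "smooth_on f S \<longleftrightarrow> (\<forall>k. Ck_on k f S)"


section \<open>Flat symplectic manifolds\<close>

text \<open>
  A flat symplectic manifold is given by its underlying set of points, a covering map onto it by
  an open subset of a Euclidean space whose deck transformations are translations, and a
  translation-invariant symplectic form.  The smooth structure is the one for which the covering
  map is a local diffeomorphism; it identifies every tangent space with the Euclidean space, so
  that derivatives of maps from or into the manifold are computed on lifts.
\<close>

record ('v, 'm) flat_mfd =
  points :: "'m set"
  cover :: "'v \<Rightarrow> 'm"
  form :: "'v \<Rightarrow> 'v \<Rightarrow> real"

definition prod_mfd ::
  "('v::real_vector, 'm) flat_mfd \<Rightarrow> ('w::real_vector, 'k) flat_mfd \<Rightarrow> ('v \<times> 'w, 'm \<times> 'k) flat_mfd" where
  "prod_mfd M N =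
     \<lparr> points = points M \<times> points N,
       cover = map_prod (cover M) (cover N),
       form = (\<lambda>x y. form M (fst x) (fst y) + form N (snd x) (snd y)) \<rparr>"


subsection \<open>Loops and free homotopy classes\<close>

definition freely_homotopic ::
  "('v, 'm::topological_space) flat_mfd \<Rightarrow> (circle1 \<Rightarrow> 'm) \<Rightarrow> (circle1 \<Rightarrow> 'm) \<Rightarrow> bool" where
  "freely_homotopic M x y \<longleftrightarrow> homotopic_with_canon (\<lambda>_. True) UNIV (points M) x y"

definition free_class ::
  "('v, 'm::topological_space) flat_mfd \<Rightarrow> (circle1 \<Rightarrow> 'm) \<Rightarrow> (circle1 \<Rightarrow> 'm) set" where
  "free_class M z = {x. freely_homotopic M z x}"

definition trivial_class :: "('v, 'm::topological_space) flat_mfd \<Rightarrow> (circle1 \<Rightarrow> 'm) set" where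
  "trivial_class M = {x. \<exists>y\<in>points M. freely_homotopic M (\<lambda>_. y) x}"

text \<open>The class \<open>(\<alpha>, \<beta>)\<close> under \<open>[S\<^sup>1, M \<times> N] = [S\<^sup>1, M] \<times> [S\<^sup>1, N]\<close>.\<close>

definition pair_class :: "(circle1 \<Rightarrow> 'm) set \<Rightarrow> (circle1 \<Rightarrow> 'k) set \<Rightarrow> (circle1 \<Rightarrow> 'm \<times> 'k) set" where
  "pair_class \<alpha> \<beta> = {x. fst \<circ> x \<in> \<alpha> \<and> snd \<circ> x \<in> \<beta>}"


subsection \<open>Hamiltonians and one-periodic trajectories\<close>

definition smooth_hamiltonian ::
  "('v::euclidean_space, 'm) flat_mfd \<Rightarrow> (circle1 \<times> 'm \<Rightarrow> real) \<Rightarrow> bool" where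
  "smooth_hamiltonian M H \<longleftrightarrow>
     smooth_on (\<lambda>(t, v). H (to_circle1 t, cover M v)) (UNIV \<times> cover M -` points M)"

definition compactly_supported ::
  "('v, 'm::topological_space) flat_mfd \<Rightarrow> (circle1 \<times> 'm \<Rightarrow> real) \<Rightarrow> bool" where
  "compactly_supported M H \<longleftrightarrow>
     (\<exists>K \<subseteq> UNIV \<times> points M. compact K \<and> (\<forall>y \<in> UNIV \<times> points M - K. H y = 0))"

text \<open>The vector \<open>X\<close> with \<open>\<omega>(X, w) = - dH\<^sub>t(w)\<close> for all \<open>w\<close>, at the point covered by \<open>v\<close>.\<close>

definition ham_vf ::
  "('v::euclidean_space, 'm) flat_mfd \<Rightarrow> (circle1 \<times> 'm \<Rightarrow> real) \<Rightarrow> real \<Rightarrow> 'v \<Rightarrow> 'v" where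
  "ham_vf M H t v =
     (THE X. \<forall>w. form M X w = - frechet_derivative (\<lambda>v. H (to_circle1 t, cover M v)) (at v) w)"

definition periodic_trajectories ::
  "('v::euclidean_space, 'm) flat_mfd \<Rightarrow> (circle1 \<times> 'm \<Rightarrow> real) \<Rightarrow> (circle1 \<Rightarrow> 'm) set
     \<Rightarrow> (circle1 \<Rightarrow> 'm) set" where
  "periodic_trajectories M H \<alpha> =
     {x \<in> \<alpha>. \<exists>X :: real \<Rightarrow> 'v. (\<forall>t. x (to_circle1 t) = cover M (X t)) \<and>
        (\<forall>t. (X has_vector_derivative ham_vf M H t (X t)) (at t))}"


subsection \<open>The action functional\<close>

text \<open>
  \<open>is_lift M y W\<close>: the map \<open>y : [0,1] \<times> S\<^sup>1 \<rightarrow> M\<close> lifts to \<open>W\<close> on \<open>[0,1] \<times> \<real>\<close>, and \<open>W\<close> is smooth on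
  a neighbourhood of \<open>[0,1] \<times> \<real>\<close>, i.e. \<open>y\<close> is smooth up to the boundary.
\<close>

definition is_lift ::
  "('v::euclidean_space, 'm) flat_mfd \<Rightarrow> (real \<times> circle1 \<Rightarrow> 'm) \<Rightarrow> (real \<times> real \<Rightarrow> 'v) \<Rightarrow> bool" where
  "is_lift M y W \<longleftrightarrow>
     (\<exists>U. open U \<and> {0..1} \<times> UNIV \<subseteq> U \<and> smooth_on W U) \<and>
     (\<forall>s\<in>{0..1}. \<forall>t. y (s, to_circle1 t) \<in> points M \<and> y (s, to_circle1 t) = cover M (W (s, t)))"

definition paths_of_loops ::
  "('v::euclidean_space, 'm) flat_mfd \<Rightarrow> (circle1 \<Rightarrow> 'm) \<Rightarrow> (circle1 \<Rightarrow> 'm)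
     \<Rightarrow> (real \<times> circle1 \<Rightarrow> 'm) set" where
  "paths_of_loops M z x =
     {y. (\<exists>W. is_lift M y W) \<and> (\<forall>t. y (0, t) = z t) \<and> (\<forall>t. y (1, t) = x t)}"

text \<open>
  The integral of \<open>y\<^sup>*\<omega> = \<omega>(\<partial>\<^sub>s y, \<partial>\<^sub>t y) ds \<and> dt\<close>.  Two lifts differ by a deck translation, so the
  value does not depend on the lift.
\<close>

definition symp_area ::
  "('v::euclidean_space, 'm) flat_mfd \<Rightarrow> (real \<times> circle1 \<Rightarrow> 'm) \<Rightarrow> real" where
  "symp_area M y =
     (let W = (SOME W. is_lift M y W) in
      integral ({0..1} \<times> {0..1})
        (\<lambda>st. form M (frechet_derivative W (at st) (1, 0)) (frechet_derivative W (at st) (0, 1))))"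

text \<open>
  The action relative to the reference loop \<open>z\<close>.  As usual it is only meaningful if \<open>\<omega>\<close> integrates
  to zero over all loops of loops in the free homotopy class of \<open>z\<close>; then it does not depend on
  the chosen path of loops.
\<close>

definition action ::
  "('v::euclidean_space, 'm) flat_mfd \<Rightarrow> (circle1 \<Rightarrow> 'm) \<Rightarrow> (circle1 \<times> 'm \<Rightarrow> real)
     \<Rightarrow> (circle1 \<Rightarrow> 'm) \<Rightarrow> real" where
  "action M z H x =
     - symp_area M (SOME y. y \<in> paths_of_loops M z x)
     + integral {0..1} (\<lambda>t. H (to_circle1 t, x (to_circle1 t)))"


section \<open>Capacities\<close>

definition H_c ::
  "('v::euclidean_space, 'm::topological_space) flat_mfd \<Rightarrow> 'm set \<Rightarrow> real
     \<Rightarrow> (circle1 \<times> 'm \<Rightarrow> real) set" where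
  "H_c M A c =
     {H. smooth_hamiltonian M H \<and> compactly_supported M H \<and>
         ereal c \<le> (INF y \<in> UNIV \<times> A. ereal (H y))}"

text \<open>The loop \<open>z\<close> is the reference loop of the action functional; it should represent \<open>\<alpha>\<close>.\<close>

definition C_BPS ::
  "('v::euclidean_space, 'm::topological_space) flat_mfd \<Rightarrow> 'm set \<Rightarrow> (circle1 \<Rightarrow> 'm) set
     \<Rightarrow> (circle1 \<Rightarrow> 'm) \<Rightarrow> ereal \<Rightarrow> ereal" where
  "C_BPS M A \<alpha> z a =
     Inf {ereal c | c. c > 0 \<and>
       (\<forall>H \<in> H_c M A c. \<exists>x \<in> periodic_trajectories M H \<alpha>. ereal (action M z H x) \<ge> a)}"

text \<open>The open annulus \<open>(-R, R) \<times> \<real>/\<int>\<close> with the form \<open>dp\<^sub>0 \<and> dq\<^sub>0\<close>.\<close>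

definition dp_dq :: "real \<times> real \<Rightarrow> real \<times> real \<Rightarrow> real" where
  "dp_dq x y = fst x * snd y - snd x * fst y"

definition annulus :: "real \<Rightarrow> (real \<times> real, real \<times> circle1) flat_mfd" where
  "annulus R =
     \<lparr> points = {-R<..<R} \<times> UNIV,
       cover = (\<lambda>(p, q). (p, to_circle1 q)),
       form = dp_dq \<rparr>"

definition alpha_loop :: "int \<Rightarrow> circle1 \<Rightarrow> real \<times> circle1" where
  "alpha_loop l t = (0, wind l t)"

definition alpha_class :: "real \<Rightarrow> int \<Rightarrow> (circle1 \<Rightarrow> real \<times> circle1) set" where
  "alpha_class R l = free_class (annulus R) (alpha_loop l)"

text \<open>
  The capacity \<open>C(N, X; R, u, \<ell>, a)\<close>; the reference loop is \<open>t \<mapsto> (0, \<ell> t; y)\<close> for a base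
  point \<open>y\<close> of \<open>N\<close>.
\<close>

definition relative_capacity ::
  "('v::euclidean_space, 'm::topological_space) flat_mfd \<Rightarrow> 'm \<Rightarrow> 'm set
     \<Rightarrow> real \<Rightarrow> real \<Rightarrow> int \<Rightarrow> ereal \<Rightarrow> ereal" where
  "relative_capacity N y X R u l a =
     C_BPS (prod_mfd (annulus R) N) (({u} \<times> UNIV) \<times> X)
       (pair_class (alpha_class R l) (trivial_class N)) (\<lambda>t. (alpha_loop l t, y)) a"

text \<open>The torus \<open>(\<real>/2\<int> \<times> \<real>/\<int>)\<^sup>n\<close> with \<open>\<Sum>\<^sub>i dp\<^sub>i \<and> dq\<^sub>i\<close>, where \<open>n = CARD('n)\<close>.\<close>

definition torus :: "((real \<times> real) ^ 'n, (circle2 \<times> circle1) ^ 'n::finite) flat_mfd" where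
  "torus =
     \<lparr> points = UNIV,
       cover = (\<lambda>v. \<chi> i. (to_circle2 (fst (v $ i)), to_circle1 (snd (v $ i)))),
       form = (\<lambda>x y. \<Sum>i\<in>UNIV. dp_dq (x $ i) (y $ i)) \<rparr>"

definition torus_origin :: "(circle2 \<times> circle1) ^ 'n::finite" where
  "torus_origin = (\<chi> i. (to_circle2 0, to_circle1 0))"

definition zero_torus :: "((circle2 \<times> circle1) ^ 'n::finite) set" where
  "zero_torus = {x. \<forall>i. fst (x $ i) = to_circle2 0}"

end

theory Submission
  imports Defs "HOL-Complex_Analysis.Great_Picard"
begin

text \<open>
  In coordinates the action of a loop \<open>(p, q)\<close> in the class \<open>(\<alpha>\<^sub>l, 0)\<close> is the integral of
  \<open>H\<^sub>t(p, q) - p \<bullet> q'\<close>.  It is at least \<open>c - u l\<close> on the loops with \<open>p = (u, 0, \<dots>, 0)\<close> and arbitrary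
  \<open>q\<close>, because they lie in \<open>L\<^sub>u \<times> T\<^sup>n\<close>, and it is bounded above on a complementary linear space of loops.
  Dividing time into \<open>N\<close> steps makes the number of variables finite.  The iterates of gradient ascent
  move the first family by a linear expansion up to a bounded error, so that the Poincare-Miranda theorem
  forces them to keep meeting the second one.  The ascent is therefore slow somewhere above the
  level \<open>c - u l\<close>, and this gives almost critical points, that is, almost solutions of the symplectic Euler
  scheme.  They converge to a periodic orbit as \<open>N\<close> tends to infinity.

  For the second family the Hamiltonian has to be extended from the annulus to \<open>\<real> \<times> S\<^sup>1\<close> by a steep concave
  barrier.  An orbit outside the annulus has action at most \<open>R \<bar>l\<bar>\<close> up to a small error, so that the
  orbit found stays inside if \<open>c - u l > R \<bar>l\<bar>\<close>.

  Conversely, a Hamiltonian \<open>f(p\<^sub>0)\<close> has orbits in the class exactly where \<open>f'(p\<^sub>0) = l\<close>, with action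
  \<open>f(p\<^sub>0) - p\<^sub>0 l\<close>.  If \<open>c < R \<bar>l\<bar> + u l\<close>, some \<open>f\<close> with \<open>f(u) \<ge> c\<close> never has this slope; if \<open>c < a + u l\<close>, a narrow
  bump at \<open>u\<close> only has orbits of action less than \<open>a\<close>.
\<close>


section \<open>Zeros of bounded perturbations of the identity\<close>

text \<open>On loop space the action has infinitely many ascending and descending directions; with N
  time steps both become finite in number. That number grows with N, so no type can carry it: points
  are functions on \<open>nat\<close> of which finitely many values matter, and continuity is stated
  along pointwise convergent sequences. The upper bound on the complementary space may depend on N;
  the level c - u l does not, which is why it survives in the limit. All computations take place on
  lifts to the covering space. Loops in the class close up there except for the shift l in q_0, and
  the deck lattice replaces the compactness of the torus. Only p_0 could escape, and the slope of
  the barrier far out prevents that. The threshold R |l| is the supremum of - p_0 l over the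
  annulus, that is, the Legendre transform of an infinitely steep barrier. Finite steepness K costs
  l^2 / (2 K), absorbed by the strict inequality c - u l > R |l|. The barrier has a bounded
  Lipschitz derivative, since gradient ascent has to remain a bounded perturbation of a linear
  map.\<close>

lemma convergent_coordinates:
  fixes a :: "nat \<Rightarrow> 'i \<Rightarrow> real"
  assumes "finite I" and "\<And>k i. i \<in> I \<Longrightarrow> \<bar>a k i\<bar> \<le> r"
  shows "\<exists>\<rho> w. strict_mono (\<rho>::nat\<Rightarrow>nat) \<and> (\<forall>i\<in>I. (\<lambda>k. a (\<rho> k) i) \<longlonglongrightarrow> w i)"
  using assms
proof (induction I rule: finite_induct)
  case empty
  show ?case by (rule exI[of _ id]) (auto simp: strict_mono_def)
next
  case (insert i I)
  obtain \<rho> w where \<rho>: "strict_mono (\<rho>::nat\<Rightarrow>nat)" "\<And>j. j\<in>I \<Longrightarrow> (\<lambda>k. a (\<rho> k) j) \<longlonglongrightarrow> w j"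
    using insert.IH insert.prems by (meson insertI2)
  have "compact {-r..r}" by simp
  moreover have "\<forall>k. a (\<rho> k) i \<in> {-r..r}" using insert.prems[of i]
    by (auto simp: abs_le_iff minus_le_iff)
  ultimately obtain l s where s: "strict_mono (s::nat\<Rightarrow>nat)" "((\<lambda>k. a (\<rho> k) i) \<circ> s) \<longlonglongrightarrow> l"
    unfolding compact_def by meson
  have "\<forall>j\<in>insert i I. (\<lambda>k. a ((\<rho> \<circ> s) k) j) \<longlonglongrightarrow> (w(i:=l)) j"
  proof
    fix j assume "j \<in> insert i I"
    show "(\<lambda>k. a ((\<rho> \<circ> s) k) j) \<longlonglongrightarrow> (w(i:=l)) j"
    proof (cases "j = i")
      case True then show ?thesis using s(2) by (simp add: o_def)
    next
      case False
      then have "j \<in> I" using \<open>j \<in> insert i I\<close> by auto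
      from LIMSEQ_subseq_LIMSEQ[OF \<rho>(2)[OF this] s(1)] False show ?thesis by (simp add: o_def)
    qed
  qed
  moreover have "strict_mono (\<rho> \<circ> s)" using \<rho>(1) s(1) by (rule strict_mono_o)
  ultimately show ?case by blast
qed

text \<open>Kuhn's combinatorial lemma on grids of mesh tending to 0: a coordinate is labelled by
  the sign of \<open>F\<close> in that coordinate, the face conditions yield the labels that
  \<open>kuhn_lemma\<close> demands on the boundary, and cells carrying both labels in every
  coordinate shrink to a common zero.\<close>

lemma poincare_miranda:
  fixes F :: "(nat \<Rightarrow> real) \<Rightarrow> nat \<Rightarrow> real" and r :: real
  assumes cont: "\<And>i X w. i < n \<Longrightarrow> (\<And>j. (\<lambda>k. X k j) \<longlonglongrightarrow> w j) \<Longrightarrow> (\<lambda>k. F (X k) i) \<longlonglongrightarrow> F w i"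
    and r: "r > 0"
    and low: "\<And>w i. i < n \<Longrightarrow> (\<And>j. j < n \<Longrightarrow> \<bar>w j\<bar> \<le> r) \<Longrightarrow> w i = - r \<Longrightarrow> F w i < 0"
    and high: "\<And>w i. i < n \<Longrightarrow> (\<And>j. j < n \<Longrightarrow> \<bar>w j\<bar> \<le> r) \<Longrightarrow> w i = r \<Longrightarrow> F w i > 0"
  shows "\<exists>w. \<forall>i<n. F w i = 0"
proof -
  \<comment> \<open>The grid with \<open>Suc p\<close> intervals per side of the cube. The value 0
    from index \<open>n\<close> on keeps all coordinates convergent, as \<open>cont\<close> asks
    for.\<close>
  define g where "g p x = (\<lambda>i. if i < n then - r + 2 * r * real (x i) / real (Suc p) else 0)"
    for p :: nat and x :: "nat \<Rightarrow> nat"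
  define label where "label p x i = (if F (g p x) i > 0 then 1 else (0::nat))" for p x i
  have gb: "\<bar>g p x i\<bar> \<le> r" if "\<forall>i<n. x i \<le> Suc p" for p x i
  proof (cases "i < n")
    case True
    have 0: "0 \<le> real (x i) / real (Suc p)" "real (x i) / real (Suc p) \<le> 1"
      using that True by (auto simp: divide_le_eq_1)
    have "2 * r * (real (x i) / real (Suc p)) \<le> 2 * r * 1"
      by (rule mult_left_mono) (use 0 r in auto)
    then have "0 \<le> 2 * r * (real (x i) / real (Suc p))" "2 * r * (real (x i) / real (Suc p)) \<le> 2 * r * 1"
      using r 0 by auto
    then show ?thesis using True by (auto simp: g_def abs_le_iff simp del: of_nat_Suc)
  qed (use r in \<open>auto simp: g_def\<close>)
  have "\<exists>q. (\<forall>i<n. q i < Suc p) \<and> (\<forall>i<n. \<exists>a b. (\<forall>j<n. q j \<le> a j \<and> a j \<le> q j + 1) \<and>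
     (\<forall>j<n. q j \<le> b j \<and> b j \<le> q j + 1) \<and> label p a i \<noteq> label p b i)" for p
  proof -
    have 1: "label p x i = 0" if "\<forall>i<n. x i \<le> Suc p" "i < n" "x i = 0" for x i
    proof -
      have "g p x i = - r" using that by (simp add: g_def)
      then have "F (g p x) i < 0" by (intro low that gb)
      then show ?thesis by (simp add: label_def)
    qed
    have 2: "label p x i = 1" if "\<forall>i<n. x i \<le> Suc p" "i < n" "x i = Suc p" for x i
    proof -
      have "g p x i = r" using that by (simp add: g_def del: of_nat_Suc)
      then have "F (g p x) i > 0" by (intro high that gb)
      then show ?thesis by (simp add: label_def)
    qed
    have 3: "label p x i = 0 \<or> label p x i = 1" for x i by (simp add: label_def)
    show ?thesis
    proof (rule kuhn_lemma[of "Suc p" n "label p"])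
      fix q :: "nat \<Rightarrow> nat" assume "\<forall>i<n. q i < Suc p"
        "\<forall>i<n. \<exists>r s. (\<forall>j<n. q j \<le> r j \<and> r j \<le> q j + 1) \<and>
          (\<forall>j<n. q j \<le> s j \<and> s j \<le> q j + 1) \<and> label p r i \<noteq> label p s i"
      then show ?thesis by (intro exI[of _ q] conjI)
    qed (simp, (rule allI impI)+, rule 3, (rule allI impI)+, rule 1, assumption+, (rule allI impI)+, rule 2, assumption+)
  qed
  then have "\<forall>p. \<exists>q. (\<forall>i<n. q i < Suc p) \<and> (\<forall>i<n. \<exists>a b. (\<forall>j<n. q j \<le> a j \<and> a j \<le> q j + 1) \<and>
     (\<forall>j<n. q j \<le> b j \<and> b j \<le> q j + 1) \<and> label p a i \<noteq> label p b i)" by (rule allI)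
  from choice[OF this] obtain q where q0: "\<forall>p. (\<forall>i<n. q p i < Suc p) \<and> (\<forall>i<n. \<exists>a b. (\<forall>j<n. q p j \<le> a j \<and> a j \<le> q p j + 1) \<and>
     (\<forall>j<n. q p j \<le> b j \<and> b j \<le> q p j + 1) \<and> label p a i \<noteq> label p b i)" by (rule exE)
  have q: "q p i < Suc p" if "i < n" for p i
    using q0[THEN spec, of p, THEN conjunct1] that by blast
  define good where "good p i = (\<lambda>(a, b). (\<forall>j<n. q p j \<le> a j \<and> a j \<le> q p j + 1) \<and>
     (\<forall>j<n. q p j \<le> b j \<and> b j \<le> q p j + 1) \<and> label p a i \<noteq> label p b i)" for p i
  have gex: "\<exists>ab. good p i ab" if i: "i < n" for p i
  proof -
    obtain a b where "good p i (a, b)" unfolding good_def case_prod_conv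
      using q0[THEN spec, of p, THEN conjunct2, THEN spec, THEN mp, OF i] by (elim exE)
    then show ?thesis ..
  qed
  have good: "good p i (SOME ab. good p i ab)" if "i < n" for p i
    by (rule someI_ex[OF gex[OF that]])
  define A where "A p i = fst (SOME ab. good p i ab)" for p i
  define B where "B p i = snd (SOME ab. good p i ab)" for p i
  have "good p i (A p i, B p i)" if "i < n" for p i
    using good[OF that] by (simp add: A_def B_def)
  then have A: "\<And>p i j. i<n \<Longrightarrow> j < n \<Longrightarrow> q p j \<le> A p i j \<and> A p i j \<le> q p j + 1"
    and B: "\<And>p i j. i<n \<Longrightarrow> j < n \<Longrightarrow> q p j \<le> B p i j \<and> B p i j \<le> q p j + 1"
    and AB: "\<And>p i. i<n \<Longrightarrow> label p (A p i) i \<noteq> label p (B p i) i"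
    unfolding good_def by auto
  have "\<exists>\<rho> w. strict_mono (\<rho>::nat\<Rightarrow>nat) \<and> (\<forall>i\<in>{..<n}. (\<lambda>k. g (\<rho> k) (q (\<rho> k)) i) \<longlonglongrightarrow> w i)"
    by (rule convergent_coordinates[where r = r]) (use gb q in \<open>auto simp: less_imp_le\<close>)
  then obtain \<rho> w0 where \<rho>: "strict_mono (\<rho>::nat\<Rightarrow>nat)"
    and w0: "\<And>i. i < n \<Longrightarrow> (\<lambda>k. g (\<rho> k) (q (\<rho> k)) i) \<longlonglongrightarrow> w0 i" by blast
  define w where "w i = (if i < n then w0 i else 0)" for i
  \<comment> \<open>The mesh 2 r / (p + 1) tends to 0, so every choice of corners of the cells has
    the same limit as the lower corners.\<close>
  have near: "(\<lambda>k. g (\<rho> k) (D (\<rho> k)) j) \<longlonglongrightarrow> w j"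
    if D: "\<And>p j. j < n \<Longrightarrow> q p j \<le> D p j \<and> D p j \<le> q p j + 1" for D j
  proof (cases "j < n")
    case True
    have c: "norm (g p (D p) j - g p (q p) j) \<le> 2 * r * inverse (real (Suc p))" for p
    proof -
      have "g p (D p) j - g p (q p) j = 2 * r * (real (D p j) - real (q p j)) * inverse (real (Suc p))"
        using True by (simp add: g_def field_simps del: of_nat_Suc)
      moreover have "\<bar>real (D p j) - real (q p j)\<bar> \<le> 1" using D[OF True, of p] by linarith
      ultimately show ?thesis using r
        by (simp add: abs_mult mult_left_le_one_le mult_right_le_one_le mult_mono del: of_nat_Suc)
    qed
    have "(\<lambda>p. g p (D p) j - g p (q p) j) \<longlonglongrightarrow> 0"
      by (rule Lim_null_comparison[OF always_eventually tendsto_mult_right_zero[OF LIMSEQ_inverse_real_of_nat, of "2 * r"]])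
        (rule allI, rule c)
    from LIMSEQ_subseq_LIMSEQ[OF this \<rho>]
    have "(\<lambda>k. g (\<rho> k) (D (\<rho> k)) j - g (\<rho> k) (q (\<rho> k)) j) \<longlonglongrightarrow> 0" by (simp add: o_def)
    from tendsto_add[OF this w0[OF True]] show ?thesis using True by (simp add: w_def)
  qed (simp add: g_def w_def)
  have "F w i = 0" if i: "i < n" for i
  proof -
    have "(\<lambda>k. F (g (\<rho> k) (A (\<rho> k) i)) i) \<longlonglongrightarrow> F w i"
      by (rule cont[OF i], rule near) (use A i in auto)
    moreover have "(\<lambda>k. F (g (\<rho> k) (B (\<rho> k) i)) i) \<longlonglongrightarrow> F w i"
      by (rule cont[OF i], rule near) (use B i in auto)
    ultimately have *: "(\<lambda>k. F (g (\<rho> k) (A (\<rho> k) i)) i * F (g (\<rho> k) (B (\<rho> k) i)) i) \<longlonglongrightarrow> F w i * F w i"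
      by (rule tendsto_mult)
    \<comment> \<open>Different labels mean one positive and one nonpositive value, so the products
      are at most 0; their limit is a square.\<close>
    have "F w i * F w i \<le> 0"
    proof (rule LIMSEQ_le_const2[OF *], intro exI allI impI)
      fix k
      show "F (g (\<rho> k) (A (\<rho> k) i)) i * F (g (\<rho> k) (B (\<rho> k) i)) i \<le> 0"
        using AB[OF i, of "\<rho> k"] by (auto simp: label_def mult_le_0_iff split: if_splits)
    qed
    then show ?thesis by (metis mult_eq_0_iff order_antisym zero_le_square)
  qed
  then show ?thesis by blast
qed

text \<open>On the cube of half side r > C, each component of \<open>F\<close> has the sign of its
  coordinate on the two opposite faces, so Poincare-Miranda applies. The N vectors are encoded by
  \<open>card J\<close> real coordinates through the enumeration \<open>e\<close> of pairs of an
  index and a basis vector.\<close>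

lemma bounded_perturbation_of_id_has_zero:
  fixes F :: "(nat \<Rightarrow> 'e::euclidean_space) \<Rightarrow> nat \<Rightarrow> 'e"
  assumes cont: "\<And>i X w. i < N \<Longrightarrow> (\<And>j. (\<lambda>k. X k j) \<longlonglongrightarrow> w j) \<Longrightarrow> (\<lambda>k. F (X k) i) \<longlonglongrightarrow> F w i"
    and bd: "\<And>w j. j < N \<Longrightarrow> norm (F w j - w j) \<le> C"
  shows "\<exists>w. \<forall>j<N. F w j = 0"
proof -
  define J where "J = {..<N} \<times> (Basis :: 'e set)"
  have fJ: "finite J" by (simp add: J_def)
  obtain e where e: "bij_betw e {0..<card J} J" using ex_bij_betw_nat_finite[OF fJ] by blast
  define d where "d = the_inv_into {0..<card J} e"
  have de: "d (e i) = i" if "i < card J" for i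
    unfolding d_def using e that by (intro the_inv_into_f_f) (auto simp: bij_betw_def)
  have ed: "e (d y) = y" "d y < card J" if "y \<in> J" for y
  proof -
    show "e (d y) = y" unfolding d_def using e that
      by (intro f_the_inv_into_f) (auto simp: bij_betw_def)
    show "d y < card J" unfolding d_def using e that the_inv_into_into[of e "{0..<card J}" y "{0..<card J}"]
      by (auto simp: bij_betw_def)
  qed
  have eJ: "fst (e i) < N" "snd (e i) \<in> Basis" if "i < card J" for i
    using e that by (auto simp: bij_betw_def J_def dest!: equalityD1 subsetD[where c="e i"])
  define dec where "dec v j = (\<Sum>b\<in>Basis. v (d (j, b)) *\<^sub>R b)" for v :: "nat \<Rightarrow> real" and j
  have dec: "dec v (fst (e i)) \<bullet> snd (e i) = v i" if "i < card J" for v i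
    using that eJ[OF that] de[OF that] by (simp add: dec_def inner_sum_left inner_Basis if_distrib sum.delta cong: if_cong)
  define G where "G v i = F (dec v) (fst (e i)) \<bullet> snd (e i)" for v i
  define r where "r = \<bar>C\<bar> + 1"
  have Gv: "\<bar>G v i - v i\<bar> < r" if "i < card J" for v i
  proof -
    have "G v i - v i = (F (dec v) (fst (e i)) - dec v (fst (e i))) \<bullet> snd (e i)"
      using dec[OF that, of v] by (simp add: G_def inner_diff_left)
    also have "\<bar>\<dots>\<bar> \<le> norm (F (dec v) (fst (e i)) - dec v (fst (e i)))"
      by (rule Basis_le_norm) (use eJ[OF that] in auto)
    also have "\<dots> \<le> C" using bd eJ[OF that] by blast
    finally show ?thesis by (simp add: r_def)
  qed
  have "\<exists>v. \<forall>i<card J. G v i = 0"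
  proof (rule poincare_miranda[where r = r])
    fix i and X :: "nat \<Rightarrow> nat \<Rightarrow> real" and w
    assume i: "i < card J" and X: "\<And>j. (\<lambda>k. X k j) \<longlonglongrightarrow> w j"
    have "(\<lambda>k. F (dec (X k)) (fst (e i))) \<longlonglongrightarrow> F (dec w) (fst (e i))"
      by (rule cont) (use eJ[OF i] X in \<open>auto simp: dec_def intro!: tendsto_intros\<close>)
    then show "(\<lambda>k. G (X k) i) \<longlonglongrightarrow> G w i" unfolding G_def by (intro tendsto_intros)
  next
    show "r > 0" by (simp add: r_def)
  next
    fix w i assume "i < card J" "w i = - r"
    then show "G w i < 0" using Gv[of i w] by (simp add: abs_if split: if_splits)
  next
    fix w i assume "i < card J" "w i = r"
    then show "G w i > 0" using Gv[of i w] by (simp add: abs_if split: if_splits)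
  qed
  then obtain v where v: "\<And>i. i < card J \<Longrightarrow> G v i = 0" by blast
  have "F (dec v) j = 0" if "j < N" for j
  proof (rule euclidean_eqI)
    fix b :: 'e assume b: "b \<in> Basis"
    have jb: "(j, b) \<in> J" using that b by (simp add: J_def)
    show "F (dec v) j \<bullet> b = 0 \<bullet> b" using v[OF ed(2)[OF jb]] ed(1)[OF jb] by (simp add: G_def)
  qed
  then show ?thesis by blast
qed

section \<open>A linking principle in finite dimensions\<close>

text \<open>The family \<open>y = \<sigma> x\<close> lies above \<open>\<alpha>\<close> and has to be pushed across the space \<open>x = 0\<close>, which lies below \<open>\<beta>\<close>.\<close>

lemma linking:
  fixes f :: "(nat \<Rightarrow> 'e::euclidean_space) \<Rightarrow> (nat \<Rightarrow> 'e) \<Rightarrow> real"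
    and gx gy :: "(nat \<Rightarrow> 'e) \<Rightarrow> (nat \<Rightarrow> 'e) \<Rightarrow> nat \<Rightarrow> 'e"
    and \<sigma> :: "(nat \<Rightarrow> 'e) \<Rightarrow> nat \<Rightarrow> 'e" and \<mu> :: "nat \<Rightarrow> real"
  assumes cont: "\<And>j X Y x y. (\<And>i. (\<lambda>k. X k i) \<longlonglongrightarrow> x i) \<Longrightarrow> (\<And>i. (\<lambda>k. Y k i) \<longlonglongrightarrow> y i) \<Longrightarrow>
        (\<lambda>k. gx (X k) (Y k) j) \<longlonglongrightarrow> gx x y j"
      "\<And>j X Y x y. (\<And>i. (\<lambda>k. X k i) \<longlonglongrightarrow> x i) \<Longrightarrow> (\<And>i. (\<lambda>k. Y k i) \<longlonglongrightarrow> y i) \<Longrightarrow>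
        (\<lambda>k. gy (X k) (Y k) j) \<longlonglongrightarrow> gy x y j"
      "\<And>j X x. (\<And>i. (\<lambda>k. X k i) \<longlonglongrightarrow> x i) \<Longrightarrow> (\<lambda>k. \<sigma> (X k) j) \<longlonglongrightarrow> \<sigma> x j"
    and ascent: "\<epsilon> > 0" "\<And>x y. f (\<lambda>j. x j + \<epsilon> *\<^sub>R gx x y j) (\<lambda>j. y j + \<epsilon> *\<^sub>R gy x y j)
        \<ge> f x y + \<epsilon> / 2 * (\<Sum>j<N. (norm (gx x y j))\<^sup>2 + (norm (gy x y j))\<^sup>2)"
    and lin: "\<And>j. \<mu> j \<ge> 0" "\<And>x y j. j < N \<Longrightarrow> norm (gx x y j - \<mu> j *\<^sub>R x j) \<le> C"
    and low: "\<And>x. f x (\<sigma> x) \<ge> \<alpha>"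
    and high: "\<And>x y. (\<And>j. j < N \<Longrightarrow> x j = 0) \<Longrightarrow> f x y \<le> \<beta>"
    and \<delta>: "\<delta> > 0"
  shows "\<exists>x y. f x y \<ge> \<alpha> \<and> (\<forall>j<N. norm (gx x y j) \<le> \<delta> \<and> norm (gy x y j) \<le> \<delta>)"
proof (rule ccontr)
  assume neg: "\<not> ?thesis"
  define S where "S x y = (\<Sum>j<N. (norm (gx x y j))\<^sup>2 + (norm (gy x y j))\<^sup>2)" for x y
  \<comment> \<open>Here the negated conclusion enters: above the level \<alpha> some component of
    the gradient exceeds \<delta>, so every ascent step gains a fixed amount.\<close>
  have S: "S x y \<ge> \<delta>\<^sup>2" if "f x y \<ge> \<alpha>" for x y
  proof -
    obtain j where j: "j < N" "norm (gx x y j) > \<delta> \<or> norm (gy x y j) > \<delta>"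
      using neg \<open>f x y \<ge> \<alpha>\<close> by (meson not_le)
    have "\<delta>\<^sup>2 \<le> (norm (gx x y j))\<^sup>2 + (norm (gy x y j))\<^sup>2"
      using j(2)
    proof
      assume "norm (gx x y j) > \<delta>"
      then have "\<delta>\<^sup>2 \<le> (norm (gx x y j))\<^sup>2" using \<delta> by (intro power_mono) auto
      then show ?thesis by (simp add: add_increasing2)
    next
      assume "norm (gy x y j) > \<delta>"
      then have "\<delta>\<^sup>2 \<le> (norm (gy x y j))\<^sup>2" using \<delta> by (intro power_mono) auto
      then show ?thesis by (simp add: add_increasing)
    qed
    also have "\<dots> \<le> S x y" unfolding S_def
      by (rule member_le_sum) (use j in auto)
    finally show ?thesis .
  qed
  define step where "step z = ((\<lambda>j. fst z j + \<epsilon> *\<^sub>R gx (fst z) (snd z) j),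
    (\<lambda>j. snd z j + \<epsilon> *\<^sub>R gy (fst z) (snd z) j))" for z :: "(nat \<Rightarrow> 'e) \<times> (nat \<Rightarrow> 'e)"
  define T where "T k x = (step ^^ k) (x, \<sigma> x)" for k x
  have T_Suc: "T (Suc k) x = step (T k x)" for k x by (simp add: T_def)
  have T_0: "T 0 x = (x, \<sigma> x)" for x by (simp add: T_def)
  have fT: "f (fst (T k x)) (snd (T k x)) \<ge> \<alpha> + real k * (\<epsilon> / 2 * \<delta>\<^sup>2)" for k x
  proof (induction k)
    case 0 then show ?case using low by (simp add: T_0)
  next
    case (Suc k)
    have "f (fst (T k x)) (snd (T k x)) \<ge> \<alpha>"
      using Suc ascent(1) by (smt (verit) divide_nonneg_nonneg mult_nonneg_nonneg of_nat_0_le_iff zero_le_power2)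
    then have "\<epsilon> / 2 * S (fst (T k x)) (snd (T k x)) \<ge> \<epsilon> / 2 * \<delta>\<^sup>2"
      using S ascent(1) by (intro mult_left_mono) auto
    moreover have "f (fst (T (Suc k) x)) (snd (T (Suc k) x))
       \<ge> f (fst (T k x)) (snd (T k x)) + \<epsilon> / 2 * S (fst (T k x)) (snd (T k x))"
      using ascent(2)[of "fst (T k x)" "snd (T k x)"] by (simp add: T_Suc step_def S_def)
    moreover have "real (Suc k) * (\<epsilon> / 2 * \<delta>\<^sup>2) = real k * (\<epsilon> / 2 * \<delta>\<^sup>2) + \<epsilon> / 2 * \<delta>\<^sup>2"
      by (simp add: algebra_simps)
    ultimately show ?case using Suc by linarith
  qed
  have Tcont: "(\<forall>j. (\<lambda>n. fst (T k (X n)) j) \<longlonglongrightarrow> fst (T k x) j) \<and>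
               (\<forall>j. (\<lambda>n. snd (T k (X n)) j) \<longlonglongrightarrow> snd (T k x) j)"
    if "\<And>i. (\<lambda>n. X n i) \<longlonglongrightarrow> x i" for X x k
  proof (induction k)
    case 0 show ?case using that cont(3)[OF that] by (simp add: T_0)
  next
    case (Suc k)
    then show ?case unfolding T_Suc step_def fst_conv snd_conv
      by (intro conjI allI tendsto_intros cont) auto
  qed
  define \<nu> where "\<nu> j = 1 + \<epsilon> * \<mu> j" for j
  have \<nu>: "\<nu> j \<ge> 1" for j using ascent(1) lin(1)[of j] by (simp add: \<nu>_def)
  have C: "C \<ge> 0" if "j < N" for j using lin(2)[OF that] norm_ge_zero order_trans by blast
  \<comment> \<open>Each step multiplies the first component by \<nu> up to an error
    \<open>\<epsilon> * C\<close>. Since \<nu> is at least 1, the accumulated error relative to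
    \<nu>^k grows only linearly in k.\<close>
  have Tlin: "norm (fst (T k x) j - (\<nu> j ^ k) *\<^sub>R x j) \<le> \<nu> j ^ k * (real k * \<epsilon> * C)" if j: "j < N" for k x j
  proof (induction k)
    case 0 then show ?case by (simp add: T_0)
  next
    case (Suc k)
    let ?x = "fst (T k x)" and ?y = "snd (T k x)"
    have "fst (T (Suc k) x) j - (\<nu> j ^ Suc k) *\<^sub>R x j
        = \<nu> j *\<^sub>R (?x j - (\<nu> j ^ k) *\<^sub>R x j) + \<epsilon> *\<^sub>R (gx ?x ?y j - \<mu> j *\<^sub>R ?x j)"
      by (simp add: T_Suc step_def \<nu>_def algebra_simps)
    also have "norm \<dots> \<le> \<nu> j * norm (?x j - (\<nu> j ^ k) *\<^sub>R x j) + \<epsilon> * norm (gx ?x ?y j - \<mu> j *\<^sub>R ?x j)"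
      using norm_triangle_ineq[of "\<nu> j *\<^sub>R (?x j - (\<nu> j ^ k) *\<^sub>R x j)" "\<epsilon> *\<^sub>R (gx ?x ?y j - \<mu> j *\<^sub>R ?x j)"]
        \<nu>[of j] ascent(1) by simp
    also have "\<dots> \<le> \<nu> j * (\<nu> j ^ k * (real k * \<epsilon> * C)) + \<epsilon> * C"
      using Suc lin(2)[OF j] \<nu>[of j] ascent(1) by (intro add_mono mult_left_mono) auto
    also have "\<dots> \<le> \<nu> j * (\<nu> j ^ k * (real k * \<epsilon> * C)) + \<nu> j ^ Suc k * (\<epsilon> * C)"
    proof -
      have "1 * (\<epsilon> * C) \<le> \<nu> j ^ Suc k * (\<epsilon> * C)"
        by (rule mult_right_mono) (use \<nu>[of j] ascent(1) C[OF j] in \<open>auto intro: one_le_power simp del: power_Suc\<close>)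
      then show ?thesis by simp
    qed
    also have "\<dots> = \<nu> j ^ Suc k * (real (Suc k) * \<epsilon> * C)" by (simp add: algebra_simps)
    finally show ?case .
  qed
  \<comment> \<open>After this many steps the whole family lies strictly above \<beta>.\<close>
  obtain k :: nat where k: "real k * (\<epsilon> / 2 * \<delta>\<^sup>2) > \<beta> - \<alpha>"
  proof -
    have "\<epsilon> / 2 * \<delta>\<^sup>2 > 0" using ascent(1) \<delta> by simp
    from reals_Archimedean3[OF this] show ?thesis using that by blast
  qed
  \<comment> \<open>Divided by \<nu>^k, the first component is a bounded perturbation of the
    identity in x. Its zero is a point of the pushed family that lies in the space
    \<open>x = 0\<close>, where \<open>high\<close> contradicts the gain.\<close>
  have "\<exists>x. \<forall>j<N. inverse (\<nu> j ^ k) *\<^sub>R fst (T k x) j = 0"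
  proof (rule bounded_perturbation_of_id_has_zero)
    fix i and X :: "nat \<Rightarrow> nat \<Rightarrow> 'e" and x assume "\<And>j. (\<lambda>n. X n j) \<longlonglongrightarrow> x j"
    from Tcont[OF this] show "(\<lambda>n. inverse (\<nu> i ^ k) *\<^sub>R fst (T k (X n)) i) \<longlonglongrightarrow> inverse (\<nu> i ^ k) *\<^sub>R fst (T k x) i"
      by (intro tendsto_intros) auto
  next
    fix x j assume j: "j < N"
    have pos: "\<nu> j ^ k > 0" using \<nu>[of j] by simp
    have "inverse (\<nu> j ^ k) *\<^sub>R fst (T k x) j - x j = inverse (\<nu> j ^ k) *\<^sub>R (fst (T k x) j - (\<nu> j ^ k) *\<^sub>R x j)"
      using \<nu>[of j] by (simp add: scaleR_diff_right)
    then have "norm (inverse (\<nu> j ^ k) *\<^sub>R fst (T k x) j - x j)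
        = inverse (\<nu> j ^ k) * norm (fst (T k x) j - (\<nu> j ^ k) *\<^sub>R x j)"
      using pos by simp
    also have "\<dots> \<le> inverse (\<nu> j ^ k) * (\<nu> j ^ k * (real k * \<epsilon> * C))"
      using Tlin[OF j, of k x] pos by (intro mult_left_mono) auto
    also have "\<dots> = real k * \<epsilon> * C" using \<nu>[of j] by (auto simp: field_simps)
    finally show "norm (inverse (\<nu> j ^ k) *\<^sub>R fst (T k x) j - x j) \<le> real k * \<epsilon> * C" .
  qed
  then obtain x where x: "\<And>j. j < N \<Longrightarrow> inverse (\<nu> j ^ k) *\<^sub>R fst (T k x) j = 0" by blast
  have "fst (T k x) j = 0" if "j < N" for j using x[OF that] \<nu>[of j] by auto
  then have "f (fst (T k x)) (snd (T k x)) \<le> \<beta>" by (rule high)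
  then show False using fT[where k=k and x=x] k by linarith
qed

text \<open>The first-order gain of a step is \<epsilon> G, with G the squared length of the
  gradient. By the mean value theorem the true gain falls short of it by at most
  \<open>K * m * m\<close>, where m is the sum of the lengths of all displacements, and m^2 is at
  most 2 N \<epsilon>^2 G. The choice of \<epsilon> bounds this loss by half of the gain. A
  Lipschitz gradient is all there is to work with, because the barrier is not twice
  differentiable.\<close>

lemma gradient_ascent_step:
  fixes f :: "(nat \<Rightarrow> 'e::euclidean_space) \<Rightarrow> (nat \<Rightarrow> 'e) \<Rightarrow> real"
  assumes der: "\<And>x y dx dy. ((\<lambda>\<tau>. f (\<lambda>j. x j + \<tau> *\<^sub>R dx j) (\<lambda>j. y j + \<tau> *\<^sub>R dy j)) has_real_derivative
       (\<Sum>j<N. gx x y j \<bullet> dx j + gy x y j \<bullet> dy j)) (at 0)"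
    and lip: "\<And>x y dx dy j. j < N \<Longrightarrow> norm (gx (\<lambda>j. x j + dx j) (\<lambda>j. y j + dy j) j - gx x y j) \<le> K * (\<Sum>j<N. norm (dx j) + norm (dy j))"
      "\<And>x y dx dy j. j < N \<Longrightarrow> norm (gy (\<lambda>j. x j + dx j) (\<lambda>j. y j + dy j) j - gy x y j) \<le> K * (\<Sum>j<N. norm (dx j) + norm (dy j))"
    and K: "K \<ge> 0"
  shows "\<exists>\<epsilon>>0. \<forall>x y. f (\<lambda>j. x j + \<epsilon> *\<^sub>R gx x y j) (\<lambda>j. y j + \<epsilon> *\<^sub>R gy x y j)
        \<ge> f x y + \<epsilon> / 2 * (\<Sum>j<N. (norm (gx x y j))\<^sup>2 + (norm (gy x y j))\<^sup>2)"
proof -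
  define \<epsilon> where "\<epsilon> = 1 / (2 * (K * (2 * real N) + 1))"
  have den: "K * (2 * real N) + 1 > 0" using K by (simp add: add_nonneg_pos)
  have \<epsilon>: "\<epsilon> > 0" "K * (2 * real N) * \<epsilon> \<le> 1/2"
    using den by (auto simp: \<epsilon>_def field_simps)
  have "f (\<lambda>j. x j + \<epsilon> *\<^sub>R gx x y j) (\<lambda>j. y j + \<epsilon> *\<^sub>R gy x y j)
        \<ge> f x y + \<epsilon> / 2 * (\<Sum>j<N. (norm (gx x y j))\<^sup>2 + (norm (gy x y j))\<^sup>2)" for x y
  proof -
    define dx where "dx j = \<epsilon> *\<^sub>R gx x y j" for j
    define dy where "dy j = \<epsilon> *\<^sub>R gy x y j" for j
    define G where "G = (\<Sum>j<N. (norm (gx x y j))\<^sup>2 + (norm (gy x y j))\<^sup>2)"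
    define m where "m = (\<Sum>j<N. norm (dx j) + norm (dy j))"
    define \<theta> where "\<theta> \<tau> = f (\<lambda>j. x j + \<tau> *\<^sub>R dx j) (\<lambda>j. y j + \<tau> *\<^sub>R dy j)" for \<tau>
    define D where "D \<tau> = (\<Sum>j<N. gx (\<lambda>j. x j + \<tau> *\<^sub>R dx j) (\<lambda>j. y j + \<tau> *\<^sub>R dy j) j \<bullet> dx j
       + gy (\<lambda>j. x j + \<tau> *\<^sub>R dx j) (\<lambda>j. y j + \<tau> *\<^sub>R dy j) j \<bullet> dy j)" for \<tau>
    have "(\<theta> has_real_derivative D \<tau>) (at \<tau>)" for \<tau>
    proof -
      have "((\<lambda>s. \<theta> (s + \<tau>)) has_real_derivative D \<tau>) (at 0)"
        using der[of "\<lambda>j. x j + \<tau> *\<^sub>R dx j" dx "\<lambda>j. y j + \<tau> *\<^sub>R dy j" dy]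
        by (simp add: \<theta>_def D_def algebra_simps)
      then show ?thesis using DERIV_shift[of \<theta> "D \<tau>" 0 \<tau>] by simp
    qed
    then obtain \<tau> where \<tau>: "0 < \<tau>" "\<tau> < 1" "\<theta> 1 - \<theta> 0 = D \<tau>"
      using MVT2[of 0 1 \<theta> D] by auto
    have m0: "m \<ge> 0" unfolding m_def by (intro sum_nonneg) auto
    have mj: "norm (dx j) + norm (dy j) \<le> m" if "j < N" for j
      unfolding m_def by (rule member_le_sum[of j "{..<N}" "\<lambda>j. norm (dx j) + norm (dy j)"]) (use that in auto)
    have "(\<Sum>j<N. norm (\<tau> *\<^sub>R dx j) + norm (\<tau> *\<^sub>R dy j)) = \<tau> * m"
      using \<tau> by (simp add: m_def sum_distrib_left algebra_simps)
    also have "\<dots> \<le> m" using \<tau> m0 by (simp add: mult_left_le_one_le)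
    finally have "K * (\<Sum>j<N. norm (\<tau> *\<^sub>R dx j) + norm (\<tau> *\<^sub>R dy j)) \<le> K * m" using K by (rule mult_left_mono)
    then have gl: "norm (gx (\<lambda>j. x j + \<tau> *\<^sub>R dx j) (\<lambda>j. y j + \<tau> *\<^sub>R dy j) j - gx x y j) \<le> K * m"
       "norm (gy (\<lambda>j. x j + \<tau> *\<^sub>R dx j) (\<lambda>j. y j + \<tau> *\<^sub>R dy j) j - gy x y j) \<le> K * m" if "j < N" for j
      using lip(1)[OF that, of x "\<lambda>j. \<tau> *\<^sub>R dx j" y "\<lambda>j. \<tau> *\<^sub>R dy j"]
        lip(2)[OF that, of x "\<lambda>j. \<tau> *\<^sub>R dx j" y "\<lambda>j. \<tau> *\<^sub>R dy j"] by auto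
    have inn: "a \<bullet> d \<ge> b \<bullet> d - K * m * norm d" if "norm (a - b) \<le> K * m" for a b d :: 'e
    proof -
      have "\<bar>(a - b) \<bullet> d\<bar> \<le> norm (a - b) * norm d" by (rule Cauchy_Schwarz_ineq2)
      also have "\<dots> \<le> K * m * norm d" using that by (rule mult_right_mono) simp
      finally show ?thesis by (simp add: inner_diff_left abs_le_iff)
    qed
    have "D \<tau> \<ge> (\<Sum>j<N. (gx x y j \<bullet> dx j + gy x y j \<bullet> dy j) - K * m * (norm (dx j) + norm (dy j)))"
      unfolding D_def
    proof (rule sum_mono)
      fix j assume "j \<in> {..<N}"
      then show "(gx x y j \<bullet> dx j + gy x y j \<bullet> dy j) - K * m * (norm (dx j) + norm (dy j))
        \<le> gx (\<lambda>j. x j + \<tau> *\<^sub>R dx j) (\<lambda>j. y j + \<tau> *\<^sub>R dy j) j \<bullet> dx j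
       + gy (\<lambda>j. x j + \<tau> *\<^sub>R dx j) (\<lambda>j. y j + \<tau> *\<^sub>R dy j) j \<bullet> dy j"
        using inn[OF gl(1), of j "dx j"] inn[OF gl(2), of j "dy j"] by (simp add: algebra_simps)
    qed
    also have "(\<Sum>j<N. (gx x y j \<bullet> dx j + gy x y j \<bullet> dy j) - K * m * (norm (dx j) + norm (dy j)))
       = (\<Sum>j<N. gx x y j \<bullet> dx j + gy x y j \<bullet> dy j) - K * m * m"
      by (simp only: sum_subtractf sum_distrib_left[symmetric] m_def[symmetric])
    also have "(\<Sum>j<N. gx x y j \<bullet> dx j + gy x y j \<bullet> dy j) = \<epsilon> * G"
      by (simp add: dx_def dy_def G_def power2_norm_eq_inner sum_distrib_left distrib_left)
    finally have D: "D \<tau> \<ge> \<epsilon> * G - K * m * m" .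
    have sq: "(a + b)\<^sup>2 \<le> 2 * (a\<^sup>2 + b\<^sup>2)" for a b :: real
      using sum_squares_bound[of a b] by (simp add: power2_sum algebra_simps)
    have "m\<^sup>2 \<le> (\<Sum>j<N. (norm (dx j) + norm (dy j))\<^sup>2) * real N"
      unfolding m_def using sum_squared_le_sum_of_squares[of "\<lambda>j. norm (dx j) + norm (dy j)" "{..<N}"]
      by (simp add: mult.commute)
    also have "\<dots> \<le> (\<Sum>j<N. 2 * ((norm (dx j))\<^sup>2 + (norm (dy j))\<^sup>2)) * real N"
      by (intro mult_right_mono sum_mono sq) simp
    also have "\<dots> = 2 * real N * \<epsilon>\<^sup>2 * G"
      by (simp add: dx_def dy_def G_def sum_distrib_left sum_distrib_right power_mult_distrib algebra_simps)
    finally have "K * m\<^sup>2 \<le> K * (2 * real N * \<epsilon>\<^sup>2 * G)" using K by (rule mult_left_mono)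
    also have "\<dots> = (K * (2 * real N) * \<epsilon>) * (\<epsilon> * G)" by (simp add: power2_eq_square algebra_simps)
    also have "\<dots> \<le> 1/2 * (\<epsilon> * G)"
      by (rule mult_right_mono[OF \<epsilon>(2)]) (use \<epsilon> in \<open>auto simp: G_def intro!: mult_nonneg_nonneg sum_nonneg\<close>)
    finally have "\<theta> 1 - \<theta> 0 \<ge> \<epsilon> / 2 * G" using D \<tau>(3) by (simp add: power2_eq_square algebra_simps)
    then show ?thesis by (simp add: \<theta>_def dx_def dy_def G_def)
  qed
  then show ?thesis using \<epsilon>(1) by blast
qed

section \<open>Discretised Hamilton equations\<close>

text \<open>The position q_j contains the increments of all earlier steps, so the gradient with
  respect to the increment of step i collects the q-derivatives at all later times. These are the
  tail sums in the gradient of the discrete action.\<close>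

lemma sum_by_parts_tail:
  fixes B v :: "nat \<Rightarrow> 'e::real_inner"
  shows "(\<Sum>j<Suc M. B j \<bullet> (\<Sum>i<j. v i)) = (\<Sum>i<M. (\<Sum>j\<in>{i<..<Suc M}. B j) \<bullet> v i)"
proof -
  have "(\<Sum>j<Suc M. B j \<bullet> (\<Sum>i<j. v i)) = (\<Sum>j<Suc M. \<Sum>i<M. if i < j then B j \<bullet> v i else 0)"
  proof (rule sum.cong[OF refl])
    fix j assume j: "j \<in> {..<Suc M}"
    have "(\<Sum>i<M. if i < j then B j \<bullet> v i else 0) = (\<Sum>i\<in>{..<M} \<inter> {i. i < j}. B j \<bullet> v i)"
      by (simp add: sum.inter_restrict)
    also have "{..<M} \<inter> {i. i < j} = {..<j}" using j by auto
    finally show "B j \<bullet> (\<Sum>i<j. v i) = (\<Sum>i<M. if i < j then B j \<bullet> v i else 0)"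
      by (simp add: inner_sum_right)
  qed
  also have "\<dots> = (\<Sum>i<M. \<Sum>j<Suc M. if i < j then B j \<bullet> v i else 0)" by (rule sum.swap)
  also have "\<dots> = (\<Sum>i<M. (\<Sum>j\<in>{i<..<Suc M}. B j) \<bullet> v i)"
  proof (rule sum.cong[OF refl])
    fix i
    have "(\<Sum>j<Suc M. if i < j then B j \<bullet> v i else 0) = (\<Sum>j\<in>{..<Suc M} \<inter> {j. i < j}. B j \<bullet> v i)"
      by (simp add: sum.inter_restrict del: sum.lessThan_Suc)
    also have "{..<Suc M} \<inter> {j. i < j} = {i<..<Suc M}" by auto
    finally show "(\<Sum>j<Suc M. if i < j then B j \<bullet> v i else 0) = (\<Sum>j\<in>{i<..<Suc M}. B j) \<bullet> v i"
      by (simp add: inner_sum_left)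
  qed
  finally show ?thesis .
qed

text \<open>
  With \<open>M = N - 1\<close>, the free variables are \<open>p\<^sub>M\<close>, \<open>q\<^sub>0\<close> and, for \<open>j < M\<close>, the vectors \<open>x\<^sub>j\<close>, \<open>y\<^sub>j\<close> with
  \<open>q\<^bsub>j+1\<^esub> - q\<^sub>j = x\<^sub>j + y\<^sub>j\<close> and \<open>p\<^sub>j - p\<^sub>M = y\<^sub>j - x\<^sub>j\<close>.  They diagonalise the discretised \<open>- \<integral> p \<bullet> q'\<close>, which becomes
  \<open>\<Sum>\<^sub>j \<bar>x\<^sub>j\<bar>\<^sup>2 - \<bar>y\<^sub>j\<bar>\<^sup>2\<close> minus \<open>p\<^sub>M \<bullet> w\<close>.  The indices of \<open>P\<close> are shifted: \<open>P (Suc j)\<close> is \<open>p\<^sub>j\<close>.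
\<close>

lemma discrete_orbit:
  fixes H :: "real \<Rightarrow> 'e::euclidean_space \<Rightarrow> 'e \<Rightarrow> real" and Hp Hq :: "real \<Rightarrow> 'e \<Rightarrow> 'e \<Rightarrow> 'e"
    and w U :: 'e and N :: nat and h :: real
  defines "h \<equiv> 1 / real N"
  assumes der: "\<And>t p q. ((\<lambda>z. H t (fst z) (snd z)) has_derivative (\<lambda>z. Hp t p q \<bullet> fst z + Hq t p q \<bullet> snd z)) (at (p, q))"
    and lip: "\<And>t p q p' q'. norm (Hp t p q - Hp t p' q') \<le> L * (norm (p - p') + norm (q - q'))"
      "\<And>t p q p' q'. norm (Hq t p q - Hq t p' q') \<le> L * (norm (p - p') + norm (q - q'))"
    and L: "L \<ge> 0"
    and bd: "\<And>t p q. norm (Hp t p q) \<le> C" "\<And>t p q. norm (Hq t p q) \<le> C"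
    and low: "\<And>t q. H t U q \<ge> c"
    and up: "\<And>t p q. H t p q - p \<bullet> w \<le> B"
    and N: "N > 0"
  shows "\<exists>P Q. P N = P 0 \<and> Q N = Q 0 + w \<and>
     (\<forall>j<N. norm (P (Suc j) - P j + h *\<^sub>R Hq (j * h) (P (Suc j)) (Q j)) \<le> h\<^sup>2) \<and>
     (\<forall>j<N. norm (Q (Suc j) - Q j - h *\<^sub>R Hp (j * h) (P (Suc j)) (Q j)) \<le> h\<^sup>2) \<and>
     (\<Sum>j<N. h * H (j * h) (P (Suc j)) (Q j) - P (Suc j) \<bullet> (Q (Suc j) - Q j)) \<ge> c - U \<bullet> w"
proof -

  \<comment> \<open>The discrete action in diagonal variables\<close>
  obtain M where NM: "N = Suc M" using N by (cases N) auto
  have h: "h > 0" "h * real N = 1" "h \<le> 1" using N by (auto simp: h_def)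
  \<comment> \<open>Slot M of \<open>X\<close> stores q_0 and slot M of \<open>Y\<close> stores p_M;
    the slots below M store x_j and y_j.\<close>
  define p where "p X Y j = (if j < M then Y M + Y j - X j else Y M)" for X Y :: "nat \<Rightarrow> 'e" and j
  define q where "q X Y j = X M + (\<Sum>i<j. X i + Y i)" for X Y :: "nat \<Rightarrow> 'e" and j
  define A where "A X Y j = Hp (j * h) (p X Y j) (q X Y j)" for X Y and j :: nat
  define Bq where "Bq X Y j = Hq (j * h) (p X Y j) (q X Y j)" for X Y and j :: nat
  \<comment> \<open>The last increment of q is w minus the sum of the others, because the loop
    closes up to w. Hence the products of p_M with x_j + y_j cancel, and only the squares and
    \<open>- Y M \<bullet> w\<close> remain of the discretised integral.\<close>
  define f where "f X Y = (\<Sum>j<M. (X j \<bullet> X j) - (Y j \<bullet> Y j)) - Y M \<bullet> w + h * (\<Sum>j<N. H (j * h) (p X Y j) (q X Y j))"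
    for X Y :: "nat \<Rightarrow> 'e"
  \<comment> \<open>The partial gradients of \<open>f\<close> in the slots of \<open>X\<close> and
    \<open>Y\<close>, with the default 0 above M.\<close>
  define gX where "gX X Y j = (if j < M then 2 *\<^sub>R X j - h *\<^sub>R A X Y j + h *\<^sub>R (\<Sum>i\<in>{j<..<N}. Bq X Y i)
     else if j = M then h *\<^sub>R (\<Sum>i<N. Bq X Y i) else 0)" for X Y j
  define gY where "gY X Y j = (if j < M then - (2 *\<^sub>R Y j) + h *\<^sub>R A X Y j + h *\<^sub>R (\<Sum>i\<in>{j<..<N}. Bq X Y i)
     else if j = M then - w + h *\<^sub>R (\<Sum>i<N. A X Y i) else 0)" for X Y j
  have pcont: "(\<lambda>k. p (X k) (Y k) j) \<longlonglongrightarrow> p x y j" and qcont: "(\<lambda>k. q (X k) (Y k) j) \<longlonglongrightarrow> q x y j"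
    if "\<And>i. (\<lambda>k. X k i) \<longlonglongrightarrow> x i" "\<And>i. (\<lambda>k. Y k i) \<longlonglongrightarrow> y i" for X Y x y j
    using that by (auto simp: p_def q_def intro!: tendsto_intros)
  have Gcont: "(\<lambda>k. G t (a k) (b k)) \<longlonglongrightarrow> G t a' b'"
    if G: "\<And>t p q p' q'. norm (G t p q - G t p' q') \<le> L * (norm (p - p') + norm (q - q'))"
      and ab: "a \<longlonglongrightarrow> a'" "b \<longlonglongrightarrow> b'" for G :: "real \<Rightarrow> 'e \<Rightarrow> 'e \<Rightarrow> 'e" and t a b a' b'
  proof -
    have "(\<lambda>k. L * (norm (a k - a') + norm (b k - b'))) \<longlonglongrightarrow> L * (norm (a' - a') + norm (b' - b'))"
      by (intro tendsto_intros ab)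
    then have "(\<lambda>k. G t (a k) (b k) - G t a' b') \<longlonglongrightarrow> 0"
      by (intro Lim_null_comparison[OF always_eventually[OF allI[OF G]]]) simp
    then show ?thesis by (rule LIM_zero_cancel)
  qed
  have Acont: "(\<lambda>k. A (X k) (Y k) j) \<longlonglongrightarrow> A x y j" and Bcont: "(\<lambda>k. Bq (X k) (Y k) j) \<longlonglongrightarrow> Bq x y j"
    if "\<And>i. (\<lambda>k. X k i) \<longlonglongrightarrow> x i" "\<And>i. (\<lambda>k. Y k i) \<longlonglongrightarrow> y i" for X Y x y j
    unfolding A_def Bq_def by (intro Gcont[OF lip(1)] Gcont[OF lip(2)] pcont qcont that)+
  have fder: "((\<lambda>\<tau>. f (\<lambda>j. X j + \<tau> *\<^sub>R dX j) (\<lambda>j. Y j + \<tau> *\<^sub>R dY j)) has_real_derivative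
       (\<Sum>j<N. gX X Y j \<bullet> dX j + gY X Y j \<bullet> dY j)) (at 0)" for X Y dX dY
  proof -
    define dp where "dp j = (if j < M then dY M + dY j - dX j else dY M)" for j
    define dq where "dq j = dX M + (\<Sum>i<j. dX i + dY i)" for j
    have p\<tau>: "p (\<lambda>j. X j + \<tau> *\<^sub>R dX j) (\<lambda>j. Y j + \<tau> *\<^sub>R dY j) j = p X Y j + \<tau> *\<^sub>R dp j" for \<tau> j
      by (simp add: p_def dp_def algebra_simps)
    have q\<tau>: "q (\<lambda>j. X j + \<tau> *\<^sub>R dX j) (\<lambda>j. Y j + \<tau> *\<^sub>R dY j) j = q X Y j + \<tau> *\<^sub>R dq j" for \<tau> j
      by (simp add: q_def dq_def algebra_simps sum.distrib scaleR_sum_right)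
    have Hder: "((\<lambda>\<tau>. H (j * h) (p X Y j + \<tau> *\<^sub>R dp j) (q X Y j + \<tau> *\<^sub>R dq j)) has_real_derivative
        A X Y j \<bullet> dp j + Bq X Y j \<bullet> dq j) (at 0)" for j :: nat
    proof -
      have "((\<lambda>\<tau>. (p X Y j + \<tau> *\<^sub>R dp j, q X Y j + \<tau> *\<^sub>R dq j)) has_derivative (\<lambda>\<tau>. (\<tau> *\<^sub>R dp j, \<tau> *\<^sub>R dq j))) (at 0)"
        by (auto intro!: derivative_eq_intros)
      moreover have "((\<lambda>z. H (j * h) (fst z) (snd z)) has_derivative (\<lambda>z. A X Y j \<bullet> fst z + Bq X Y j \<bullet> snd z))
          (at (p X Y j + 0 *\<^sub>R dp j, q X Y j + 0 *\<^sub>R dq j))"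
        using der by (simp add: A_def Bq_def)
      ultimately have "((\<lambda>z. H (j * h) (fst z) (snd z)) \<circ> (\<lambda>\<tau>. (p X Y j + \<tau> *\<^sub>R dp j, q X Y j + \<tau> *\<^sub>R dq j)) has_derivative
          (\<lambda>z. A X Y j \<bullet> fst z + Bq X Y j \<bullet> snd z) \<circ> (\<lambda>\<tau>. (\<tau> *\<^sub>R dp j, \<tau> *\<^sub>R dq j))) (at 0)"
        by (rule diff_chain_at)
      moreover have "(\<lambda>z. A X Y j \<bullet> fst z + Bq X Y j \<bullet> snd z) \<circ> (\<lambda>\<tau>. (\<tau> *\<^sub>R dp j, \<tau> *\<^sub>R dq j))
          = (*) (A X Y j \<bullet> dp j + Bq X Y j \<bullet> dq j)"
        by (auto simp: fun_eq_iff algebra_simps)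
      ultimately show ?thesis
        by (simp only: has_field_derivative_def o_def fst_conv snd_conv)
    qed
    have in2: "((\<lambda>\<tau>. (a + \<tau> *\<^sub>R d) \<bullet> (a + \<tau> *\<^sub>R d)) has_real_derivative 2 * (a \<bullet> d)) (at 0)" for a d :: 'e
      by (auto simp: inner_add_left inner_add_right inner_commute intro!: derivative_eq_intros)
    have in1: "((\<lambda>\<tau>. (a + \<tau> *\<^sub>R d) \<bullet> w) has_real_derivative d \<bullet> w) (at 0)" for a d :: 'e
      by (auto simp: inner_add_left intro!: derivative_eq_intros)
    have "((\<lambda>\<tau>. f (\<lambda>j. X j + \<tau> *\<^sub>R dX j) (\<lambda>j. Y j + \<tau> *\<^sub>R dY j)) has_real_derivative
       (\<Sum>j<M. 2 * (X j \<bullet> dX j) - 2 * (Y j \<bullet> dY j)) - dY M \<bullet> w + h * (\<Sum>j<N. A X Y j \<bullet> dp j + Bq X Y j \<bullet> dq j)) (at 0)"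
      unfolding f_def p\<tau> q\<tau>
      by (intro DERIV_add DERIV_diff DERIV_sum DERIV_cmult in1 in2 Hder)
    also have "(\<Sum>j<M. 2 * (X j \<bullet> dX j) - 2 * (Y j \<bullet> dY j)) - dY M \<bullet> w + h * (\<Sum>j<N. A X Y j \<bullet> dp j + Bq X Y j \<bullet> dq j)
        = (\<Sum>j<N. gX X Y j \<bullet> dX j + gY X Y j \<bullet> dY j)"
    proof -
      let ?A = "A X Y" and ?B = "Bq X Y"
      have 1: "(\<Sum>j<N. ?A j \<bullet> dp j) = (\<Sum>j<N. ?A j) \<bullet> dY M + (\<Sum>j<M. ?A j \<bullet> dY j - ?A j \<bullet> dX j)"
        by (simp add: NM dp_def inner_sum_left inner_add_left inner_diff_right inner_add_right sum.distrib sum_subtractf)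
      have 2: "(\<Sum>j<N. ?B j \<bullet> dq j) = (\<Sum>j<N. ?B j) \<bullet> dX M + (\<Sum>i<M. (\<Sum>j\<in>{i<..<N}. ?B j) \<bullet> (dX i + dY i))"
        unfolding dq_def inner_add_right sum.distrib inner_sum_left[symmetric]
        using sum_by_parts_tail[of ?B "\<lambda>i. dX i + dY i" M]
        by (simp add: NM inner_add_right sum.distrib del: sum.lessThan_Suc)
      have 3: "(\<Sum>j<N. gX X Y j \<bullet> dX j + gY X Y j \<bullet> dY j) = (\<Sum>j<M. gX X Y j \<bullet> dX j + gY X Y j \<bullet> dY j)
          + (h * ((\<Sum>i<N. ?B i) \<bullet> dX M) - w \<bullet> dY M + h * ((\<Sum>i<N. ?A i) \<bullet> dY M))"
      proof -
        have "(\<Sum>j<N. gX X Y j \<bullet> dX j + gY X Y j \<bullet> dY j) = (\<Sum>j<M. gX X Y j \<bullet> dX j + gY X Y j \<bullet> dY j)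
          + (gX X Y M \<bullet> dX M + gY X Y M \<bullet> dY M)" by (simp add: NM)
        also have "gX X Y M = h *\<^sub>R (\<Sum>i<N. ?B i)" by (simp add: gX_def)
        also have "gY X Y M = - w + h *\<^sub>R (\<Sum>i<N. ?A i)" by (simp add: gY_def)
        finally show ?thesis by (simp add: inner_diff_left inner_add_left del: sum.lessThan_Suc)
      qed
      have 4: "(\<Sum>j<M. gX X Y j \<bullet> dX j + gY X Y j \<bullet> dY j) = (\<Sum>j<M. (2 * (X j \<bullet> dX j) - 2 * (Y j \<bullet> dY j))
          + h * (?A j \<bullet> dY j - ?A j \<bullet> dX j) + h * ((\<Sum>i\<in>{j<..<N}. ?B i) \<bullet> (dX j + dY j)))"
        by (rule sum.cong) (auto simp: gX_def gY_def inner_add_left inner_diff_left inner_add_right algebra_simps)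
      show ?thesis unfolding sum.distrib 1 2 3[unfolded sum.distrib] 4[unfolded sum.distrib]
        by (simp only: sum.distrib sum_distrib_left[symmetric] distrib_left inner_commute[of w])
    qed
    finally show ?thesis .
  qed

  \<comment> \<open>Lipschitz bounds for the gradient\<close>
  have dpb: "norm (p (\<lambda>j. X j + dX j) (\<lambda>j. Y j + dY j) j - p X Y j) \<le> 3 * (\<Sum>j<N. norm (dX j) + norm (dY j))"
   and dqb: "norm (q (\<lambda>j. X j + dX j) (\<lambda>j. Y j + dY j) j - q X Y j) \<le> 2 * (\<Sum>j<N. norm (dX j) + norm (dY j))"
   and mj: "norm (dX j) + norm (dY j) \<le> (\<Sum>j<N. norm (dX j) + norm (dY j))"
   if j: "j < N" for X Y dX dY :: "nat \<Rightarrow> 'e" and j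
  proof -
    define m where "m = (\<Sum>j<N. norm (dX j) + norm (dY j))"
    have mj: "norm (dX j) + norm (dY j) \<le> m" if "j < N" for j
      unfolding m_def by (rule member_le_sum[of j "{..<N}" "\<lambda>j. norm (dX j) + norm (dY j)"]) (use that in auto)
    have m0: "m \<ge> 0" unfolding m_def by (intro sum_nonneg) auto
    have a: "norm (dX j) \<le> m" "norm (dY j) \<le> m" if "j < N" for j
      using mj[OF that] norm_ge_zero[of "dX j"] norm_ge_zero[of "dY j"] by linarith+
    have "norm (dY M + dY j - dX j) \<le> norm (dY M) + norm (dY j) + norm (dX j)"
      by (meson norm_triangle_ineq norm_triangle_ineq4 order_trans add_right_mono)
    also have "\<dots> \<le> 3 * m" using a[of M] a[of j] j NM by linarith
    finally have 1: "norm (dY M + dY j - dX j) \<le> 3 * m" .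
    have "norm (dY M) \<le> 3 * m" using a[of M] NM m0 by linarith
    then show "norm (p (\<lambda>j. X j + dX j) (\<lambda>j. Y j + dY j) j - p X Y j) \<le> 3 * (\<Sum>j<N. norm (dX j) + norm (dY j))"
      using 1 unfolding m_def[symmetric] by (simp add: p_def algebra_simps)
    have "norm (\<Sum>i<j. dX i + dY i) \<le> (\<Sum>i<j. norm (dX i) + norm (dY i))"
      by (intro sum_norm_le norm_triangle_ineq)
    also have "\<dots> \<le> m" unfolding m_def by (rule sum_mono2) (use j in auto)
    finally have "norm (dX M + (\<Sum>i<j. dX i + dY i)) \<le> 2 * m"
      using a[of M] NM norm_triangle_ineq[of "dX M" "\<Sum>i<j. dX i + dY i"] by linarith
    moreover have "q (\<lambda>j. X j + dX j) (\<lambda>j. Y j + dY j) j - q X Y j = dX M + (\<Sum>i<j. dX i + dY i)"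
      by (simp add: q_def sum.distrib algebra_simps)
    ultimately show "norm (q (\<lambda>j. X j + dX j) (\<lambda>j. Y j + dY j) j - q X Y j) \<le> 2 * (\<Sum>j<N. norm (dX j) + norm (dY j))"
      unfolding m_def by simp
    show "norm (dX j) + norm (dY j) \<le> (\<Sum>j<N. norm (dX j) + norm (dY j))" using mj[OF j] m_def by simp
  qed
  have AB5: "norm (A (\<lambda>j. X j + dX j) (\<lambda>j. Y j + dY j) j - A X Y j) \<le> 5 * L * (\<Sum>j<N. norm (dX j) + norm (dY j))"
     "norm (Bq (\<lambda>j. X j + dX j) (\<lambda>j. Y j + dY j) j - Bq X Y j) \<le> 5 * L * (\<Sum>j<N. norm (dX j) + norm (dY j))"
    if j: "j < N" for X Y dX dY :: "nat \<Rightarrow> 'e" and j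
  proof -
    have "L * (norm (p (\<lambda>j. X j + dX j) (\<lambda>j. Y j + dY j) j - p X Y j) + norm (q (\<lambda>j. X j + dX j) (\<lambda>j. Y j + dY j) j - q X Y j))
      \<le> L * (3 * (\<Sum>j<N. norm (dX j) + norm (dY j)) + 2 * (\<Sum>j<N. norm (dX j) + norm (dY j)))"
      by (intro mult_left_mono add_mono dpb[OF j] dqb[OF j] L)
    then have le: "L * (norm (p (\<lambda>j. X j + dX j) (\<lambda>j. Y j + dY j) j - p X Y j) + norm (q (\<lambda>j. X j + dX j) (\<lambda>j. Y j + dY j) j - q X Y j))
      \<le> 5 * L * (\<Sum>j<N. norm (dX j) + norm (dY j))" by (simp add: algebra_simps)
    show "norm (A (\<lambda>j. X j + dX j) (\<lambda>j. Y j + dY j) j - A X Y j) \<le> 5 * L * (\<Sum>j<N. norm (dX j) + norm (dY j))"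
      unfolding A_def by (rule order_trans[OF lip(1) le])
    show "norm (Bq (\<lambda>j. X j + dX j) (\<lambda>j. Y j + dY j) j - Bq X Y j) \<le> 5 * L * (\<Sum>j<N. norm (dX j) + norm (dY j))"
      unfolding Bq_def by (rule order_trans[OF lip(2) le])
  qed
  have sumb: "norm (h *\<^sub>R (\<Sum>i\<in>I. z i)) \<le> b" if "I \<subseteq> {..<N}" "\<And>i. i < N \<Longrightarrow> norm (z i) \<le> b" "b \<ge> 0" for I and z :: "nat \<Rightarrow> 'e" and b
  proof -
    have "norm (\<Sum>i\<in>I. z i) \<le> (\<Sum>i\<in>I. b)" by (rule sum_norm_le) (use that in auto)
    also have "\<dots> \<le> (\<Sum>i<N. b)" by (rule sum_mono2) (use that in auto)
    also have "\<dots> = real N * b" by simp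
    finally have "h * norm (\<Sum>i\<in>I. z i) \<le> h * (real N * b)" using h(1) by (intro mult_left_mono) auto
    also have "\<dots> = b" using h(2) by (simp add: mult.assoc[symmetric])
    finally show ?thesis using h(1) by simp
  qed
  have hz: "norm (h *\<^sub>R z) \<le> b" if "norm z \<le> b" for z :: 'e and b
    using that h mult_mono[of h 1 "norm z" b] by simp
  have tri3: "norm (a + b + c) \<le> norm a + norm b + norm c" for a b c :: 'e
    by (meson norm_triangle_ineq order_trans add_right_mono)
  \<comment> \<open>The quadratic part contributes 2; the terms in \<open>A\<close> and in
    \<open>Bq\<close> contribute 5 L each, since p and q move by at most 3 and 2 times the sum of
    all displacements.\<close>
  define K where "K = 2 + 10 * L"
  have gl: "norm (gX (\<lambda>j. X j + dX j) (\<lambda>j. Y j + dY j) j - gX X Y j) \<le> K * (\<Sum>j<N. norm (dX j) + norm (dY j))"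
      "norm (gY (\<lambda>j. X j + dX j) (\<lambda>j. Y j + dY j) j - gY X Y j) \<le> K * (\<Sum>j<N. norm (dX j) + norm (dY j))"
    if j: "j < N" for X Y dX dY j
  proof -
    define m where "m = (\<Sum>j<N. norm (dX j) + norm (dY j))"
    let ?X = "\<lambda>j. X j + dX j" and ?Y = "\<lambda>j. Y j + dY j"
    have m0: "m \<ge> 0" unfolding m_def by (intro sum_nonneg) auto
    have Lm: "5 * L * m \<ge> 0" using L m0 by simp
    have dj: "norm (2 *\<^sub>R dX j) \<le> 2 * m" "norm (2 *\<^sub>R dY j) \<le> 2 * m"
      using mj[OF j, of dX dY] norm_ge_zero[of "dX j"] norm_ge_zero[of "dY j"] unfolding m_def norm_scaleR abs_numeral by linarith+
    have a: "norm (h *\<^sub>R (A ?X ?Y j - A X Y j)) \<le> 5 * L * m"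
      by (rule hz) (use AB5(1)[OF j] in \<open>simp add: m_def\<close>)
    have sA: "norm (h *\<^sub>R (\<Sum>i\<in>I. A ?X ?Y i - A X Y i)) \<le> 5 * L * m" if "I \<subseteq> {..<N}" for I
      by (rule sumb[OF that _ Lm]) (use AB5(1) in \<open>simp add: m_def\<close>)
    have sB: "norm (h *\<^sub>R (\<Sum>i\<in>I. Bq ?X ?Y i - Bq X Y i)) \<le> 5 * L * m" if "I \<subseteq> {..<N}" for I
      by (rule sumb[OF that _ Lm]) (use AB5(2) in \<open>simp add: m_def\<close>)
    have Km: "K * m = 2 * m + 5 * L * m + 5 * L * m" by (simp add: K_def algebra_simps)
    have jM: "j < M \<or> j = M" using j NM by auto
    have "norm (gX ?X ?Y j - gX X Y j) \<le> K * m"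
    proof (cases "j < M")
      case True
      have "gX ?X ?Y j - gX X Y j = 2 *\<^sub>R dX j + - (h *\<^sub>R (A ?X ?Y j - A X Y j)) + h *\<^sub>R (\<Sum>i\<in>{j<..<N}. Bq ?X ?Y i - Bq X Y i)"
        using True by (simp add: gX_def algebra_simps sum_subtractf)
      then show ?thesis using tri3[of "2 *\<^sub>R dX j" "- (h *\<^sub>R (A ?X ?Y j - A X Y j))" "h *\<^sub>R (\<Sum>i\<in>{j<..<N}. Bq ?X ?Y i - Bq X Y i)"]
        dj a sB[of "{j<..<N}"] Km unfolding norm_minus_cancel by fastforce
    next
      case False
      then have "gX ?X ?Y j - gX X Y j = h *\<^sub>R (\<Sum>i<N. Bq ?X ?Y i - Bq X Y i)"
        using jM by (simp add: gX_def algebra_simps sum_subtractf)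
      then show ?thesis using sB[of "{..<N}"] Km Lm m0 by auto
    qed
    moreover have "norm (gY ?X ?Y j - gY X Y j) \<le> K * m"
    proof (cases "j < M")
      case True
      have "gY ?X ?Y j - gY X Y j = - (2 *\<^sub>R dY j) + (h *\<^sub>R (A ?X ?Y j - A X Y j)) + h *\<^sub>R (\<Sum>i\<in>{j<..<N}. Bq ?X ?Y i - Bq X Y i)"
        using True by (simp add: gY_def algebra_simps sum_subtractf)
      then show ?thesis using tri3[of "- (2 *\<^sub>R dY j)" "(h *\<^sub>R (A ?X ?Y j - A X Y j))" "h *\<^sub>R (\<Sum>i\<in>{j<..<N}. Bq ?X ?Y i - Bq X Y i)"]
        dj a sB[of "{j<..<N}"] Km unfolding norm_minus_cancel by fastforce
    next
      case False
      then have "gY ?X ?Y j - gY X Y j = h *\<^sub>R (\<Sum>i<N. A ?X ?Y i - A X Y i)"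
        using jM by (simp add: gY_def algebra_simps sum_subtractf)
      then show ?thesis using sA[of "{..<N}"] Km Lm m0 by auto
    qed
    ultimately show "norm (gX ?X ?Y j - gX X Y j) \<le> K * (\<Sum>j<N. norm (dX j) + norm (dY j))"
      "norm (gY ?X ?Y j - gY X Y j) \<le> K * (\<Sum>j<N. norm (dX j) + norm (dY j))" unfolding m_def by auto
  qed

  \<comment> \<open>Linking for the discrete action\<close>
  have K0: "K \<ge> 0" using L by (simp add: K_def)
  obtain \<epsilon> where \<epsilon>: "\<epsilon> > 0" "\<And>X Y. f (\<lambda>j. X j + \<epsilon> *\<^sub>R gX X Y j) (\<lambda>j. Y j + \<epsilon> *\<^sub>R gY X Y j)
        \<ge> f X Y + \<epsilon> / 2 * (\<Sum>j<N. (norm (gX X Y j))\<^sup>2 + (norm (gY X Y j))\<^sup>2)"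
    using gradient_ascent_step[where f=f and N=N and gx=gX and gy=gY and K=K, OF fder gl K0] by blast
  \<comment> \<open>Equal x_j and y_j make all momenta equal to p_M = U, while the increments 2 x_j
    of q remain arbitrary: these are the discrete loops to which \<open>low\<close> applies.\<close>
  define \<sigma> where "\<sigma> X j = (if j < M then X j else U)" for X :: "nat \<Rightarrow> 'e" and j
  have C0: "C \<ge> 0" using bd(1)[of 0 0 0] norm_ge_zero order_trans by blast
  have BqC: "norm (Bq X Y i) \<le> C" for X Y i unfolding Bq_def by (rule bd(2))
  \<comment> \<open>The closing equation for q collects the errors of all N = 1 / h steps, so a
    tolerance of order h^3 is required to end with h^2.\<close>
  define \<delta> where "\<delta> = h ^ 3 / 2"
  have \<delta>: "\<delta> > 0" using h by (simp add: \<delta>_def)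
  have "\<exists>X Y. f X Y \<ge> c - U \<bullet> w \<and> (\<forall>j<N. norm (gX X Y j) \<le> \<delta> \<and> norm (gY X Y j) \<le> \<delta>)"
  \<comment> \<open>The square of x_j has gradient 2 x_j, whence the factor 2; q_0 has the factor 0.
    What remains of the gradient in \<open>X\<close> consists of at most two averaged or scaled
    derivatives of \<open>H\<close>, each bounded by \<open>C\<close>.\<close>
  proof (rule linking[where \<sigma> = \<sigma> and \<mu> = "\<lambda>j. if j < M then 2 else 0" and C = "2 * C" and \<beta> = "B + real M * (w \<bullet> w)"])
    show "\<epsilon> > 0" by fact
    \<comment> \<open>On the complementary space p_j = p_M + y_j for j < M. By \<open>up\<close>, H
      is at most B + p \<bullet> w, whose part in p_M cancels \<open>- Y M \<bullet> w\<close>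
      because h N = 1; the rest is bounded by completing the square in y_j.\<close>
    fix X Y :: "nat \<Rightarrow> 'e" assume *: "\<And>j. j < N \<Longrightarrow> X j = 0"
    have "h * (\<Sum>j<N. H (j * h) (p X Y j) (q X Y j)) \<le> h * (\<Sum>j<N. B + p X Y j \<bullet> w)"
      using up h by (intro mult_left_mono sum_mono) (auto simp: algebra_simps)
    also have "(\<Sum>j<N. B + p X Y j \<bullet> w) = real N * B + (\<Sum>j<M. Y j \<bullet> w) + real N * (Y M \<bullet> w)"
    proof -
      have "(\<Sum>j<M. p X Y j \<bullet> w) = (\<Sum>j<M. Y M \<bullet> w + Y j \<bullet> w)"
        by (rule sum.cong) (use * NM in \<open>auto simp: p_def inner_add_left\<close>)
      then show ?thesis by (simp add: NM p_def sum.distrib algebra_simps)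
    qed
    also have "h * \<dots> = B + h * (\<Sum>j<M. Y j \<bullet> w) + Y M \<bullet> w" using h(2) by (simp add: algebra_simps)
    finally have "f X Y \<le> B + (\<Sum>j<M. h * (Y j \<bullet> w) - Y j \<bullet> Y j)"
      using * NM by (simp add: f_def sum_subtractf sum_distrib_left sum_negf)
    also have "(\<Sum>j<M. h * (Y j \<bullet> w) - Y j \<bullet> Y j) \<le> (\<Sum>j<M. w \<bullet> w)"
    proof (rule sum_mono)
      fix j
      have "0 \<le> (Y j - (h/2) *\<^sub>R w) \<bullet> (Y j - (h/2) *\<^sub>R w)" by simp
      then have "h * (Y j \<bullet> w) - Y j \<bullet> Y j \<le> h * h / 4 * (w \<bullet> w)"
        by (simp add: inner_diff_left inner_diff_right inner_commute[of w "Y j"] algebra_simps)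
      also have "\<dots> \<le> 1 * (w \<bullet> w)"
      proof (rule mult_right_mono)
        show "h * h / 4 \<le> 1" using mult_le_one[OF h(3) less_imp_le[OF h(1)] h(3)] by linarith
      qed simp
      finally show "h * (Y j \<bullet> w) - Y j \<bullet> Y j \<le> w \<bullet> w" by simp
    qed
    finally show "f X Y \<le> B + real M * (w \<bullet> w)" by simp
  next
    fix X :: "nat \<Rightarrow> 'e"
    have "p X (\<sigma> X) j = U" for j by (simp add: p_def \<sigma>_def)
    then have "h * (\<Sum>j<N. H (j * h) (p X (\<sigma> X) j) (q X (\<sigma> X) j)) \<ge> h * (\<Sum>j<N. c)"
      using low h by (intro mult_left_mono sum_mono) auto
    then show "c - U \<bullet> w \<le> f X (\<sigma> X)" using h(2) by (simp add: f_def \<sigma>_def mult.assoc[symmetric])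
  next
    fix X Y :: "nat \<Rightarrow> 'e" and j assume j: "j < N"
    show "norm (gX X Y j - (if j < M then 2 else 0) *\<^sub>R X j) \<le> 2 * C"
    proof (cases "j < M")
      case True
      have 1: "norm (h *\<^sub>R A X Y j) \<le> C" unfolding A_def by (rule hz[OF bd(1)])
      have 2: "norm (h *\<^sub>R (\<Sum>i\<in>{j<..<N}. Bq X Y i)) \<le> C"
        by (rule sumb[OF _ BqC C0]) auto
      have "gX X Y j - 2 *\<^sub>R X j = h *\<^sub>R (\<Sum>i\<in>{j<..<N}. Bq X Y i) - h *\<^sub>R A X Y j" using True by (simp add: gX_def)
      then show ?thesis using norm_triangle_ineq4[of "h *\<^sub>R (\<Sum>i\<in>{j<..<N}. Bq X Y i)" "h *\<^sub>R A X Y j"] 1 2 True by simp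
    next
      case False
      have 2: "norm (h *\<^sub>R (\<Sum>i<N. Bq X Y i)) \<le> C"
        by (rule sumb[OF _ BqC C0]) auto
      then show ?thesis using False j NM C0 by (simp add: gX_def del: sum.lessThan_Suc)
    qed
  qed (use \<epsilon> \<delta> in \<open>auto simp: gX_def gY_def \<sigma>_def intro!: tendsto_intros Acont Bcont\<close>)

  \<comment> \<open>Recovery of the symplectic Euler scheme\<close>
  then obtain X Y where fXY: "f X Y \<ge> c - U \<bullet> w" and gX: "\<And>j. j<N \<Longrightarrow> norm (gX X Y j) \<le> \<delta>"
    and gY: "\<And>j. j<N \<Longrightarrow> norm (gY X Y j) \<le> \<delta>" by blast
  \<comment> \<open>Both ends of \<open>P\<close> are p_M, and \<open>Q\<close> ends at q_0 + w, so
    the closing conditions hold by definition; the equations of the first step of \<open>P\<close>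
    and the last step of \<open>Q\<close> have to be earned separately.\<close>
  define P where "P j = (if j = 0 then p X Y M else p X Y (j - 1))" for j
  define Q where "Q j = (if j \<le> M then q X Y j else q X Y 0 + w)" for j
  let ?A = "A X Y" and ?B = "Bq X Y"
  have P_Suc: "P (Suc j) = p X Y j" for j by (simp add: P_def)
  have \<delta>h: "2 * \<delta> \<le> h\<^sup>2" "real N * \<delta> \<le> h\<^sup>2"
  proof -
    have "h ^ 3 = h * h\<^sup>2" by (simp add: power3_eq_cube power2_eq_square)
    also have "\<dots> \<le> 1 * h\<^sup>2" using h by (intro mult_right_mono) auto
    finally show "2 * \<delta> \<le> h\<^sup>2" by (simp add: \<delta>_def)
    have "real N * \<delta> = (h * real N) * h\<^sup>2 / 2" by (simp add: \<delta>_def power3_eq_cube power2_eq_square)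
    then have "real N * \<delta> = h\<^sup>2 / 2" using h(2) by simp
    then show "real N * \<delta> \<le> h\<^sup>2" using zero_le_power2[of h] by linarith
  qed
  have hA2: "(h * 2) *\<^sub>R a = h *\<^sub>R a + h *\<^sub>R a" for a :: 'e
    by (simp only: mult_2_right scaleR_add_left)
  \<comment> \<open>The difference of the two gradients is twice the equation for q; their sum is
    the equation for p.\<close>
  have eq_q: "norm (X j + Y j - h *\<^sub>R ?A j) \<le> \<delta>" if "j < M" for j
  proof -
    have "gX X Y j - gY X Y j = 2 *\<^sub>R (X j + Y j - h *\<^sub>R ?A j)"
      using that by (simp add: gX_def gY_def algebra_simps hA2)
    then have "2 * norm (X j + Y j - h *\<^sub>R ?A j) \<le> norm (gX X Y j) + norm (gY X Y j)"
      using norm_triangle_ineq4[of "gX X Y j" "gY X Y j"] by simp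
    then show ?thesis using gX[of j] gY[of j] that NM by simp
  qed
  \<comment> \<open>The defect of the equation for p after summation from the end. Differences of
    consecutive defects are the defects of single steps.\<close>
  define e where "e j = p X Y j - Y M - h *\<^sub>R (\<Sum>i\<in>{j<..<N}. ?B i)" for j
  have e: "norm (e j) \<le> \<delta>" if "j < N" for j
  proof (cases "j < M")
    case True
    have "gX X Y j + gY X Y j = - (2 *\<^sub>R e j)"
      using True by (simp add: gX_def gY_def e_def p_def algebra_simps scaleR_2 hA2)
    then have "2 * norm (e j) \<le> norm (gX X Y j) + norm (gY X Y j)"
      using norm_triangle_ineq[of "gX X Y j" "gY X Y j"] by simp
    then show ?thesis using gX[of j] gY[of j] that by simp
  next
    case False
    then have "j = M" using that NM by simp
    moreover have "{M<..<Suc M} = {}" by auto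
    ultimately have "e j = 0" by (simp add: e_def p_def NM)
    then show ?thesis using \<delta> by simp
  qed
  have Bsum: "(\<Sum>i\<in>{j<..<N}. ?B i) = ?B (Suc j) + (\<Sum>i\<in>{Suc j<..<N}. ?B i)" if "Suc j < N" for j
  proof -
    have "{j<..<N} = insert (Suc j) {Suc j<..<N}" using that by auto
    then show ?thesis by simp
  qed
  have "norm (P (Suc j) - P j + h *\<^sub>R Hq (j * h) (P (Suc j)) (Q j)) \<le> h\<^sup>2" if j: "j < N" for j
  proof -
    have Hq: "Hq (j * h) (P (Suc j)) (Q j) = ?B j" using j NM by (simp add: P_Suc Bq_def Q_def)
    show ?thesis
    proof (cases j)
      case 0
      \<comment> \<open>The step that leaves P 0 = p_M closes the loop. It rests on the derivative
        in q_0, which is the sum of the q-derivatives over all times.\<close>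
      have "(\<Sum>i<N. ?B i) = ?B 0 + (\<Sum>i\<in>{0<..<N}. ?B i)"
      proof -
        have "{..<N} = insert 0 {0<..<N}" using N by auto
        then show ?thesis by simp
      qed
      moreover have "gX X Y M = h *\<^sub>R (\<Sum>i<N. ?B i)" by (simp add: gX_def)
      ultimately have "P (Suc j) - P j + h *\<^sub>R Hq (j * h) (P (Suc j)) (Q j) = e 0 + gX X Y M"
        unfolding Hq using 0 by (simp add: P_def e_def p_def algebra_simps)
      then show ?thesis using norm_triangle_ineq[of "e 0" "gX X Y M"] e[OF N] gX[of M] NM \<delta>h by simp
    next
      case (Suc i)
      have "P (Suc j) - P j + h *\<^sub>R Hq (j * h) (P (Suc j)) (Q j) = e j - e i"
        unfolding Hq using Suc Bsum[of i] j by (simp add: P_def e_def algebra_simps)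
      then show ?thesis using norm_triangle_ineq4[of "e j" "e i"] e[OF j] e[of i] Suc j \<delta>h by simp
    qed
  qed
  moreover have "norm (Q (Suc j) - Q j - h *\<^sub>R Hp (j * h) (P (Suc j)) (Q j)) \<le> h\<^sup>2" if j: "j < N" for j
  proof -
    have Hp: "Hp (j * h) (P (Suc j)) (Q j) = ?A j" using j NM by (simp add: P_Suc A_def Q_def)
    show ?thesis
    proof (cases "j < M")
      case True
      then have "Q (Suc j) - Q j - h *\<^sub>R Hp (j * h) (P (Suc j)) (Q j) = X j + Y j - h *\<^sub>R ?A j"
        unfolding Hp by (simp add: Q_def q_def)
      then show ?thesis using eq_q[OF True] \<delta>h \<delta> by simp
    next
      case False
      then have jM: "j = M" using j NM by simp
      have gYM: "gY X Y M = - w + h *\<^sub>R (\<Sum>i<M. ?A i) + h *\<^sub>R ?A M" by (simp add: gY_def NM scaleR_add_right)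
      \<comment> \<open>The last increment of q is determined by w. The derivative in p_M controls
        it only together with all earlier steps, hence the error N \<delta>.\<close>
      have "Q (Suc j) - Q j - h *\<^sub>R Hp (j * h) (P (Suc j)) (Q j) = - gY X Y M - (\<Sum>i<M. X i + Y i - h *\<^sub>R ?A i)"
        unfolding Hp gYM by (simp add: jM Q_def q_def sum_subtractf scaleR_sum_right algebra_simps)
      then have "norm (Q (Suc j) - Q j - h *\<^sub>R Hp (j * h) (P (Suc j)) (Q j)) \<le> norm (gY X Y M) + norm (\<Sum>i<M. X i + Y i - h *\<^sub>R ?A i)"
        using norm_triangle_ineq4[of "- gY X Y M" "\<Sum>i<M. X i + Y i - h *\<^sub>R ?A i"] by simp
      also have "norm (\<Sum>i<M. X i + Y i - h *\<^sub>R ?A i) \<le> (\<Sum>i<M. \<delta>)"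
        by (rule sum_norm_le) (use eq_q in auto)
      also have "norm (gY X Y M) \<le> \<delta>" using gY[of M] NM by simp
      finally have "norm (Q (Suc j) - Q j - h *\<^sub>R Hp (j * h) (P (Suc j)) (Q j)) \<le> real N * \<delta>"
        by (simp add: NM algebra_simps)
      then show ?thesis using \<delta>h by simp
    qed
  qed
  moreover have "(\<Sum>j<N. h * H (j * h) (P (Suc j)) (Q j) - P (Suc j) \<bullet> (Q (Suc j) - Q j)) \<ge> c - U \<bullet> w"
  proof -
    have 1: "(\<Sum>j<N. h * H (j * h) (P (Suc j)) (Q j)) = h * (\<Sum>j<N. H (j * h) (p X Y j) (q X Y j))"
      unfolding sum_distrib_left P_Suc by (rule sum.cong) (use NM in \<open>auto simp: Q_def\<close>)
    have "(\<Sum>j<M. P (Suc j) \<bullet> (Q (Suc j) - Q j)) = (\<Sum>j<M. Y M \<bullet> (X j + Y j) + (Y j \<bullet> Y j - X j \<bullet> X j))"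
      by (rule sum.cong) (auto simp: P_Suc p_def Q_def q_def inner_add_left inner_add_right inner_diff_left inner_commute algebra_simps)
    also have "\<dots> = Y M \<bullet> (\<Sum>j<M. X j + Y j) + (\<Sum>j<M. Y j \<bullet> Y j - X j \<bullet> X j)"
      by (subst sum.distrib) (simp only: inner_sum_right)
    finally have "(\<Sum>j<M. P (Suc j) \<bullet> (Q (Suc j) - Q j)) = Y M \<bullet> (\<Sum>j<M. X j + Y j) + (\<Sum>j<M. Y j \<bullet> Y j - X j \<bullet> X j)" .
    moreover have "P (Suc M) \<bullet> (Q (Suc M) - Q M) = Y M \<bullet> w - Y M \<bullet> (\<Sum>j<M. X j + Y j)"
      by (simp add: P_Suc p_def Q_def q_def inner_diff_right inner_add_right)
    ultimately have "(\<Sum>j<N. P (Suc j) \<bullet> (Q (Suc j) - Q j)) = Y M \<bullet> w + (\<Sum>j<M. Y j \<bullet> Y j - X j \<bullet> X j)"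
      by (simp add: NM)
    then show ?thesis using fXY unfolding sum_subtractf 1 by (simp add: f_def sum_subtractf)
  qed
  moreover have "P N = P 0" "Q N = Q 0 + w" using NM by (auto simp: P_def Q_def)
  ultimately show ?thesis by blast
qed

section \<open>Limits of Euler polygons\<close>

definition cutoff :: "real \<Rightarrow> real" where "cutoff x = max 0 (min 1 x)"

lemma sum_cutoff: "(\<Sum>j<N. cutoff (x - real j)) = max 0 (min (real N) x)"
  by (induction N) (auto simp: cutoff_def max_def min_def)

lemma cutoff_mono: "x \<le> y \<Longrightarrow> cutoff x \<le> cutoff y"
  by (auto simp: cutoff_def)

text \<open>The piecewise linear path with vertex \<open>z j\<close> at time \<open>j / N\<close>.
  Written with clamped weights, its increment over an interval is a nonnegative combination of the
  steps, with no case distinction on the pieces.\<close>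

definition polygon :: "nat \<Rightarrow> (nat \<Rightarrow> 'e::real_vector) \<Rightarrow> real \<Rightarrow> 'e" where
  "polygon N z t = z 0 + (\<Sum>j<N. cutoff (real N * t - real j) *\<^sub>R (z (Suc j) - z j))"

lemma polygon_vertex:
  assumes "i \<le> N" "N > 0" shows "polygon N z (real i / real N) = z i"
proof -
  have "(\<Sum>j<N. cutoff (real i - real j) *\<^sub>R (z (Suc j) - z j)) = (\<Sum>j<i. z (Suc j) - z j)"
  proof -
    have "(\<Sum>j<N. cutoff (real i - real j) *\<^sub>R (z (Suc j) - z j)) = (\<Sum>j<N. if j < i then z (Suc j) - z j else 0)"
      by (rule sum.cong) (auto simp: cutoff_def)
    also have "\<dots> = (\<Sum>j\<in>{..<N} \<inter> {j. j < i}. z (Suc j) - z j)" by (simp add: sum.inter_restrict)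
    also have "{..<N} \<inter> {j. j < i} = {..<i}" using assms by auto
    finally show ?thesis .
  qed
  then show ?thesis using assms(2) by (simp add: polygon_def sum_lessThan_telescope)
qed

text \<open>The weights \<open>c j\<close> sum to N (b - a) and vanish unless step j overlaps (a, b)
  in time, so an estimate for the overlapping steps averages to one for the chord.\<close>

lemma polygon_diff_le:
  fixes z :: "nat \<Rightarrow> 'e::real_normed_vector"
  assumes N: "N > 0" and ab: "0 \<le> a" "a \<le> b" "b \<le> 1"
    and near: "\<And>j. j < N \<Longrightarrow> real j / real N < b \<Longrightarrow> a < (real j + 1) / real N \<Longrightarrow>
        norm (z (Suc j) - z j - (1 / real N) *\<^sub>R g) \<le> e / real N"
  shows "norm (polygon N z b - polygon N z a - (b - a) *\<^sub>R g) \<le> e * (b - a)"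
proof -
  define c where "c j = cutoff (real N * b - real j) - cutoff (real N * a - real j)" for j
  have c0: "c j \<ge> 0" for j unfolding c_def using ab N by (simp add: cutoff_mono)
  have csum: "(\<Sum>j<N. c j) = real N * (b - a)"
  proof -
    have "max 0 (min (real N) (real N * x)) = real N * x" if "0 \<le> x" "x \<le> 1" for x
      using that N by (simp add: min_absorb2 mult_left_le)
    then show ?thesis unfolding c_def sum_subtractf sum_cutoff using ab by (simp add: algebra_simps)
  qed
  have "polygon N z b - polygon N z a = (\<Sum>j<N. c j *\<^sub>R (z (Suc j) - z j))"
    by (simp add: polygon_def c_def scaleR_diff_left sum_subtractf)
  moreover have "(b - a) *\<^sub>R g = (\<Sum>j<N. c j *\<^sub>R ((1 / real N) *\<^sub>R g))"
    using csum N by (simp flip: scaleR_sum_left sum_divide_distrib)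
  ultimately have "polygon N z b - polygon N z a - (b - a) *\<^sub>R g
      = (\<Sum>j<N. c j *\<^sub>R (z (Suc j) - z j - (1 / real N) *\<^sub>R g))"
    by (simp only: sum_subtractf scaleR_diff_right)
  also have "norm \<dots> \<le> (\<Sum>j<N. c j * (e / real N))"
  proof (rule sum_norm_le)
    fix j assume j: "j \<in> {..<N}"
    show "norm (c j *\<^sub>R (z (Suc j) - z j - (1 / real N) *\<^sub>R g)) \<le> c j * (e / real N)"
    proof (cases "c j = 0")
      case False
      have "real j < real N * b" "real N * a < real j + 1"
      proof -
        have le: "real N * a \<le> real N * b" using ab by (simp add: mult_left_mono)
        have "cutoff (real N * b - real j) > cutoff (real N * a - real j)" using False c0[of j] by (simp add: c_def)
        moreover have "cutoff x \<ge> 0" "cutoff x \<le> 1" "x \<le> 0 \<Longrightarrow> cutoff x = 0" "x \<ge> 1 \<Longrightarrow> cutoff x = 1" for x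
          by (auto simp: cutoff_def)
        ultimately show "real j < real N * b" "real N * a < real j + 1"
          by (smt (verit))+
      qed
      then have "norm (z (Suc j) - z j - (1 / real N) *\<^sub>R g) \<le> e / real N"
        using j N by (intro near) (auto simp: field_simps)
      from mult_left_mono[OF this c0[of j]] show ?thesis using c0[of j] by simp
    qed simp
  qed
  also have "\<dots> = (\<Sum>j<N. c j) * (e / real N)" by (rule sum_distrib_right[symmetric])
  also have "\<dots> = e * (b - a)" using csum N by simp
  finally show ?thesis .
qed

text \<open>Peano's argument: the polygons are equi-Lipschitz, a subsequence converges uniformly,
  and on a short interval around s all steps are close to \<open>G s (g s)\<close> by continuity.
  The points \<zeta> allow the field to be evaluated off the polygon, as the symplectic Euler scheme
  does. The limits of the end points carry the closing condition over to the solution.\<close>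

lemma euler_polygon_limit:
  fixes G :: "real \<Rightarrow> 'e::euclidean_space \<Rightarrow> 'e" and z \<zeta> :: "nat \<Rightarrow> nat \<Rightarrow> 'e"
  assumes G: "continuous_on UNIV (\<lambda>x. G (fst x) (snd x))"
    and z0: "\<And>N. N > 0 \<Longrightarrow> norm (z N 0) \<le> B"
    and inc: "\<And>N j. j < N \<Longrightarrow> norm (z N (Suc j) - z N j) \<le> D / real N"
    and euler: "\<And>N j. j < N \<Longrightarrow> norm (z N (Suc j) - z N j - (1 / real N) *\<^sub>R G (real j / real N) (\<zeta> N j)) \<le> D / (real N)\<^sup>2"
    and near: "\<And>N j. j < N \<Longrightarrow> norm (\<zeta> N j - z N j) \<le> D / real N"
  shows "\<exists>Z r. strict_mono (r :: nat \<Rightarrow> nat) \<and>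
     (\<forall>t\<in>{0..1}. (Z has_vector_derivative G t (Z t)) (at t within {0..1})) \<and>
     (\<lambda>k. z (Suc (r k)) 0) \<longlonglongrightarrow> Z 0 \<and> (\<lambda>k. z (Suc (r k)) (Suc (r k))) \<longlonglongrightarrow> Z 1"
proof -
  \<comment> \<open>Shifted by one, so that the number of steps is never 0.\<close>
  define F where "F n = polygon (Suc n) (z (Suc n))" for n
  have D0: "D \<ge> 0" using order_trans[OF norm_ge_zero inc[of 0 1]] by simp
  have lip: "norm (F n b - F n a) \<le> D * (b - a)" if "0 \<le> a" "a \<le> b" "b \<le> 1" for n a b
  proof -
    have "norm (F n b - F n a - (b - a) *\<^sub>R 0) \<le> D * (b - a)" unfolding F_def
    proof (rule polygon_diff_le)
      fix j assume "j < Suc n"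
      then show "norm (z (Suc n) (Suc j) - z (Suc n) j - (1 / real (Suc n)) *\<^sub>R 0) \<le> D / real (Suc n)"
        unfolding scaleR_zero_right diff_zero by (rule inc)
    qed (use that in simp_all)
    then show ?thesis by simp
  qed
  have lip': "norm (F n b - F n a) \<le> D * \<bar>b - a\<bar>" if "a \<in> {0..1}" "b \<in> {0..1}" for n a b
    using lip[of a b n] lip[of b a n] that by (cases "a \<le> b") (auto simp: norm_minus_commute)
  have F0: "F n 0 = z (Suc n) 0" for n
    using polygon_vertex[of 0 "Suc n" "z (Suc n)"] by (simp add: F_def)
  have F1: "F n 1 = z (Suc n) (Suc n)" for n
    using polygon_vertex[of "Suc n" "Suc n" "z (Suc n)"] by (simp add: F_def del: of_nat_Suc)
  have bdd: "norm (F n t) \<le> B + D" if "t \<in> {0..1}" for n t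
  proof -
    have "norm (F n t) \<le> norm (F n 0) + norm (F n t - F n 0)" by (metis add_diff_cancel_left' diff_add_cancel norm_triangle_ineq add.commute)
    also have "\<dots> \<le> B + D * t" using z0[of "Suc n"] lip[of 0 t n] that by (simp add: F0)
    also have "\<dots> \<le> B + D" using that D0 by (simp add: mult_left_le)
    finally show ?thesis .
  qed
  obtain g r where g: "continuous_on {0..1} g" and r: "strict_mono (r :: nat \<Rightarrow> nat)"
    and unif: "\<And>e. 0 < e \<Longrightarrow> \<exists>N. \<forall>n x. n \<ge> N \<and> x \<in> {0..1} \<longrightarrow> norm (F (r n) x - g x) < e"
  proof (rule Arzela_Ascoli[of "{0..1::real}" F "B + D"])
    fix x e :: real assume x: "x \<in> {0..1}" and e: "0 < e"
    show "\<exists>d>0. \<forall>n y. y \<in> {0..1} \<and> norm (x - y) < d \<longrightarrow> norm (F n x - F n y) < e"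
    proof (intro exI conjI allI impI)
      show "e / (D + 1) > 0" using e D0 by simp
      fix n y assume y: "y \<in> {0..1} \<and> norm (x - y) < e / (D + 1)"
      have "norm (F n x - F n y) \<le> D * \<bar>x - y\<bar>" by (rule lip') (use x y in auto)
      also have "\<dots> \<le> D * (e / (D + 1))" using y D0 by (intro mult_left_mono) auto
      also have "\<dots> < e" using e D0 by (simp add: field_simps)
      finally show "norm (F n x - F n y) < e" .
    qed
  qed (use bdd in auto)
  have lim: "(\<lambda>n. F (r n) x) \<longlonglongrightarrow> g x" if "x \<in> {0..1}" for x
    unfolding LIMSEQ_iff using unif that by meson
  have "(g has_vector_derivative G s (g s)) (at s within {0..1})" if s: "s \<in> {0..1}" for s
    unfolding has_vector_derivative_def has_derivative_within_alt
  proof (intro conjI allI impI)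
    show "bounded_linear (\<lambda>x. x *\<^sub>R G s (g s))" by (rule bounded_linear_scaleR_left)
    fix e :: real assume e: "0 < e"
    have "continuous (at (s, g s)) (\<lambda>x. G (fst x) (snd x))"
      using G by (simp add: continuous_on_eq_continuous_at)
    then obtain d where d: "d > 0" "\<And>x. dist x (s, g s) < d \<Longrightarrow> dist (G (fst x) (snd x)) (G s (g s)) < e / 2"
      unfolding continuous_at_eps_delta using half_gt_zero[OF e] by (metis fst_conv snd_conv)
    define \<eta> where "\<eta> = d / 2"
    have \<eta>: "\<eta> > 0" using d by (simp add: \<eta>_def)
    have Gnear: "norm (G t x - G s (g s)) \<le> e / 2" if "\<bar>t - s\<bar> < \<eta>" "norm (x - g s) < \<eta>" for t x
    proof -
      have "dist (t, x) (s, g s) \<le> dist t s + dist x (g s)"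
        by (simp add: dist_prod_def real_sqrt_le_iff sqrt_sum_squares_le_sum)
      then have "dist (t, x) (s, g s) < d" using that by (simp add: \<eta>_def dist_norm)
      from d(2)[OF this] show ?thesis by (simp add: dist_norm)
    qed
    define \<delta> where "\<delta> = \<eta> / (4 * (D + 1))"
    have \<delta>: "\<delta> > 0" "D * \<delta> \<le> \<eta> / 4" "\<delta> \<le> \<eta> / 4" using \<eta> D0 by (auto simp: \<delta>_def field_simps)
    \<comment> \<open>A chord estimate for any two times near s, which gives the derivative from
      both sides. It is proved for the polygons and survives the limit because it is a weak
      inequality.\<close>
    have main: "norm (g b - g a - (b - a) *\<^sub>R G s (g s)) \<le> e * (b - a)"
      if ab: "0 \<le> a" "a \<le> b" "b \<le> 1" and as: "\<bar>a - s\<bar> < \<delta>" "\<bar>b - s\<bar> < \<delta>" for a b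
    proof -
      have "(\<lambda>n. norm (F (r n) b - F (r n) a - (b - a) *\<^sub>R G s (g s))) \<longlonglongrightarrow> norm (g b - g a - (b - a) *\<^sub>R G s (g s))"
        by (intro tendsto_intros lim) (use ab in auto)
      moreover have "\<exists>N0. \<forall>n\<ge>N0. norm (F (r n) b - F (r n) a - (b - a) *\<^sub>R G s (g s)) \<le> e * (b - a)"
      proof -
        obtain N1 where N1: "\<And>n x. n \<ge> N1 \<Longrightarrow> x \<in> {0..1} \<Longrightarrow> norm (F (r n) x - g x) < \<eta> / 4"
          using unif[of "\<eta> / 4"] \<eta> by auto
        \<comment> \<open>A bound on the step size under which \<zeta> stays within \<eta> / 4 of
          the polygon, the drift during one step is at most \<eta> / 4, and the Euler error costs at
          most e / 2.\<close>
        define \<kappa> where "\<kappa> = min (\<eta> / 4) (e / 2) / (D + 1)"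
        have \<kappa>: "\<kappa> > 0" "D * \<kappa> \<le> \<eta> / 4" "\<kappa> \<le> \<eta> / 4" "D * \<kappa> \<le> e / 2"
        proof -
          have "\<kappa> * (D + 1) = min (\<eta> / 4) (e / 2)" using D0 by (simp add: \<kappa>_def)
          moreover show "\<kappa> > 0" using \<eta> e D0 by (simp add: \<kappa>_def)
          moreover have "\<kappa> * (D + 1) = D * \<kappa> + \<kappa>" by (simp add: algebra_simps)
          ultimately have "D * \<kappa> + \<kappa> \<le> \<eta> / 4 \<and> D * \<kappa> + \<kappa> \<le> e / 2"
            using min.cobounded1[of "\<eta> / 4" "e / 2"] min.cobounded2[of "\<eta> / 4" "e / 2"] by linarith
          then show "D * \<kappa> \<le> \<eta> / 4" "\<kappa> \<le> \<eta> / 4" "D * \<kappa> \<le> e / 2" using \<open>\<kappa> > 0\<close> mult_nonneg_nonneg[OF D0 less_imp_le[OF \<open>\<kappa> > 0\<close>]] by linarith+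
        qed
        obtain N2 :: nat where N2: "inverse (real (Suc N2)) < \<kappa>" using reals_Archimedean[OF \<kappa>(1)] by blast
        have "norm (F (r n) b - F (r n) a - (b - a) *\<^sub>R G s (g s)) \<le> e * (b - a)" if n: "n \<ge> max N1 N2" for n
        proof -
          define N where "N = Suc (r n)"
          have "real (Suc N2) \<le> real N" using seq_suble[OF r, of n] n by (simp add: N_def)
          then have "inverse (real N) \<le> inverse (real (Suc N2))" by (rule le_imp_inverse_le) simp
          then have N\<kappa>: "1 / real N \<le> \<kappa>" using N2 by (simp only: divide_inverse mult_1)
          have DN: "D / real N \<le> D * \<kappa>" using mult_left_mono[OF N\<kappa> D0] by simp
          show ?thesis unfolding F_def
          proof (fold N_def, rule polygon_diff_le)
            fix j assume j: "j < N" "real j / real N < b" "a < (real j + 1) / real N"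
            have Npos: "real N > 0" by (simp add: N_def)
            have "real j / real N > a - 1 / real N" using j(3) by (simp add: add_divide_distrib)
            then have js: "\<bar>real j / real N - s\<bar> \<le> \<delta> + 1 / real N"
              using as j(2) zero_less_divide_1_iff[of "real N"] Npos unfolding abs_le_iff abs_less_iff by linarith
            then have js1: "\<bar>real j / real N - s\<bar> < \<eta>" using \<delta> N\<kappa> \<kappa> \<eta> by linarith
            have zj: "z N j = F (r n) (real j / real N)"
              using polygon_vertex[of j N "z N"] j by (simp add: F_def N_def)
            have "norm (F (r n) (real j / real N) - F (r n) s) \<le> D * \<bar>real j / real N - s\<bar>"
              by (rule lip') (use s j Npos in \<open>auto simp: field_simps\<close>)
            also have "\<dots> \<le> D * (\<delta> + 1 / real N)" using js D0 by (rule mult_left_mono)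
            also have "\<dots> \<le> \<eta> / 4 + \<eta> / 4" using \<delta> DN \<kappa> by (simp add: distrib_left)
            finally have a1: "norm (F (r n) (real j / real N) - F (r n) s) \<le> \<eta> / 4 + \<eta> / 4" .
            have a2: "norm (F (r n) s - g s) < \<eta> / 4" using N1 n s by simp
            have a3: "norm (\<zeta> N j - z N j) \<le> \<eta> / 4" using near[OF j(1)] DN \<kappa> by linarith
            have "\<zeta> N j - g s = (\<zeta> N j - z N j) + (F (r n) (real j / real N) - F (r n) s) + (F (r n) s - g s)"
              by (simp add: zj)
            then have "norm (\<zeta> N j - g s) < \<eta>"
              using a1 a2 a3 norm_triangle_ineq[of "(\<zeta> N j - z N j) + (F (r n) (real j / real N) - F (r n) s)" "F (r n) s - g s"]
                norm_triangle_ineq[of "\<zeta> N j - z N j" "F (r n) (real j / real N) - F (r n) s"] by simp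
            from Gnear[OF js1 this] have G1: "norm (G (real j / real N) (\<zeta> N j) - G s (g s)) \<le> e / 2" .
            have dec: "z N (Suc j) - z N j - (1 / real N) *\<^sub>R G s (g s) =
               (z N (Suc j) - z N j - (1 / real N) *\<^sub>R G (real j / real N) (\<zeta> N j)) + (1 / real N) *\<^sub>R (G (real j / real N) (\<zeta> N j) - G s (g s))"
              by (simp add: algebra_simps)
            have "norm (z N (Suc j) - z N j - (1 / real N) *\<^sub>R G s (g s))
               \<le> norm (z N (Suc j) - z N j - (1 / real N) *\<^sub>R G (real j / real N) (\<zeta> N j)) + 1 / real N * norm (G (real j / real N) (\<zeta> N j) - G s (g s))"
              by (subst dec, rule order_trans[OF norm_triangle_ineq]) simp
            also have "\<dots> \<le> D / (real N)\<^sup>2 + 1 / real N * (e / 2)"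
              by (intro add_mono euler[OF j(1)] mult_left_mono G1) simp
            also have "\<dots> = (D / real N + e / 2) / real N" by (simp add: power2_eq_square add_divide_distrib)
            also have "\<dots> \<le> e / real N" using DN \<kappa> by (intro divide_right_mono) auto
            finally show "norm (z N (Suc j) - z N j - (1 / real N) *\<^sub>R G s (g s)) \<le> e / real N" .
          qed (use ab in \<open>auto simp: N_def\<close>)
        qed
        then show ?thesis by blast
      qed
      ultimately show ?thesis by (rule LIMSEQ_le_const2)
    qed
    show "\<exists>d>0. \<forall>y\<in>{0..1}. norm (y - s) < d \<longrightarrow> norm (g y - g s - (y - s) *\<^sub>R G s (g s)) \<le> e * norm (y - s)"
    proof (intro exI conjI ballI impI)
      show "\<delta> > 0" by fact
      fix y assume y: "y \<in> {0..1}" "norm (y - s) < \<delta>"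
      show "norm (g y - g s - (y - s) *\<^sub>R G s (g s)) \<le> e * norm (y - s)"
      proof (cases "s \<le> y")
        case True
        then show ?thesis using main[of s y] y s \<delta> by simp
      next
        case False
        have "norm (g s - g y - (s - y) *\<^sub>R G s (g s)) \<le> e * (s - y)" using main[of y s] y s \<delta> False by simp
        moreover have "g y - g s - (y - s) *\<^sub>R G s (g s) = - (g s - g y - (s - y) *\<^sub>R G s (g s))"
          by (simp add: algebra_simps)
        ultimately show ?thesis using False by (simp only: norm_minus_cancel) simp
      qed
    qed
  qed
  moreover have "(\<lambda>k. z (Suc (r k)) 0) \<longlonglongrightarrow> g 0" "(\<lambda>k. z (Suc (r k)) (Suc (r k))) \<longlonglongrightarrow> g 1"
    using lim[of 0] lim[of 1] by (simp_all add: F0 F1)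
  ultimately show ?thesis using r by blast
qed

section \<open>Periodic orbits on a product with a barrier\<close>

text \<open>The building block of the barrier, differentiable once but not twice at 0. The remainder
  of the linear approximation is at most (y - x)^2 on either side of the kink.\<close>

lemma has_real_derivative_max_sq: "((\<lambda>x. (max 0 x)\<^sup>2) has_real_derivative 2 * max 0 x) (at (x::real))"
  unfolding has_field_derivative_def has_derivative_within_alt
proof (intro conjI allI impI)
  show "bounded_linear ((*) (2 * max 0 x))" by (rule bounded_linear_mult_right)
  fix e :: real assume e: "0 < e"
  have key: "\<bar>(max 0 y)\<^sup>2 - (max 0 x)\<^sup>2 - 2 * max 0 x * (y - x)\<bar> \<le> (y - x)\<^sup>2" for y
  proof (cases "x \<ge> 0")
    case x: True
    show ?thesis
    proof (cases "y \<ge> 0")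
      case True
      have "y\<^sup>2 - x\<^sup>2 - 2 * x * (y - x) = (y - x)\<^sup>2" by (simp add: power2_eq_square algebra_simps)
      then show ?thesis using x True by simp
    next
      case False
      have e1: "0 - x\<^sup>2 - 2 * x * (y - x) = (y - x)\<^sup>2 - y\<^sup>2" by (simp add: power2_eq_square algebra_simps)
      have "x * y \<le> 0" using x False by (simp add: mult_le_0_iff)
      moreover have "(y - x)\<^sup>2 - y\<^sup>2 = x\<^sup>2 - 2 * (x * y)" by (simp add: power2_eq_square algebra_simps)
      ultimately have "(y - x)\<^sup>2 - y\<^sup>2 \<ge> 0" using zero_le_power2[of x] by linarith
      then show ?thesis using e1 x False by simp
    qed
  next
    case x: False
    show ?thesis
    proof (cases "y \<ge> 0")
      case True
      then have "y\<^sup>2 \<le> (y - x)\<^sup>2" using x by (intro power_mono) auto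
      then show ?thesis using x True by simp
    qed (use x in simp)
  qed
  show "\<exists>d>0. \<forall>y\<in>UNIV. norm (y - x) < d \<longrightarrow> norm ((max 0 y)\<^sup>2 - (max 0 x)\<^sup>2 - 2 * max 0 x * (y - x)) \<le> e * norm (y - x)"
  proof (intro exI conjI ballI impI)
    show "e > 0" by fact
    fix y assume "norm (y - x) < e"
    then have "(y - x)\<^sup>2 \<le> e * norm (y - x)"
      by (metis abs_ge_zero less_imp_le mult_right_mono power2_abs power2_eq_square real_norm_def)
    then show "norm ((max 0 y)\<^sup>2 - (max 0 x)\<^sup>2 - 2 * max 0 x * (y - x)) \<le> e * norm (y - x)"
      using key[of y] by simp
  qed
qed

text \<open>This is -K times the Huber function of the distance d to [-R, R]: it equals -K d^2 / 2
  up to d = b and continues affinely with slope of modulus K b. Thus its derivative is Lipschitz and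
  also bounded, which a pure square would not provide.\<close>

definition barrier :: "real \<Rightarrow> real \<Rightarrow> real \<Rightarrow> real \<Rightarrow> real" where
  "barrier K b R x = - (K / 2) * ((max 0 (x - R))\<^sup>2 - (max 0 (x - R - b))\<^sup>2
     + (max 0 (- x - R))\<^sup>2 - (max 0 (- x - R - b))\<^sup>2)"

definition barrier' :: "real \<Rightarrow> real \<Rightarrow> real \<Rightarrow> real \<Rightarrow> real" where
  "barrier' K b R x = - K * (max 0 (x - R) - max 0 (x - R - b) - max 0 (- x - R) + max 0 (- x - R - b))"

lemma has_real_derivative_barrier: "(barrier K b R has_real_derivative barrier' K b R x) (at x)"
proof -
  have 1: "((\<lambda>x. (max 0 (x - c))\<^sup>2) has_real_derivative 2 * max 0 (x - c) * 1) (at x)" for c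
    by (rule DERIV_chain2[OF has_real_derivative_max_sq]) (auto intro!: derivative_eq_intros)
  have 2: "((\<lambda>x. (max 0 (- x - c))\<^sup>2) has_real_derivative 2 * max 0 (- x - c) * (- 1)) (at x)" for c
    by (rule DERIV_chain2[OF has_real_derivative_max_sq]) (auto intro!: derivative_eq_intros)
  have 3: "barrier K b R = (\<lambda>x. - (K / 2) * ((max 0 (x - R))\<^sup>2 - (max 0 (x - (R + b)))\<^sup>2
     + (max 0 (- x - R))\<^sup>2 - (max 0 (- x - (R + b)))\<^sup>2))"
    by (simp add: barrier_def diff_diff_eq fun_eq_iff)
  have "((\<lambda>x. - (K / 2) * ((max 0 (x - R))\<^sup>2 - (max 0 (x - (R + b)))\<^sup>2
     + (max 0 (- x - R))\<^sup>2 - (max 0 (- x - (R + b)))\<^sup>2)) has_real_derivative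
     - (K / 2) * (2 * max 0 (x - R) * 1 - 2 * max 0 (x - (R + b)) * 1 + 2 * max 0 (- x - R) * (- 1) - 2 * max 0 (- x - (R + b)) * (- 1))) (at x)"
    by (intro DERIV_cmult DERIV_add DERIV_diff 1 2)
  also have "- (K / 2) * (2 * max 0 (x - R) * 1 - 2 * max 0 (x - (R + b)) * 1 + 2 * max 0 (- x - R) * (- 1) - 2 * max 0 (- x - (R + b)) * (- 1))
     = barrier' K b R x" by (simp add: barrier'_def diff_diff_eq algebra_simps)
  finally show ?thesis unfolding 3 .
qed

lemma barrier_zero:
  assumes "\<bar>x\<bar> \<le> R" "b \<ge> 0"
  shows "barrier K b R x = 0" "barrier' K b R x = 0"
proof -
  have "max 0 (x - R) = 0" "max 0 (x - R - b) = 0" "max 0 (- x - R) = 0" "max 0 (- x - R - b) = 0"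
    using assms by auto
  then show "barrier K b R x = 0" "barrier' K b R x = 0" by (simp_all add: barrier_def barrier'_def)
qed

lemma barrier'_lipschitz: "K \<ge> 0 \<Longrightarrow> \<bar>barrier' K b R x - barrier' K b R y\<bar> \<le> 4 * K * \<bar>x - y\<bar>"
proof -
  assume K: "K \<ge> 0"
  have "\<bar>(max 0 (x - R) - max 0 (x - R - b) - max 0 (- x - R) + max 0 (- x - R - b)) -
     (max 0 (y - R) - max 0 (y - R - b) - max 0 (- y - R) + max 0 (- y - R - b))\<bar> \<le> 4 * \<bar>x - y\<bar>"
  proof -
    have m: "\<bar>max 0 u - max 0 v\<bar> \<le> d" if "\<bar>u - v\<bar> \<le> d" for u v d :: real using that by linarith
    have lin: "\<bar>(a1 - a2 - a3 + a4) - (b1 - b2 - b3 + b4)\<bar> \<le> 4 * d"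
      if "\<bar>a1 - b1\<bar> \<le> d" "\<bar>a2 - b2\<bar> \<le> d" "\<bar>a3 - b3\<bar> \<le> d" "\<bar>a4 - b4\<bar> \<le> d"
      for a1 a2 a3 a4 b1 b2 b3 b4 d :: real using that by linarith
    show ?thesis by (intro lin m) auto
  qed
  then have "K * \<bar>(max 0 (x - R) - max 0 (x - R - b) - max 0 (- x - R) + max 0 (- x - R - b)) -
     (max 0 (y - R) - max 0 (y - R - b) - max 0 (- y - R) + max 0 (- y - R - b))\<bar> \<le> K * (4 * \<bar>x - y\<bar>)"
    using K by (rule mult_left_mono)
  moreover have "barrier' K b R x - barrier' K b R y = - (K * ((max 0 (x - R) - max 0 (x - R - b) - max 0 (- x - R) + max 0 (- x - R - b)) -
     (max 0 (y - R) - max 0 (y - R - b) - max 0 (- y - R) + max 0 (- y - R - b))))"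
    unfolding barrier'_def by (simp only: right_diff_distrib mult_minus_left minus_diff_eq diff_minus_eq_add)
  ultimately show ?thesis using K by (simp add: abs_mult)
qed

lemma barrier'_bounded: "K \<ge> 0 \<Longrightarrow> b \<ge> 0 \<Longrightarrow> R \<ge> 0 \<Longrightarrow> \<bar>barrier' K b R x\<bar> \<le> K * b"
proof -
  assume K: "K \<ge> 0" "b \<ge> 0" "R \<ge> 0"
  have "\<bar>max 0 (x - R) - max 0 (x - R - b) - max 0 (- x - R) + max 0 (- x - R - b)\<bar> \<le> b"
    using K by (simp add: max_def)
  then have "K * \<bar>max 0 (x - R) - max 0 (x - R - b) - max 0 (- x - R) + max 0 (- x - R - b)\<bar> \<le> K * b"
    using K(1) by (rule mult_left_mono)
  then show ?thesis using K by (simp add: barrier'_def abs_mult)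
qed

lemma barrier'_far: "K \<ge> 0 \<Longrightarrow> b \<ge> 0 \<Longrightarrow> R \<ge> 0 \<Longrightarrow> x \<ge> R + b \<Longrightarrow> barrier' K b R x = - (K * b)"
  "K \<ge> 0 \<Longrightarrow> b \<ge> 0 \<Longrightarrow> R \<ge> 0 \<Longrightarrow> x \<le> - (R + b) \<Longrightarrow> barrier' K b R x = K * b"
  by (auto simp: barrier'_def max_def)

text \<open>The Legendre transform of the barrier exceeds the one of its limit, the function that is
  infinite outside \<open>[-R, R]\<close>, by at most \<open>l\<^sup>2 / (2 K)\<close>.\<close>

lemma barrier_legendre:
  assumes K: "K > 0" and R: "R \<ge> 0" and l: "\<bar>l\<bar> \<le> K * b"
  shows "barrier K b R x - x * l \<le> R * \<bar>l\<bar> + l\<^sup>2 / (2 * K)"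
proof -
  \<comment> \<open>At distance \<beta> from [-R, R] the barrier has slope of modulus |l|. Up to the
    factor - K / 2, \<open>low\<close> is the tangent line there, and convexity of the Huber
    function puts the function above it.\<close>
  define \<beta> where "\<beta> = \<bar>l\<bar> / K"
  have \<beta>: "0 \<le> \<beta>" "\<beta> \<le> b" using K l by (auto simp: \<beta>_def field_simps)
  have low: "(max 0 y)\<^sup>2 - (max 0 (y - b))\<^sup>2 \<ge> 2 * \<beta> * y - \<beta>\<^sup>2" for y
  proof (cases "y \<ge> b")
    case True
    have "(b - \<beta>) * (2 * y - b - \<beta>) \<ge> 0" using True \<beta> by (intro mult_nonneg_nonneg) auto
    then show ?thesis using True \<beta> by (simp add: power2_eq_square algebra_simps)
  next
    case y: False
    show ?thesis
    proof (cases "y \<ge> 0")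
      case True
      then show ?thesis using y zero_le_power2[of "y - \<beta>"] by (simp add: power2_eq_square algebra_simps)
    next
      case False
      have y0: "2 * \<beta> * y \<le> 0" using False \<beta> by (simp add: mult_le_0_iff)
      have "max 0 y = 0" "max 0 (y - b) = 0" using False \<beta> by auto
      then show ?thesis by (simp, use y0 zero_le_power2[of \<beta>] in linarith)
    qed
  qed
  have pos: "(max 0 y)\<^sup>2 - (max 0 (y - b))\<^sup>2 \<ge> 0" for y
    using power_mono[of "max 0 (y - b)" "max 0 y" 2] \<beta> by auto
  have "2 * \<beta> * (\<bar>x\<bar> - R) - \<beta>\<^sup>2 \<le> (max 0 (x - R))\<^sup>2 - (max 0 (x - R - b))\<^sup>2
     + (max 0 (- x - R))\<^sup>2 - (max 0 (- x - R - b))\<^sup>2"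
  proof (cases "x \<ge> 0")
    case True
    then have "\<bar>x\<bar> = x" by simp
    show ?thesis unfolding \<open>\<bar>x\<bar> = x\<close> using low[of "x - R"] pos[of "- x - R"] by linarith
  next
    case False
    then have "\<bar>x\<bar> = - x" by simp
    show ?thesis unfolding \<open>\<bar>x\<bar> = - x\<close> using low[of "- x - R"] pos[of "x - R"] by linarith
  qed
  then have "K / 2 * (2 * \<beta> * (\<bar>x\<bar> - R) - \<beta>\<^sup>2) \<le> K / 2 * ((max 0 (x - R))\<^sup>2 - (max 0 (x - R - b))\<^sup>2
     + (max 0 (- x - R))\<^sup>2 - (max 0 (- x - R - b))\<^sup>2)"
    using K by (intro mult_left_mono) auto
  then have "barrier K b R x \<le> - (K / 2 * (2 * \<beta> * (\<bar>x\<bar> - R) - \<beta>\<^sup>2))"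
    unfolding barrier_def by simp
  also have "\<dots> = R * \<bar>l\<bar> - \<bar>x\<bar> * \<bar>l\<bar> + l\<^sup>2 / (2 * K)"
    using K by (simp add: \<beta>_def field_simps power2_eq_square)
  finally show ?thesis using abs_ge_minus_self[of "x * l"] by (simp add: abs_mult)
qed

text \<open>The proof composes \<open>p\<close> with a function that is flat on \<open>[-r, r]\<close> and injective outside.\<close>

lemma confined_or_constant:
  fixes p p' :: "real \<Rightarrow> real"
  assumes der: "\<And>t. t \<in> {0..1} \<Longrightarrow> (p has_real_derivative p' t) (at t within {0..1})"
    and zero: "\<And>t. t \<in> {0..1} \<Longrightarrow> \<bar>p t\<bar> > r \<Longrightarrow> p' t = 0" and r: "r \<ge> 0"
    and s: "s \<in> {0..1}" "\<bar>p s\<bar> > r" and t: "t \<in> {0..1}"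
  shows "p t = p s"
proof -
  define \<psi> where "\<psi> x = (max 0 (x - r))\<^sup>2 - (max 0 (- x - r))\<^sup>2" for x :: real
  define \<psi>' where "\<psi>' x = 2 * max 0 (x - r) + 2 * max 0 (- x - r)" for x :: real
  have 1: "((\<lambda>x. (max 0 (x - r))\<^sup>2) has_real_derivative 2 * max 0 (x - r) * 1) (at x)" for x
    by (rule DERIV_chain2[OF has_real_derivative_max_sq]) (auto intro!: derivative_eq_intros)
  have 2: "((\<lambda>x. (max 0 (- x - r))\<^sup>2) has_real_derivative 2 * max 0 (- x - r) * (- 1)) (at x)" for x
    by (rule DERIV_chain2[OF has_real_derivative_max_sq]) (auto intro!: derivative_eq_intros)
  have d\<psi>: "(\<psi> has_real_derivative \<psi>' x) (at x)" for x
    unfolding \<psi>_def[abs_def] using DERIV_diff[OF 1 2, of x] by (simp add: \<psi>'_def)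
  have "((\<lambda>t. \<psi> (p t)) has_real_derivative 0) (at t within {0..1})" if "t \<in> {0..1}" for t
  proof -
    have "((\<lambda>t. \<psi> (p t)) has_real_derivative \<psi>' (p t) * p' t) (at t within {0..1})"
      by (rule DERIV_chain2[OF d\<psi> der[OF that]])
    moreover have "\<psi>' (p t) * p' t = 0"
    proof (cases "\<bar>p t\<bar> > r")
      case False
      then have "max 0 (p t - r) = 0" "max 0 (- p t - r) = 0" by auto
      then show ?thesis by (simp add: \<psi>'_def)
    qed (use zero[OF that] in simp)
    ultimately show ?thesis by simp
  qed
  then have "\<exists>c. \<forall>t\<in>{0..1}. \<psi> (p t) = c"
    by (intro has_field_derivative_zero_constant) auto
  then have "\<psi> (p t) = \<psi> (p s)" using s t by auto
  show ?thesis
  proof (cases "p s > 0")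
    case True
    then have ps: "p s - r > 0" using s by simp
    have \<psi>s: "\<psi> (p s) = (p s - r)\<^sup>2" using ps r by (simp add: \<psi>_def max_def)
    have "\<psi> (p t) > 0" using \<open>\<psi> (p t) = \<psi> (p s)\<close> \<psi>s ps by simp
    have pt: "p t - r > 0"
    proof (rule ccontr)
      assume "\<not> p t - r > 0"
      then have "max 0 (p t - r) = 0" by simp
      then show False using \<open>\<psi> (p t) > 0\<close> by (simp add: \<psi>_def)
    qed
    then have "\<psi> (p t) = (p t - r)\<^sup>2" using r by (simp add: \<psi>_def max_def)
    then show ?thesis using \<open>\<psi> (p t) = \<psi> (p s)\<close> \<psi>s ps pt by (simp add: power2_eq_iff)
  next
    case False
    then have ps: "- p s - r > 0" using s by simp
    have \<psi>s: "\<psi> (p s) = - (- p s - r)\<^sup>2" using ps r by (simp add: \<psi>_def max_def)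
    have "(- p s - r)\<^sup>2 > 0" using ps by simp
    then have "\<psi> (p t) < 0" using \<open>\<psi> (p t) = \<psi> (p s)\<close> \<psi>s by linarith
    have pt: "- p t - r > 0"
    proof (rule ccontr)
      assume "\<not> - p t - r > 0"
      then have "max 0 (- p t - r) = 0" by simp
      then show False using \<open>\<psi> (p t) < 0\<close> by (simp add: \<psi>_def)
    qed
    then have "\<psi> (p t) = - (- p t - r)\<^sup>2" using r by (simp add: \<psi>_def max_def)
    then have "(- p t - r)\<^sup>2 = (- p s - r)\<^sup>2" using \<open>\<psi> (p t) = \<psi> (p s)\<close> \<psi>s by simp
    then show ?thesis using ps pt by (simp only: power2_eq_iff) linarith
  qed
qed

section \<open>Passage from discrete to continuous orbits\<close>

lemma abs_fst_le_norm: "\<bar>fst z\<bar> \<le> norm (z :: real \<times> 'f::real_normed_vector)"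
  by (metis norm_fst_le prod.collapse real_norm_def)

text \<open>The action is carried along as an additional component of the Euler scheme, which makes it converge too.\<close>

lemma hamiltonian_orbit:
  fixes F :: "real \<Rightarrow> real \<times> 'f::euclidean_space \<Rightarrow> real \<times> 'f \<Rightarrow> real"
    and Fp Fq :: "real \<Rightarrow> real \<times> 'f \<Rightarrow> real \<times> 'f \<Rightarrow> real \<times> 'f"
    and \<Lambda>p :: "'f set" and \<Lambda>q :: "(real \<times> 'f) set"
  assumes der: "\<And>t p q. ((\<lambda>z. F t (fst z) (snd z)) has_derivative (\<lambda>z. Fp t p q \<bullet> fst z + Fq t p q \<bullet> snd z)) (at (p, q))"
    and lip: "\<And>t p q p' q'. norm (Fp t p q - Fp t p' q') \<le> L * (norm (p - p') + norm (q - q'))"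
      "\<And>t p q p' q'. norm (Fq t p q - Fq t p' q') \<le> L * (norm (p - p') + norm (q - q'))"
    and L: "L \<ge> 0"
    and bd: "\<And>t p q. norm (Fp t p q) \<le> C" "\<And>t p q. norm (Fq t p q) \<le> C" "\<And>t p q. \<bar>F t p q\<bar> \<le> C"
    and contF: "continuous_on UNIV (\<lambda>(t, p, q). F t p q)" "continuous_on UNIV (\<lambda>(t, p, q). Fp t p q)"
      "continuous_on UNIV (\<lambda>(t, p, q). Fq t p q)"
    and per: "\<And>t p q a b. a \<in> \<Lambda>p \<Longrightarrow> b \<in> \<Lambda>q \<Longrightarrow> F t (p + (0, a)) (q + b) = F t p q"
      "\<And>t p q a b. a \<in> \<Lambda>p \<Longrightarrow> b \<in> \<Lambda>q \<Longrightarrow> Fp t (p + (0, a)) (q + b) = Fp t p q"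
      "\<And>t p q a b. a \<in> \<Lambda>p \<Longrightarrow> b \<in> \<Lambda>q \<Longrightarrow> Fq t (p + (0, a)) (q + b) = Fq t p q"
    and cocompact: "\<And>x. \<exists>a\<in>\<Lambda>p. norm (x + a) \<le> D" "\<And>y. \<exists>b\<in>\<Lambda>q. norm (y + b) \<le> D"
    and supp: "\<And>t p q. \<bar>fst p\<bar> > r \<Longrightarrow> F t p q = 0 \<and> Fp t p q = 0 \<and> Fq t p q = 0"
    and r: "0 \<le> r" "r < R"
    and u: "\<bar>u\<bar> < R" and low: "\<And>t q. F t (u, 0) q \<ge> c"
    and c: "c - u * l > R * \<bar>l\<bar>"
  shows "\<exists>P Q. (\<forall>t\<in>{0..1}. (P has_vector_derivative - Fq t (P t) (Q t)) (at t within {0..1}) \<and>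
       (Q has_vector_derivative Fp t (P t) (Q t)) (at t within {0..1}) \<and> \<bar>fst (P t)\<bar> < R) \<and>
     P 1 = P 0 \<and> Q 1 = Q 0 + (l, 0) \<and>
     integral {0..1} (\<lambda>t. F t (P t) (Q t) - P t \<bullet> Fp t (P t) (Q t)) \<ge> c - u * l"
proof -
  have R0: "R > 0" using r by simp
  define gap where "gap = c - u * l - R * \<bar>l\<bar>"
  have gap: "gap > 0" using c by (simp add: gap_def)
  \<comment> \<open>Steep enough that the excess l^2 / (2 K) of the Legendre transform of the
    barrier stays below the gap.\<close>
  define K where "K = (l\<^sup>2 + 1) / gap"
  have K: "K > 0" using gap by (simp add: K_def add_nonneg_pos)
  have Kgap: "l\<^sup>2 / (2 * K) < gap"
  proof -
    have "l\<^sup>2 < 2 * (l\<^sup>2 + 1)" using zero_le_power2[of l] by (smt (verit))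
    then have "l\<^sup>2 < gap * (2 * K)" using gap by (simp add: K_def)
    then show ?thesis using K by (simp add: divide_less_eq)
  qed
  \<comment> \<open>The modulus of the slope far out. It exceeds |l| by 2, whereas the total
    displacement of a discrete orbit there reflects the slope with an error of at most 1. The width
    b is then dictated by K b = \<kappa>.\<close>
  define \<kappa> where "\<kappa> = \<bar>l\<bar> + 2"
  define b where "b = \<kappa> / K"
  have b: "b > 0" "K * b = \<kappa>" using K by (auto simp: b_def \<kappa>_def add_nonneg_pos)
  define \<phi> where "\<phi> = barrier K b R"
  define \<phi>' where "\<phi>' = barrier' K b R"
  have \<phi>: "(\<phi> has_real_derivative \<phi>' x) (at x)" for x
    unfolding \<phi>_def \<phi>'_def by (rule has_real_derivative_barrier)
  have \<phi>0: "\<phi> x = 0" "\<phi>' x = 0" if "\<bar>x\<bar> \<le> R" for x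
    using barrier_zero[OF that less_imp_le[OF b(1)]] by (auto simp: \<phi>_def \<phi>'_def)
  have \<phi>leg: "\<phi> x - x * l \<le> R * \<bar>l\<bar> + l\<^sup>2 / (2 * K)" for x
    unfolding \<phi>_def by (rule barrier_legendre) (use K R0 b in \<open>auto simp: \<kappa>_def\<close>)
  have \<phi>bd: "\<bar>\<phi>' x\<bar> \<le> \<kappa>" for x
    unfolding \<phi>'_def b(2)[symmetric] by (rule barrier'_bounded) (use K R0 b in auto)
  have \<phi>lip: "\<bar>\<phi>' x - \<phi>' y\<bar> \<le> 4 * K * \<bar>x - y\<bar>" for x y
    unfolding \<phi>'_def by (rule barrier'_lipschitz) (use K in auto)
  have \<phi>far: "x \<ge> R + b \<Longrightarrow> \<phi>' x = - \<kappa>" "x \<le> - (R + b) \<Longrightarrow> \<phi>' x = \<kappa>" for x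
    unfolding \<phi>'_def b(2)[symmetric] using barrier'_far[of K b R x] K R0 b by auto
  have \<phi>cont: "continuous_on S \<phi>" for S using \<phi> by (meson DERIV_isCont continuous_at_imp_continuous_on)
  have \<phi>'cont: "continuous_on S \<phi>'" for S
    unfolding \<phi>'_def barrier'_def[abs_def] by (intro continuous_intros)
  define H where "H t p q = F t p q + \<phi> (fst p)" for t and p q :: "real \<times> 'f"
  define Hp where "Hp t p q = Fp t p q + (\<phi>' (fst p), 0)" for t and p q :: "real \<times> 'f"
  have Hder: "((\<lambda>z. H t (fst z) (snd z)) has_derivative (\<lambda>z. Hp t p q \<bullet> fst z + Fq t p q \<bullet> snd z)) (at (p, q))" for t p q
  proof -
    have "((\<lambda>z::(real\<times>'f)\<times>(real\<times>'f). fst (fst z)) has_derivative (\<lambda>z. fst (fst z))) (at (p, q))"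
      by (intro bounded_linear_imp_has_derivative bounded_linear_intros)
    moreover have "(\<phi> has_derivative (*) (\<phi>' (fst p))) (at (fst (fst (p, q))))"
      using \<phi>[of "fst p"] by (simp add: has_field_derivative_def)
    ultimately have "(\<phi> \<circ> (\<lambda>z::(real\<times>'f)\<times>(real\<times>'f). fst (fst z)) has_derivative (*) (\<phi>' (fst p)) \<circ> (\<lambda>z. fst (fst z))) (at (p, q))"
      by (rule diff_chain_at)
    from has_derivative_add[OF der[of t p q] this] show ?thesis
      by (simp add: H_def Hp_def o_def inner_add_left inner_prod_def algebra_simps)
  qed
  have Hlip: "norm (Hp t p q - Hp t p' q') \<le> (L + 4 * K) * (norm (p - p') + norm (q - q'))" for t p q p' q'
  proof -
    have "norm (Hp t p q - Hp t p' q') \<le> norm (Fp t p q - Fp t p' q') + norm (\<phi>' (fst p) - \<phi>' (fst p'), 0::'f)"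
    proof -
      have "Hp t p q - Hp t p' q' = (Fp t p q - Fp t p' q') + (\<phi>' (fst p) - \<phi>' (fst p'), 0::'f)"
        by (simp add: Hp_def prod_eq_iff)
      then show ?thesis by (simp only: norm_triangle_ineq)
    qed
    also have "norm (\<phi>' (fst p) - \<phi>' (fst p'), 0::'f) = \<bar>\<phi>' (fst p) - \<phi>' (fst p')\<bar>" by (simp add: norm_Pair)
    also have "\<dots> \<le> 4 * K * norm (p - p')"
    proof -
      have "\<bar>fst p - fst p'\<bar> \<le> norm (p - p')" using abs_fst_le_norm[of "p - p'"] by simp
      then have "4 * K * \<bar>fst p - fst p'\<bar> \<le> 4 * K * norm (p - p')" using K by (intro mult_left_mono) auto
      then show ?thesis using \<phi>lip[of "fst p" "fst p'"] by linarith
    qed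
    also have "\<dots> \<le> 4 * K * (norm (p - p') + norm (q - q'))" using K by (intro mult_left_mono) auto
    finally show ?thesis using lip(1)[of t p q p' q'] by (simp add: distrib_right)
  qed
  have Hlip2: "norm (Fq t p q - Fq t p' q') \<le> (L + 4 * K) * (norm (p - p') + norm (q - q'))" for t p q p' q'
  proof -
    have "L * (norm (p - p') + norm (q - q')) \<le> (L + 4 * K) * (norm (p - p') + norm (q - q'))"
      using K by (intro mult_right_mono) auto
    then show ?thesis using lip(2)[of t p q p' q'] by linarith
  qed
  have C0: "C \<ge> 0" using bd(3)[of 0 0 0] by linarith
  define C' where "C' = C + \<kappa>"
  have C': "C \<le> C'" "C' \<ge> 0" using C0 by (auto simp: C'_def \<kappa>_def)
  have Hbd: "norm (Hp t p q) \<le> C'" "norm (Fq t p q) \<le> C'" for t p q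
  proof -
    have "norm (Hp t p q) \<le> norm (Fp t p q) + norm (\<phi>' (fst p), 0::'f)" unfolding Hp_def by (rule norm_triangle_ineq)
    also have "norm (\<phi>' (fst p), 0::'f) = \<bar>\<phi>' (fst p)\<bar>" by (simp add: norm_Pair)
    finally show "norm (Hp t p q) \<le> C'" using bd(1)[of t p q] \<phi>bd[of "fst p"] by (simp add: C'_def)
    show "norm (Fq t p q) \<le> C'" using bd(2)[of t p q] C' by linarith
  qed
  define w where "w = (l, 0 :: 'f)"
  define U where "U = (u, 0 :: 'f)"
  have Uw: "U \<bullet> w = u * l" by (simp add: U_def w_def)
  have Hlow: "H t U q \<ge> c" for t q using low[of t q] \<phi>0(1)[of u] u by (simp add: H_def U_def)
  have Hup: "H t p q - p \<bullet> w \<le> C + (R * \<bar>l\<bar> + l\<^sup>2 / (2 * K))" for t p q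
    using bd(3)[of t p q] \<phi>leg[of "fst p"] by (cases p) (simp add: H_def w_def)

  \<comment> \<open>Discrete orbits and their a priori bounds\<close>
  define good where "good N P Q \<longleftrightarrow> P N = P 0 \<and> Q N = Q 0 + w \<and>
     (\<forall>j<N. norm (P (Suc j) - P j + (1 / real N) *\<^sub>R Fq (j * (1 / real N)) (P (Suc j)) (Q j)) \<le> (1 / real N)\<^sup>2) \<and>
     (\<forall>j<N. norm (Q (Suc j) - Q j - (1 / real N) *\<^sub>R Hp (j * (1 / real N)) (P (Suc j)) (Q j)) \<le> (1 / real N)\<^sup>2) \<and>
     (\<Sum>j<N. 1 / real N * H (j * (1 / real N)) (P (Suc j)) (Q j) - P (Suc j) \<bullet> (Q (Suc j) - Q j)) \<ge> c - u * l"
    for N and P Q :: "nat \<Rightarrow> real \<times> 'f"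
  have LK: "L + 4 * K \<ge> 0" using L K by simp
  have "\<exists>P Q. good N P Q" if "N > 0" for N
    unfolding good_def Uw[symmetric] by (rule discrete_orbit[OF Hder Hlip Hlip2 LK Hbd Hlow Hup that])
  then have goodex: "\<exists>PQ. good N (fst PQ) (snd PQ)" if "N > 0" for N using that by simp
  define P0 where "P0 N = fst (SOME PQ. good N (fst PQ) (snd PQ))" for N
  define Q0 where "Q0 N = snd (SOME PQ. good N (fst PQ) (snd PQ))" for N
  have good: "good N (P0 N) (Q0 N)" if "N > 0" for N
    unfolding P0_def Q0_def by (rule someI_ex[OF goodex[OF that]])
  have per0: "P0 N N = P0 N 0 \<and> Q0 N N = Q0 N 0 + w" if "N > 0" for N
    using good[OF that] unfolding good_def by (elim conjE) (rule conjI)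
  have dP0: "norm (P0 N (Suc j) - P0 N j + (1 / real N) *\<^sub>R Fq (j * (1 / real N)) (P0 N (Suc j)) (Q0 N j)) \<le> (1 / real N)\<^sup>2"
    if "j < N" for N j
    using good[of N] that unfolding good_def by auto
  have dQ0: "norm (Q0 N (Suc j) - Q0 N j - (1 / real N) *\<^sub>R Hp (j * (1 / real N)) (P0 N (Suc j)) (Q0 N j)) \<le> (1 / real N)\<^sup>2"
    if "j < N" for N j
    using good[of N] that unfolding good_def by auto
  have act0: "(\<Sum>j<N. 1 / real N * H (j * (1 / real N)) (P0 N (Suc j)) (Q0 N j) - P0 N (Suc j) \<bullet> (Q0 N (Suc j) - Q0 N j)) \<ge> c - u * l"
    if "N > 0" for N
    using good[OF that] unfolding good_def by (elim conjE)
  \<comment> \<open>A step has length at most (C' + 1) / N, so the momenta of one orbit differ by at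
    most C' + 1. If one of them were further out, all would lie where \<open>Hp\<close> is the
    constant \<open>(sg, 0)\<close>, and Q could not advance by w.\<close>
  have near: "\<bar>fst (P0 N j)\<bar> \<le> R + b + (C' + 1)" and var: "norm (P0 N j - P0 N i) \<le> C' + 1"
    and varQ: "norm (Q0 N j - Q0 N i) \<le> C' + 1"
    and stepP: "j < N \<Longrightarrow> norm (P0 N (Suc j) - P0 N j) \<le> (C' + 1) / N"
    and stepQ: "j < N \<Longrightarrow> norm (Q0 N (Suc j) - Q0 N j) \<le> (C' + 1) / N"
    if N: "N > 0" and ij: "i \<le> N" "j \<le> N" for N i j
  proof -
    have h1: "(1 / real N)\<^sup>2 \<le> 1 / real N" using N by (simp add: power2_eq_square divide_le_eq mult_le_one)
    have sP: "norm (P0 N (Suc j) - P0 N j) \<le> (C' + 1) / N" if j: "j < N" for j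
    proof -
      have "P0 N (Suc j) - P0 N j = (P0 N (Suc j) - P0 N j + (1 / real N) *\<^sub>R Fq (j * (1 / real N)) (P0 N (Suc j)) (Q0 N j))
          - (1 / real N) *\<^sub>R Fq (j * (1 / real N)) (P0 N (Suc j)) (Q0 N j)" by simp
      also have "norm \<dots> \<le> (1 / real N)\<^sup>2 + 1 / real N * norm (Fq (j * (1 / real N)) (P0 N (Suc j)) (Q0 N j))"
        by (rule order_trans[OF norm_triangle_ineq4], rule add_mono[OF dP0[OF j]]) simp
      also have "\<dots> \<le> 1 / real N + 1 / real N * C'"
        by (intro add_mono h1 mult_left_mono Hbd) simp
      finally show ?thesis by (simp add: add_divide_distrib add.commute)
    qed
    have sQ: "norm (Q0 N (Suc j) - Q0 N j) \<le> (C' + 1) / N" if j: "j < N" for j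
    proof -
      have "Q0 N (Suc j) - Q0 N j = (Q0 N (Suc j) - Q0 N j - (1 / real N) *\<^sub>R Hp (j * (1 / real N)) (P0 N (Suc j)) (Q0 N j))
          + (1 / real N) *\<^sub>R Hp (j * (1 / real N)) (P0 N (Suc j)) (Q0 N j)" by simp
      also have "norm \<dots> \<le> (1 / real N)\<^sup>2 + 1 / real N * norm (Hp (j * (1 / real N)) (P0 N (Suc j)) (Q0 N j))"
        by (rule order_trans[OF norm_triangle_ineq], rule add_mono[OF dQ0[OF j]]) simp
      also have "\<dots> \<le> 1 / real N + 1 / real N * C'"
        by (intro add_mono h1 mult_left_mono Hbd) simp
      finally show ?thesis by (simp add: add_divide_distrib add.commute)
    qed
    have tele: "norm (z j - z i) \<le> C' + 1" if "i \<le> j" "j \<le> N" and s: "\<And>j. j < N \<Longrightarrow> norm (z (Suc j) - z j) \<le> (C' + 1) / N"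
      for z :: "nat \<Rightarrow> real \<times> 'f" and i j
    proof -
      have "norm (z j - z i) = norm (\<Sum>k\<in>{i..<j}. z (Suc k) - z k)" using that(1) by (simp add: sum_Suc_diff')
      also have "\<dots> \<le> (\<Sum>k\<in>{i..<j}. (C' + 1) / N)" by (rule sum_norm_le) (use that in auto)
      also have "\<dots> = real (j - i) * ((C' + 1) / N)" by simp
      also have "\<dots> \<le> real N * ((C' + 1) / N)" using that C' by (intro mult_right_mono) auto
      also have "\<dots> = C' + 1" using N by simp
      finally show ?thesis .
    qed
    have tele2: "norm (z j - z i) \<le> C' + 1" if "i \<le> N" "j \<le> N" and s: "\<And>j. j < N \<Longrightarrow> norm (z (Suc j) - z j) \<le> (C' + 1) / N"
      for z :: "nat \<Rightarrow> real \<times> 'f" and i j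
      using tele[of i j z] tele[of j i z] that by (metis linear norm_minus_commute)
    show var: "norm (P0 N j - P0 N i) \<le> C' + 1" using ij sP by (intro tele2)
    show "norm (Q0 N j - Q0 N i) \<le> C' + 1" using ij sQ by (intro tele2)
    show "j < N \<Longrightarrow> norm (P0 N (Suc j) - P0 N j) \<le> (C' + 1) / N" by (rule sP)
    show "j < N \<Longrightarrow> norm (Q0 N (Suc j) - Q0 N j) \<le> (C' + 1) / N" by (rule sQ)
    show "\<bar>fst (P0 N j)\<bar> \<le> R + b + (C' + 1)"
    proof (rule ccontr)
      assume neg: "\<not> ?thesis"
      have close: "\<bar>fst (P0 N k) - fst (P0 N j)\<bar> \<le> C' + 1" if "k \<le> N" for k
      proof -
        have "\<bar>fst (P0 N k) - fst (P0 N j)\<bar> \<le> norm (P0 N k - P0 N j)"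
          using abs_fst_le_norm[of "P0 N k - P0 N j"] by simp
        also have "\<dots> \<le> C' + 1" by (rule tele2) (use that ij sP in auto)
        finally show ?thesis .
      qed
      define sg where "sg = (if fst (P0 N j) > 0 then - \<kappa> else \<kappa>)"
      have slope: "\<phi>' (fst (P0 N k)) = sg" and out: "\<bar>fst (P0 N k)\<bar> > r" if "k \<le> N" for k
      proof -
        have A: "fst (P0 N k) \<ge> R + b" if "fst (P0 N j) > 0" using neg close[OF \<open>k \<le> N\<close>] that by (simp add: abs_if split: if_splits)
        have B: "fst (P0 N k) \<le> - (R + b)" if "\<not> fst (P0 N j) > 0" using neg close[OF \<open>k \<le> N\<close>] that by (simp add: abs_if split: if_splits)
        show "\<phi>' (fst (P0 N k)) = sg" using A B \<phi>far[of "fst (P0 N k)"] by (auto simp: sg_def)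
        show "\<bar>fst (P0 N k)\<bar> > r" using A B r b by (cases "fst (P0 N j) > 0") auto
      qed
      have Hout: "Hp t (P0 N (Suc k)) q = (sg, 0)" if "k < N" for k t q
        using supp[OF out[of "Suc k"]] slope[of "Suc k"] that by (simp add: Hp_def)
      have "norm (w - (sg, 0)) \<le> 1"
      proof -
        have "(\<Sum>k<N. Q0 N (Suc k) - Q0 N k - (1 / real N) *\<^sub>R (sg, 0)) = Q0 N N - Q0 N 0 - real N *\<^sub>R ((1 / real N) *\<^sub>R (sg, 0))"
          by (subst sum_subtractf) (simp only: sum_lessThan_telescope sum_constant_scaleR card_lessThan)
        also have "\<dots> = w - (sg, 0)" using per0[OF N] N by simp
        finally have "norm (w - (sg, 0)) = norm (\<Sum>k<N. Q0 N (Suc k) - Q0 N k - (1 / real N) *\<^sub>R (sg, 0 :: 'f))" by simp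
        also have "\<dots> \<le> (\<Sum>k<N. (1 / real N)\<^sup>2)"
        proof (rule sum_norm_le)
          fix k assume "k \<in> {..<N}"
          then show "norm (Q0 N (Suc k) - Q0 N k - (1 / real N) *\<^sub>R (sg, 0 :: 'f)) \<le> (1 / real N)\<^sup>2"
            using dQ0[of k N] Hout[of k] by simp
        qed
        also have "\<dots> = 1 / real N" using N by (simp add: power2_eq_square)
        also have "\<dots> \<le> 1" using N by simp
        finally show ?thesis .
      qed
      then have "\<bar>l - sg\<bar> \<le> 1" using abs_fst_le_norm[of "w - (sg, 0)"] by (simp add: w_def)
      then show False by (auto simp: sg_def \<kappa>_def split: if_splits)
    qed
  qed
  \<comment> \<open>The momentum p_0 is bounded by \<open>near\<close>; all other coordinates are
    brought into a bounded region by lattice translations, under which the scheme is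
    invariant.\<close>
  obtain aN where aN: "\<And>N. aN N \<in> \<Lambda>p" "\<And>N. norm (snd (P0 N 0) + aN N) \<le> D"
    using bchoice[of UNIV "\<lambda>N a. a \<in> \<Lambda>p \<and> norm (snd (P0 N 0) + a) \<le> D"] cocompact(1) by (auto simp: Bex_def)
  obtain bN where bN: "\<And>N. bN N \<in> \<Lambda>q" "\<And>N. norm (Q0 N 0 + bN N) \<le> D"
    using bchoice[of UNIV "\<lambda>N a. a \<in> \<Lambda>q \<and> norm (Q0 N 0 + a) \<le> D"] cocompact(2) by (auto simp: Bex_def)
  define P1 where "P1 N j = P0 N j + (0, aN N)" for N j
  define Q1 where "Q1 N j = Q0 N j + bN N" for N j
  have fst1: "fst (P1 N j) = fst (P0 N j)" for N j by (simp add: P1_def)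
  have H1: "H t (P1 N i) (Q1 N j) = H t (P0 N i) (Q0 N j)" for t N i j
    unfolding H_def fst1 unfolding P1_def Q1_def per(1)[OF aN(1) bN(1)] ..
  have Hp1: "Hp t (P1 N i) (Q1 N j) = Hp t (P0 N i) (Q0 N j)" for t N i j
    unfolding Hp_def fst1 unfolding P1_def Q1_def per(2)[OF aN(1) bN(1)] ..
  have Fq1: "Fq t (P1 N i) (Q1 N j) = Fq t (P0 N i) (Q0 N j)" for t N i j
    unfolding P1_def Q1_def per(3)[OF aN(1) bN(1)] ..
  have dif1: "P1 N i - P1 N j = P0 N i - P0 N j" "Q1 N i - Q1 N j = Q0 N i - Q0 N j" for N i j
    by (simp_all add: P1_def Q1_def)
  define dS where "dS N i = 1 / real N * H (i * (1 / real N)) (P1 N (Suc i)) (Q1 N i) - P1 N (Suc i) \<bullet> (Q1 N (Suc i) - Q1 N i)" for N and i :: nat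
  define S where "S N j = (\<Sum>i<j. dS N i)" for N and j :: nat
  have SN: "S N N \<ge> c - u * l" if N: "N > 0" for N
  proof -
    \<comment> \<open>Translating P by \<open>(0, aN N)\<close> changes the action by the inner
      product of this vector with w, which is 0: the class is trivial in the torus factor.\<close>
    have "(\<Sum>i<N. (0, aN N) \<bullet> (Q0 N (Suc i) - Q0 N i)) = (0, aN N) \<bullet> (Q0 N N - Q0 N 0)"
      by (simp only: inner_sum_right[symmetric] sum_lessThan_telescope)
    also have "\<dots> = 0" using per0[OF N] by (simp add: w_def)
    finally have "S N N = (\<Sum>j<N. 1 / real N * H (j * (1 / real N)) (P0 N (Suc j)) (Q0 N j) - P0 N (Suc j) \<bullet> (Q0 N (Suc j) - Q0 N j))"
      unfolding S_def dS_def H1 dif1 by (simp add: P1_def inner_add_left sum_subtractf sum.distrib)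
    then show ?thesis using act0[OF N] by simp
  qed
  define B1 where "B1 = (R + b + (C' + 1)) + (D + (C' + 1))"
  have D0: "D \<ge> 0" using cocompact(1)[of 0] norm_ge_zero order_trans by blast
  have B1: "norm (P1 N j) \<le> B1" if "N > 0" "j \<le> N" for N j
  proof -
    have "norm (P1 N j) \<le> \<bar>fst (P1 N j)\<bar> + norm (snd (P1 N j))"
      using norm_Pair_le[of "fst (P1 N j)" "snd (P1 N j)"] by simp
    also have "norm (snd (P1 N j)) \<le> norm (snd (P0 N 0) + aN N) + norm (snd (P0 N j - P0 N 0))"
    proof -
      have "snd (P1 N j) = (snd (P0 N 0) + aN N) + snd (P0 N j - P0 N 0)" by (simp add: P1_def)
      then show ?thesis by (simp only: norm_triangle_ineq)
    qed
    also have "norm (snd (P0 N j - P0 N 0)) \<le> norm (P0 N j - P0 N 0)" by (metis norm_snd_le prod.collapse)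
    also have "\<dots> \<le> C' + 1" by (rule var) (use that in auto)
    also have "\<bar>fst (P1 N j)\<bar> \<le> R + b + (C' + 1)" unfolding fst1 by (rule near[of N 0 j]) (use that in auto)
    finally show ?thesis using aN(2)[of N] by (simp add: B1_def)
  qed
  have B10: "B1 \<ge> 0" using D0 C' R0 b by (simp add: B1_def)
  have "bounded (\<phi> ` {- (R + b + (C' + 1))..R + b + (C' + 1)})"
    by (intro compact_imp_bounded compact_continuous_image \<phi>cont) simp
  then obtain M\<phi> where M\<phi>': "\<forall>y\<in>\<phi> ` {- (R + b + (C' + 1))..R + b + (C' + 1)}. norm y \<le> M\<phi>"
    unfolding bounded_iff by blast
  have M\<phi>: "\<bar>\<phi> x\<bar> \<le> M\<phi>" if "\<bar>x\<bar> \<le> R + b + (C' + 1)" for x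
  proof -
    have "x \<in> {- (R + b + (C' + 1))..R + b + (C' + 1)}" using that by (simp add: abs_le_iff)
    then show ?thesis using M\<phi>' by force
  qed
  have M\<phi>0: "M\<phi> \<ge> 0" using M\<phi>[of 0] R0 b C' by (simp add: order_trans[OF abs_ge_zero])
  \<comment> \<open>One constant for three requirements of \<open>euler_polygon_limit\<close>: the
    length of a step, the Euler error, and the distance of \<zeta> from the polygon.\<close>
  define D2 where "D2 = 2 * (C' + 1) + (C + M\<phi> + B1 * (C' + 1)) + (2 + B1)"
  have D2: "2 * (C' + 1) + (C + M\<phi> + B1 * (C' + 1)) \<le> D2" "2 + B1 \<le> D2" "C' + 1 \<le> D2"
    using C' C0 M\<phi>0 B10 by (auto simp: D2_def add_nonneg_nonneg)
  define z where "z N j = (P1 N j, Q1 N j, S N j)" for N j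
  \<comment> \<open>New momentum and old position: the point at which the discrete equations
    evaluate the derivatives.\<close>
  define \<zeta> where "\<zeta> N j = (P1 N (Suc j), Q1 N j, S N j)" for N j
  define G where "G t x = (- Fq t (fst x) (fst (snd x)), Hp t (fst x) (fst (snd x)),
      H t (fst x) (fst (snd x)) - fst x \<bullet> Hp t (fst x) (fst (snd x)))" for t and x :: "(real \<times> 'f) \<times> (real \<times> 'f) \<times> real"
  have norm3: "norm (a, b, c) \<le> norm a + norm b + norm c" for a b :: "real \<times> 'f" and c :: real
    using norm_Pair_le[of a "(b, c)"] norm_Pair_le[of b c] by linarith
  have "\<exists>Z r. strict_mono (r :: nat \<Rightarrow> nat) \<and>
     (\<forall>t\<in>{0..1}. (Z has_vector_derivative G t (Z t)) (at t within {0..1})) \<and>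
     (\<lambda>k. z (Suc (r k)) 0) \<longlonglongrightarrow> Z 0 \<and> (\<lambda>k. z (Suc (r k)) (Suc (r k))) \<longlonglongrightarrow> Z 1"
  proof (rule euler_polygon_limit[where \<zeta> = \<zeta> and B = "B1 + D" and D = D2])
    have sel: "continuous_on UNIV (\<lambda>x::real \<times> (real \<times> 'f) \<times> (real \<times> 'f) \<times> real. (fst x, fst (snd x), fst (snd (snd x))))"
      by (intro continuous_intros)
    have cF: "continuous_on UNIV (\<lambda>x::real \<times> (real \<times> 'f) \<times> (real \<times> 'f) \<times> real. F (fst x) (fst (snd x)) (fst (snd (snd x))))"
      using continuous_on_compose2[OF contF(1) sel] by simp
    have cFp: "continuous_on UNIV (\<lambda>x::real \<times> (real \<times> 'f) \<times> (real \<times> 'f) \<times> real. Fp (fst x) (fst (snd x)) (fst (snd (snd x))))"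
      using continuous_on_compose2[OF contF(2) sel] by simp
    have cFq: "continuous_on UNIV (\<lambda>x::real \<times> (real \<times> 'f) \<times> (real \<times> 'f) \<times> real. Fq (fst x) (fst (snd x)) (fst (snd (snd x))))"
      using continuous_on_compose2[OF contF(3) sel] by simp
    have c\<phi>: "continuous_on UNIV (\<lambda>x::real \<times> (real \<times> 'f) \<times> (real \<times> 'f) \<times> real. \<phi> (fst (fst (snd x))))"
      "continuous_on UNIV (\<lambda>x::real \<times> (real \<times> 'f) \<times> (real \<times> 'f) \<times> real. \<phi>' (fst (fst (snd x))))"
      by (rule continuous_on_compose2[OF \<phi>cont[of UNIV]] continuous_on_compose2[OF \<phi>'cont[of UNIV]]; auto intro!: continuous_intros)+
    show "continuous_on UNIV (\<lambda>x. G (fst x) (snd x))"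
      unfolding G_def H_def Hp_def by (intro continuous_intros cF cFp cFq c\<phi>)
  next
    fix N :: nat assume N: "N > 0"
    show "norm (z N 0) \<le> B1 + D"
      using norm3[of "P1 N 0" "Q1 N 0" "S N 0"] B1[OF N, of 0] bN(2)[of N] by (simp add: z_def S_def Q1_def)
  next
    fix N j :: nat assume j: "j < N"
    then have N: "N > 0" by simp
    have dz: "z N (Suc j) - z N j = (P0 N (Suc j) - P0 N j, Q0 N (Suc j) - Q0 N j, dS N j)"
      unfolding z_def by (simp add: dif1 S_def)
    have Habs: "\<bar>H t (P1 N (Suc j)) q\<bar> \<le> C + M\<phi>" for t q
    proof -
      have "\<bar>\<phi> (fst (P1 N (Suc j)))\<bar> \<le> M\<phi>" unfolding fst1 by (intro M\<phi> near[of N 0]) (use j in auto)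
      then show ?thesis using bd(3)[of t "P1 N (Suc j)" q] by (simp add: H_def)
    qed
    have sQ: "norm (Q0 N (Suc j) - Q0 N j) \<le> (C' + 1) / N" by (rule stepQ[of N 0 j]) (use j in auto)
    have sP: "norm (P0 N (Suc j) - P0 N j) \<le> (C' + 1) / N" by (rule stepP[of N 0 j]) (use j in auto)
    have PB: "norm (P1 N (Suc j)) \<le> B1" by (rule B1) (use j in auto)
    have dS: "\<bar>dS N j\<bar> \<le> (C + M\<phi> + B1 * (C' + 1)) / N"
    proof -
      have "\<bar>dS N j\<bar> \<le> \<bar>1 / real N * H (j * (1 / real N)) (P1 N (Suc j)) (Q1 N j)\<bar> + \<bar>P1 N (Suc j) \<bullet> (Q0 N (Suc j) - Q0 N j)\<bar>"
        unfolding dS_def dif1 by (rule abs_triangle_ineq4)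
      also have "\<bar>1 / real N * H (j * (1 / real N)) (P1 N (Suc j)) (Q1 N j)\<bar> \<le> 1 / real N * (C + M\<phi>)"
        unfolding abs_mult by (intro mult_mono Habs) auto
      also have "\<bar>P1 N (Suc j) \<bullet> (Q0 N (Suc j) - Q0 N j)\<bar> \<le> norm (P1 N (Suc j)) * norm (Q0 N (Suc j) - Q0 N j)"
        by (rule Cauchy_Schwarz_ineq2)
      also have "\<dots> \<le> B1 * ((C' + 1) / N)" by (intro mult_mono PB sQ B10) simp
      finally show ?thesis by (simp add: add_divide_distrib distrib_left)
    qed
    have "norm (z N (Suc j) - z N j) \<le> (C' + 1) / N + (C' + 1) / N + (C + M\<phi> + B1 * (C' + 1)) / N"
      unfolding dz using norm3[of "P0 N (Suc j) - P0 N j" "Q0 N (Suc j) - Q0 N j" "dS N j"] sP sQ dS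
      unfolding real_norm_def by linarith
    also have "\<dots> = (2 * (C' + 1) + (C + M\<phi> + B1 * (C' + 1))) / N" by (simp add: add_divide_distrib)
    also have "\<dots> \<le> D2 / N" using D2 by (intro divide_right_mono) auto
    finally show "norm (z N (Suc j) - z N j) \<le> D2 / real N" .
    show "norm (\<zeta> N j - z N j) \<le> D2 / real N"
    proof -
      have "norm (\<zeta> N j - z N j) = norm (P0 N (Suc j) - P0 N j)" by (simp add: \<zeta>_def z_def dif1 norm_Pair zero_prod_def[symmetric])
      also have "\<dots> \<le> (C' + 1) / N" by (rule sP)
      also have "\<dots> \<le> D2 / N" using D2 by (intro divide_right_mono) auto
      finally show ?thesis .
    qed
    show "norm (z N (Suc j) - z N j - (1 / real N) *\<^sub>R G (real j / real N) (\<zeta> N j)) \<le> D2 / (real N)\<^sup>2"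
    proof -
      let ?eP = "P0 N (Suc j) - P0 N j + (1 / real N) *\<^sub>R Fq (j * (1 / real N)) (P0 N (Suc j)) (Q0 N j)"
      let ?eQ = "Q0 N (Suc j) - Q0 N j - (1 / real N) *\<^sub>R Hp (j * (1 / real N)) (P0 N (Suc j)) (Q0 N j)"
      have "z N (Suc j) - z N j - (1 / real N) *\<^sub>R G (real j / real N) (\<zeta> N j) = (?eP, ?eQ, - (P1 N (Suc j) \<bullet> ?eQ))"
        unfolding dz G_def \<zeta>_def fst_conv snd_conv dS_def dif1 Hp1 Fq1
        by (simp add: inner_diff_right algebra_simps)
      then have "norm (z N (Suc j) - z N j - (1 / real N) *\<^sub>R G (real j / real N) (\<zeta> N j)) \<le> norm ?eP + norm ?eQ + \<bar>P1 N (Suc j) \<bullet> ?eQ\<bar>"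
        using norm3[of ?eP ?eQ "- (P1 N (Suc j) \<bullet> ?eQ)"] by simp
      also have "\<bar>P1 N (Suc j) \<bullet> ?eQ\<bar> \<le> norm (P1 N (Suc j)) * norm ?eQ" by (rule Cauchy_Schwarz_ineq2)
      also have "\<dots> \<le> B1 * (1 / real N)\<^sup>2" by (intro mult_mono PB dQ0 j B10) simp
      finally have "norm (z N (Suc j) - z N j - (1 / real N) *\<^sub>R G (real j / real N) (\<zeta> N j)) \<le> (1 / real N)\<^sup>2 + (1 / real N)\<^sup>2 + B1 * (1 / real N)\<^sup>2"
        using dP0[OF j] dQ0[OF j] by linarith
      also have "\<dots> = (2 + B1) / (real N)\<^sup>2" by (simp add: power_divide add_divide_distrib)
      also have "\<dots> \<le> D2 / (real N)\<^sup>2" using D2 by (intro divide_right_mono) auto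
      finally show ?thesis .
    qed
  qed

  \<comment> \<open>The limit orbit\<close>
  then obtain Z \<rho> where dZ: "\<And>t. t \<in> {0..1} \<Longrightarrow> (Z has_vector_derivative G t (Z t)) (at t within {0..1})"
    and lim0: "(\<lambda>k. z (Suc (\<rho> k)) 0) \<longlonglongrightarrow> Z 0" and lim1: "(\<lambda>k. z (Suc (\<rho> k)) (Suc (\<rho> k))) \<longlonglongrightarrow> Z 1" by blast
  define P where "P t = fst (Z t)" for t
  define Q where "Q t = fst (snd (Z t))" for t
  define T where "T t = snd (snd (Z t))" for t
  have dP: "(P has_vector_derivative - Fq t (P t) (Q t)) (at t within {0..1})"
    and dQ: "(Q has_vector_derivative Hp t (P t) (Q t)) (at t within {0..1})"
    and dT: "(T has_vector_derivative H t (P t) (Q t) - P t \<bullet> Hp t (P t) (Q t)) (at t within {0..1})" if "t \<in> {0..1}" for t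
    using bounded_linear.has_vector_derivative[OF bounded_linear_fst dZ[OF that]]
      bounded_linear.has_vector_derivative[OF bounded_linear_compose[OF bounded_linear_fst bounded_linear_snd] dZ[OF that]]
      bounded_linear.has_vector_derivative[OF bounded_linear_compose[OF bounded_linear_snd bounded_linear_snd] dZ[OF that]]
    by (simp_all add: P_def[abs_def] Q_def[abs_def] T_def[abs_def] G_def o_def)
  have P10: "P 1 = P 0"
  proof -
    have "(\<lambda>k. fst (z (Suc (\<rho> k)) 0)) \<longlonglongrightarrow> P 0" "(\<lambda>k. fst (z (Suc (\<rho> k)) (Suc (\<rho> k)))) \<longlonglongrightarrow> P 1"
      unfolding P_def by (intro tendsto_fst lim0 lim1)+
    moreover have "fst (z (Suc (\<rho> k)) (Suc (\<rho> k))) = fst (z (Suc (\<rho> k)) 0)" for k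
      using per0[of "Suc (\<rho> k)"] by (simp add: z_def P1_def)
    ultimately show ?thesis using LIMSEQ_unique by simp
  qed
  have Q10: "Q 1 = Q 0 + w"
  proof -
    have "(\<lambda>k. fst (snd (z (Suc (\<rho> k)) 0)) + w) \<longlonglongrightarrow> Q 0 + w" "(\<lambda>k. fst (snd (z (Suc (\<rho> k)) (Suc (\<rho> k))))) \<longlonglongrightarrow> Q 1"
      unfolding Q_def by (intro tendsto_intros lim0 lim1)+
    moreover have "fst (snd (z (Suc (\<rho> k)) (Suc (\<rho> k)))) = fst (snd (z (Suc (\<rho> k)) 0)) + w" for k
      using per0[of "Suc (\<rho> k)"] by (simp add: z_def Q1_def)
    ultimately show ?thesis using LIMSEQ_unique by simp
  qed
  have T10: "T 1 - T 0 \<ge> c - u * l"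
  proof -
    have "(\<lambda>k. snd (snd (z (Suc (\<rho> k)) (Suc (\<rho> k)))) - snd (snd (z (Suc (\<rho> k)) 0))) \<longlonglongrightarrow> T 1 - T 0"
      unfolding T_def by (intro tendsto_intros lim0 lim1)
    moreover have "snd (snd (z (Suc (\<rho> k)) (Suc (\<rho> k)))) - snd (snd (z (Suc (\<rho> k)) 0)) \<ge> c - u * l" for k
      using SN[of "Suc (\<rho> k)"] by (simp add: z_def S_def)
    ultimately show ?thesis by (intro LIMSEQ_le_const) auto
  qed
  have intT: "((\<lambda>t. H t (P t) (Q t) - P t \<bullet> Hp t (P t) (Q t)) has_integral T 1 - T 0) {0..1}"
    by (rule fundamental_theorem_of_calculus) (use dT in auto)
  \<comment> \<open>An orbit that reaches the boundary is outside the support of \<open>F\<close>,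
    so p_0 is constant along it. Closing up to w forces the barrier to have slope l there, and the
    action is then bounded by the Legendre transform, which lies below the level c - u l.\<close>
  have conf: "\<bar>fst (P s)\<bar> < R" if s: "s \<in> {0..1}" for s
  proof (rule ccontr)
    assume "\<not> ?thesis"
    then have big: "\<bar>fst (P s)\<bar> > r" using r by simp
    have const: "fst (P t) = fst (P s)" if "t \<in> {0..1}" for t
    proof (rule confined_or_constant[where p = "\<lambda>t. fst (P t)" and p' = "\<lambda>t. fst (- Fq t (P t) (Q t))", OF _ _ r(1) s big that])
      fix t :: real assume t: "t \<in> {0..1}"
      show "((\<lambda>t. fst (P t)) has_real_derivative fst (- Fq t (P t) (Q t))) (at t within {0..1})"
        using bounded_linear.has_vector_derivative[OF bounded_linear_fst dP[OF t]]
        by (simp add: has_real_derivative_iff_has_vector_derivative)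
      assume "\<bar>fst (P t)\<bar> > r"
      then show "fst (- Fq t (P t) (Q t)) = 0" using supp by simp
    qed
    define x where "x = fst (P s)"
    have zero: "F t (P t) (Q t) = 0" "Fp t (P t) (Q t) = 0" if "t \<in> {0..1}" for t
      using supp[of "P t" t "Q t"] const[OF that] big by auto
    have "((\<lambda>t. Hp t (P t) (Q t)) has_integral Q 1 - Q 0) {0..1}"
      by (rule fundamental_theorem_of_calculus) (use dQ in auto)
    moreover have "((\<lambda>t. Hp t (P t) (Q t)) has_integral (\<phi>' x, 0)) {0..1} \<longleftrightarrow> ((\<lambda>t::real. (\<phi>' x, 0::'f)) has_integral (\<phi>' x, 0)) {0..1}"
      by (rule has_integral_cong) (simp add: Hp_def zero const x_def)
    moreover have "((\<lambda>t::real. (\<phi>' x, 0::'f)) has_integral (\<phi>' x, 0)) {0..1}"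
      using has_integral_const_real[of "(\<phi>' x, 0::'f)" 0 1] by simp
    ultimately have "(\<phi>' x, 0) = Q 1 - Q 0" using has_integral_unique by blast
    then have slope: "\<phi>' x = l" using Q10 by (simp add: w_def)
    have "((\<lambda>t. H t (P t) (Q t) - P t \<bullet> Hp t (P t) (Q t)) has_integral \<phi> x - x * l) {0..1}
        \<longleftrightarrow> ((\<lambda>t::real. \<phi> x - x * l) has_integral \<phi> x - x * l) {0..1}"
      by (rule has_integral_cong) (auto simp: Hp_def H_def zero const x_def[symmetric] slope inner_prod_def)
    moreover have "((\<lambda>t::real. \<phi> x - x * l) has_integral \<phi> x - x * l) {0..1}"
      using has_integral_const_real[of "\<phi> x - x * l" 0 1] by simp
    ultimately have "T 1 - T 0 = \<phi> x - x * l" using intT has_integral_unique by blast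
    then show False using T10 \<phi>leg[of x] Kgap by (simp add: gap_def)
  qed
  have HF: "H t (P t) (Q t) = F t (P t) (Q t)" "Hp t (P t) (Q t) = Fp t (P t) (Q t)" if "t \<in> {0..1}" for t
    using \<phi>0[of "fst (P t)"] conf[OF that] by (auto simp: H_def Hp_def zero_prod_def[symmetric])
  have "integral {0..1} (\<lambda>t. F t (P t) (Q t) - P t \<bullet> Fp t (P t) (Q t)) = T 1 - T 0"
  proof -
    have "integral {0..1} (\<lambda>t. F t (P t) (Q t) - P t \<bullet> Fp t (P t) (Q t)) = integral {0..1} (\<lambda>t. H t (P t) (Q t) - P t \<bullet> Hp t (P t) (Q t))"
      by (rule integral_cong) (simp add: HF)
    then show ?thesis using intT by (simp add: integral_unique)
  qed
  then have "integral {0..1} (\<lambda>t. F t (P t) (Q t) - P t \<bullet> Fp t (P t) (Q t)) \<ge> c - u * l" using T10 by simp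
  moreover have "(Q has_vector_derivative Fp t (P t) (Q t)) (at t within {0..1})" if "t \<in> {0..1}" for t
    using dQ[OF that] HF[OF that] by simp
  ultimately show ?thesis using dP conf P10 Q10 unfolding w_def by blast
qed

section \<open>Smooth maps\<close>

abbreviation fd :: "('a::real_normed_vector \<Rightarrow> 'b::real_normed_vector) \<Rightarrow> 'a \<Rightarrow> 'a \<Rightarrow> 'b" where
  "fd f x \<equiv> frechet_derivative f (at x)"

lemma fd_eqI: "(f has_derivative f') (at x) \<Longrightarrow> fd f x = f'"
  by (rule frechet_derivative_at[symmetric])

lemma fd_works: "f differentiable (at x) \<Longrightarrow> (f has_derivative fd f x) (at x)"
  by (simp add: frechet_derivative_works)

lemma has_derivative_cong_open:
  assumes "open S" "x \<in> S" "\<And>y. y \<in> S \<Longrightarrow> f y = g y"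
  shows "(f has_derivative f') (at x) \<longleftrightarrow> (g has_derivative f') (at x)"
  using has_derivative_transform_within_open[of f f' x UNIV S g]
    has_derivative_transform_within_open[of g f' x UNIV S f] assms by auto

lemma fd_cong_open:
  assumes "open S" "x \<in> S" "\<And>y. y \<in> S \<Longrightarrow> f y = g y"
  shows "fd f x = fd g x"
  unfolding frechet_derivative_def using has_derivative_cong_open[OF assms] by simp

lemma Ck_on_cong:
  assumes "open S" "\<And>y. y \<in> S \<Longrightarrow> f y = g y"
  shows "Ck_on k f S \<longleftrightarrow> Ck_on k g S"
  using assms(2)
proof (induction k arbitrary: f g)
  case 0 then show ?case by (simp cong: continuous_on_cong)
next
  case (Suc k)
  have "f differentiable (at x) \<longleftrightarrow> g differentiable (at x)" if "x \<in> S" for x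
    unfolding differentiable_def using has_derivative_cong_open[OF assms(1) that Suc.prems] by simp
  moreover have "Ck_on k (\<lambda>x. fd f x v) S \<longleftrightarrow> Ck_on k (\<lambda>x. fd g x v) S" for v
    by (rule Suc.IH) (rule fun_cong[OF fd_cong_open[OF assms(1) _ Suc.prems]])
  ultimately show ?case by simp
qed

lemma Ck_on_subset: "Ck_on k f S \<Longrightarrow> T \<subseteq> S \<Longrightarrow> Ck_on k f T"
  by (induction k arbitrary: f) (auto intro: continuous_on_subset)

lemma Ck_on_Un: "open S \<Longrightarrow> open T \<Longrightarrow> Ck_on k f S \<Longrightarrow> Ck_on k f T \<Longrightarrow> Ck_on k f (S \<union> T)"
  by (induction k arbitrary: f) (auto intro: continuous_on_open_Un)

lemma Ck_on_imp_continuous_on: "Ck_on k f S \<Longrightarrow> continuous_on S f"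
  by (cases k) (auto intro!: differentiable_imp_continuous_on differentiable_at_imp_differentiable_on)

lemma Ck_on_Suc_imp: "Ck_on (Suc k) f S \<Longrightarrow> Ck_on k f S"
proof (induction k arbitrary: f)
  case 0
  then show ?case using Ck_on_imp_continuous_on[of "Suc 0" f S] by simp
next
  case (Suc k)
  note * = iffD1[OF Ck_on.simps(2) Suc.prems]
  show ?case
  proof (rule iffD2[OF Ck_on.simps(2)], intro conjI allI)
    show "\<forall>x\<in>S. f differentiable (at x)" by (rule conjunct1[OF *])
    show "Ck_on k (\<lambda>x. fd f x v) S" for v by (rule Suc.IH[OF spec[OF conjunct2[OF *]]])
  qed
qed

lemma Ck_on_const: "Ck_on k (\<lambda>_. c) S"
proof (induction k arbitrary: c)
  case (Suc k)
  then show ?case by (simp add: fd_eqI[OF has_derivative_const])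
qed simp

lemma Ck_on_bounded_linear:
  assumes L: "bounded_linear L" and S: "open S" and f: "Ck_on k f S"
  shows "Ck_on k (\<lambda>x. L (f x)) S"
  using f
proof (induction k arbitrary: f)
  case 0 then show ?case using continuous_on_compose2[OF linear_continuous_on[OF L, of UNIV], of S f] by simp
next
  case (Suc k)
  have d: "((\<lambda>x. L (f x)) has_derivative (\<lambda>v. L (fd f x v))) (at x)" if "x \<in> S" for x
    by (rule bounded_linear.has_derivative[OF L fd_works]) (use Suc.prems that in simp)
  have "Ck_on k (\<lambda>x. fd (\<lambda>x. L (f x)) x v) S" for v
    using Ck_on_cong[OF S, of "\<lambda>x. fd (\<lambda>x. L (f x)) x v" "\<lambda>x. L (fd f x v)"] Suc fd_eqI[OF d] by simp
  then show ?case using d by (auto simp: differentiable_def)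
qed

lemma Ck_on_add:
  assumes S: "open S" and f: "Ck_on k f S" and g: "Ck_on k g S"
  shows "Ck_on k (\<lambda>x. f x + g x) S"
  using f g
proof (induction k arbitrary: f g)
  case 0 then show ?case by (auto intro: continuous_intros)
next
  case (Suc k)
  have d: "((\<lambda>x. f x + g x) has_derivative (\<lambda>v. fd f x v + fd g x v)) (at x)" if "x \<in> S" for x
    by (rule has_derivative_add[OF fd_works fd_works]) (use Suc.prems that in simp_all)
  have "Ck_on k (\<lambda>x. fd (\<lambda>x. f x + g x) x v) S" for v
    using Ck_on_cong[OF S, of "\<lambda>x. fd (\<lambda>x. f x + g x) x v" "\<lambda>x. fd f x v + fd g x v"] Suc fd_eqI[OF d] by simp
  then show ?case using d by (auto simp: differentiable_def)
qed

lemma Ck_on_sum: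
  assumes "open S" "\<And>i. i \<in> I \<Longrightarrow> Ck_on k (f i) S"
  shows "Ck_on k (\<lambda>x. \<Sum>i\<in>I. f i x) S"
  using assms(2)
proof (induction I rule: infinite_finite_induct)
  case (insert i I)
  then show ?case by (simp add: Ck_on_add assms(1))
qed (auto simp: Ck_on_const)

lemma Ck_on_scaleR:
  fixes u :: "'a::real_normed_vector \<Rightarrow> real"
  assumes S: "open S" and f: "Ck_on k u S" and g: "Ck_on k g S"
  shows "Ck_on k (\<lambda>x. u x *\<^sub>R g x) S"
  using f g
proof (induction k arbitrary: u g)
  case 0 then show ?case by (auto intro: continuous_intros)
next
  case (Suc k)
  have d: "((\<lambda>x. u x *\<^sub>R g x) has_derivative (\<lambda>v. u x *\<^sub>R fd g x v + fd u x v *\<^sub>R g x)) (at x)" if "x \<in> S" for x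
    by (rule has_derivative_scaleR[OF fd_works fd_works]) (use Suc.prems that in simp_all)
  have "Ck_on k (\<lambda>x. u x *\<^sub>R fd g x v + fd u x v *\<^sub>R g x) S" for v
    using Suc.prems Ck_on_Suc_imp[OF Suc.prems(1)] Ck_on_Suc_imp[OF Suc.prems(2)]
    by (intro Ck_on_add S Suc.IH) auto
  then have "Ck_on k (\<lambda>x. fd (\<lambda>x. u x *\<^sub>R g x) x v) S" for v
    using Ck_on_cong[OF S, of "\<lambda>x. fd (\<lambda>x. u x *\<^sub>R g x) x v" "\<lambda>x. u x *\<^sub>R fd g x v + fd u x v *\<^sub>R g x"] fd_eqI[OF d] by simp
  then show ?case using d by (auto simp: differentiable_def)
qed

text \<open>Expanding the inner derivative in a basis of the middle space leaves only derivatives of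
  \<open>f\<close> in fixed directions, the only ones that the recursive definition of
  \<open>Ck_on\<close> provides. This is where finite dimension enters.\<close>

lemma Ck_on_compose:
  fixes g :: "'a::real_normed_vector \<Rightarrow> 'b::euclidean_space"
  assumes S: "open S" and g: "Ck_on k g S" and f: "Ck_on k f UNIV"
  shows "Ck_on k (\<lambda>x. f (g x)) S"
  using f g
proof (induction k arbitrary: f)
  case 0 then show ?case by (auto intro: continuous_on_compose2)
next
  case (Suc k)
  have g': "Ck_on k g S" using Suc.prems(2) by (rule Ck_on_Suc_imp)
  have lin: "linear (fd f y)" for y using fd_works[of f y] Suc.prems(1) has_derivative_linear by auto
  have d: "((\<lambda>x. f (g x)) has_derivative (\<lambda>v. fd f (g x) (fd g x v))) (at x)" if "x \<in> S" for x
    using diff_chain_at[OF fd_works fd_works, of g x f] Suc.prems that by (simp add: o_def)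
  have e: "fd f y w = (\<Sum>b\<in>Basis. (w \<bullet> b) *\<^sub>R fd f y b)" for y w
  proof -
    have "fd f y w = fd f y (\<Sum>b\<in>Basis. (w \<bullet> b) *\<^sub>R b)" by (simp add: euclidean_representation)
    then show ?thesis by (simp add: linear_sum[OF lin] linear_scale[OF lin])
  qed
  have "Ck_on k (\<lambda>x. \<Sum>b\<in>Basis. (fd g x v \<bullet> b) *\<^sub>R fd f (g x) b) S" for v
  proof (intro Ck_on_sum Ck_on_scaleR S)
    fix b :: 'b
    show "Ck_on k (\<lambda>x. fd g x v \<bullet> b) S"
      using Suc.prems(2) by (intro Ck_on_bounded_linear[OF bounded_linear_inner_left S]) simp
    show "Ck_on k (\<lambda>x. fd f (g x) b) S" using Suc.prems(1) g' by (intro Suc.IH) auto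
  qed
  then have part: "Ck_on k (\<lambda>x. \<Sum>b\<in>Basis. (fd g x v \<bullet> b) *\<^sub>R fd f (g x) b) S" for v .
  have "Ck_on k (\<lambda>x. fd (\<lambda>x. f (g x)) x v) S" for v
  proof -
    have eq: "fd (\<lambda>x. f (g x)) x v = (\<Sum>b\<in>Basis. (fd g x v \<bullet> b) *\<^sub>R fd f (g x) b)" if "x \<in> S" for x
      unfolding fd_eqI[OF d[OF that]] by (rule e)
    show ?thesis by (rule iffD2[OF Ck_on_cong[OF S eq] part])
  qed
  then show ?case using d by (auto simp: differentiable_def)
qed

lemma Ck_on_linear: "bounded_linear L \<Longrightarrow> Ck_on k L UNIV"
proof (cases k)
  case (Suc k)
  assume L: "bounded_linear L"
  have "fd L x = L" for x by (rule fd_eqI[OF bounded_linear_imp_has_derivative[OF L]])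
  then show ?thesis using Suc L Ck_on_const by (auto intro: bounded_linear_imp_differentiable)
qed (auto intro: linear_continuous_on)

lemma Ck_on_Pair:
  assumes S: "open S" and "Ck_on k f S" "Ck_on k g S"
  shows "Ck_on k (\<lambda>x. (f x, g x)) S"
proof -
  have "Ck_on k (\<lambda>x. (f x, 0) + (0, g x)) S"
  proof (rule Ck_on_add[OF S])
    show "Ck_on k (\<lambda>x. (f x, 0)) S"
      by (rule Ck_on_bounded_linear[OF _ S assms(2), where L = "\<lambda>y. (y, 0)"]) (intro bounded_linear_intros)
    show "Ck_on k (\<lambda>x. (0, g x)) S"
      by (rule Ck_on_bounded_linear[OF _ S assms(3), where L = "\<lambda>y. (0, y)"]) (intro bounded_linear_intros)
  qed
  then show ?thesis by simp
qed

text \<open>Bootstrap: if X is of class C^k, so is its derivative \<open>V (t, X t)\<close>. The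
  formula for the action requires smooth lifts, while the limit of polygons is only known to be
  differentiable.\<close>

lemma smooth_ode_solution:
  fixes X :: "real \<Rightarrow> 'a::euclidean_space"
  assumes V: "smooth_on V UNIV" and X: "\<And>t. (X has_vector_derivative V (t, X t)) (at t)"
  shows "smooth_on X UNIV"
  unfolding smooth_on_def
proof
  fix k
  have d: "(X has_derivative (\<lambda>v. v *\<^sub>R V (t, X t))) (at t)" for t
    using X[of t] by (simp add: has_vector_derivative_def)
  show "Ck_on k X UNIV"
  proof (induction k)
    case 0
    show ?case using d by (auto intro!: continuous_at_imp_continuous_on has_derivative_continuous)
  next
    case (Suc k)
    have "Ck_on k (\<lambda>t. V (t, X t)) UNIV"
      using V by (intro Ck_on_compose[OF open_UNIV Ck_on_Pair[OF open_UNIV Ck_on_linear[OF bounded_linear_ident] Suc]])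
        (simp add: smooth_on_def)
    then have "Ck_on k (\<lambda>t. v *\<^sub>R V (t, X t)) UNIV" for v
      by (intro Ck_on_scaleR Ck_on_const) auto
    then show ?case using fd_eqI[OF d] d by (auto simp: differentiable_def)
  qed
qed

section \<open>Global bounds for lattice-periodic functions\<close>

lemma periodic_bounded:
  fixes G :: "'a::euclidean_space \<Rightarrow> real"
  assumes "continuous_on UNIV G" and inv: "\<And>\<tau> x. \<tau> \<in> \<Lambda> \<Longrightarrow> G (x + \<tau>) = G x"
    and zero: "\<And>x. x \<in> Z \<Longrightarrow> G x = 0"
    and K: "compact K" "\<And>x. x \<in> Z \<or> (\<exists>\<tau>\<in>\<Lambda>. x + \<tau> \<in> K)"
  shows "\<exists>C\<ge>0. \<forall>x. \<bar>G x\<bar> \<le> C"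
proof -
  have "bounded (G ` K)"
    using assms(1) K(1) by (intro compact_imp_bounded compact_continuous_image) (auto intro: continuous_on_subset)
  then obtain C where C: "\<And>x. x \<in> K \<Longrightarrow> \<bar>G x\<bar> \<le> C" unfolding bounded_iff by auto
  have "\<bar>G x\<bar> \<le> max 0 C" for x
    using K(2)[of x] zero[of x] inv C by fastforce
  then show ?thesis by (meson max.cobounded1)
qed

lemma fd_zero_open:
  fixes G :: "'a::euclidean_space \<Rightarrow> real"
  assumes "open Z" "\<And>x. x \<in> Z \<Longrightarrow> G x = 0" "x \<in> Z" shows "fd G x v = 0"
  using fd_cong_open[OF assms(1,3), of G "\<lambda>_. 0"] assms(2) fd_eqI[OF has_derivative_const] by simp

lemma fd_periodic:
  fixes G :: "'a::euclidean_space \<Rightarrow> real"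
  assumes "\<And>x. G (x + \<tau>) = G x" "\<And>x. G differentiable (at x)"
  shows "fd G (x + \<tau>) = fd G x"
proof -
  have "((\<lambda>y. y + \<tau>) has_derivative (\<lambda>h. h)) (at x)" by (auto intro!: derivative_eq_intros)
  from diff_chain_at[OF this fd_works[OF assms(2)]]
  have "((\<lambda>y. G (y + \<tau>)) has_derivative fd G (x + \<tau>)) (at x)" by (simp add: o_def)
  then have "(G has_derivative fd G (x + \<tau>)) (at x)" by (simp add: assms(1))
  then show ?thesis by (rule fd_eqI[symmetric])
qed

text \<open>Modulo the translations everything outside Z lies in a compact set, and derivatives
  inherit both the invariance and the zeros. Bounds on second derivatives give the Lipschitz
  estimate. These are the global bounds that the discretisation presupposes.\<close>

lemma periodic_smooth_bounds:
  fixes F :: "'a::euclidean_space \<Rightarrow> real"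
  assumes F: "smooth_on F UNIV" and inv: "\<And>\<tau> x. \<tau> \<in> \<Lambda> \<Longrightarrow> F (x + \<tau>) = F x"
    and zero: "open Z" "\<And>x. x \<in> Z \<Longrightarrow> F x = 0"
    and K: "compact K" "\<And>x. x \<in> Z \<or> (\<exists>\<tau>\<in>\<Lambda>. x + \<tau> \<in> K)"
  shows "\<exists>C\<ge>0. (\<forall>x. \<bar>F x\<bar> \<le> C) \<and> (\<forall>x v. \<bar>fd F x v\<bar> \<le> C * norm v) \<and>
      (\<forall>x y v. \<bar>fd F x v - fd F y v\<bar> \<le> C * norm (x - y) * norm v)"
proof -
  note fdz = fd_zero_open[OF zero(1)] and fdinv = fd_periodic
  \<comment> \<open>Stated for a general function, to be applied to \<open>F\<close> and again to
    its directional derivatives.\<close>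
  have bd: "\<exists>C\<ge>0. \<forall>x v. \<bar>fd G x v\<bar> \<le> C * norm v"
    if G: "smooth_on G UNIV" "\<And>\<tau> x. \<tau> \<in> \<Lambda> \<Longrightarrow> G (x + \<tau>) = G x" "\<And>x. x \<in> Z \<Longrightarrow> G x = 0" for G :: "'a \<Rightarrow> real"
  proof -
    have "Ck_on (Suc 0) G UNIV" using G(1) by (simp only: smooth_on_def)
    then have diff: "G differentiable (at x)" and cont: "continuous_on UNIV (\<lambda>x. fd G x v)" for x v by simp_all
    have "\<exists>C\<ge>0. \<forall>x. \<bar>fd G x b\<bar> \<le> C" for b
      by (rule periodic_bounded[OF cont, of \<Lambda>, OF _ _ K]) (auto simp: fdinv[OF G(2) diff] fdz[OF G(3)])
    then obtain c where c: "\<And>b. c b \<ge> 0" "\<And>b x. \<bar>fd G x b\<bar> \<le> c b" by metis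
    have "\<bar>fd G x v\<bar> \<le> (\<Sum>b\<in>Basis. c b) * norm v" for x v
    proof -
      have lin: "linear (fd G x)" using has_derivative_linear[OF fd_works[OF diff]] .
      have "fd G x v = fd G x (\<Sum>b\<in>Basis. (v \<bullet> b) *\<^sub>R b)" by (simp add: euclidean_representation)
      also have "\<dots> = (\<Sum>b\<in>Basis. (v \<bullet> b) * fd G x b)" by (simp add: linear_sum[OF lin] linear_scale[OF lin])
      also have "\<bar>\<dots>\<bar> \<le> (\<Sum>b\<in>Basis. \<bar>(v \<bullet> b) * fd G x b\<bar>)" by (rule sum_abs)
      also have "\<dots> \<le> (\<Sum>b\<in>Basis. norm v * c b)"
        unfolding abs_mult by (intro sum_mono mult_mono c Basis_le_norm) auto
      finally show ?thesis by (simp add: sum_distrib_left mult.commute)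
    qed
    then show ?thesis using c(1) by (meson sum_nonneg)
  qed
  have "Ck_on 0 F UNIV" using F by (simp only: smooth_on_def)
  then obtain C0 where C0: "C0 \<ge> 0" "\<And>x. \<bar>F x\<bar> \<le> C0"
    using periodic_bounded[of F \<Lambda> Z K, OF _ inv zero(2) K] by auto
  obtain C1 where C1: "C1 \<ge> 0" "\<And>x v. \<bar>fd F x v\<bar> \<le> C1 * norm v" using bd[OF F inv zero(2)] by auto
  have "Ck_on (Suc k) F UNIV" for k using F by (simp only: smooth_on_def)
  then have diff: "F differentiable (at x)" and sm: "smooth_on (\<lambda>x. fd F x v) UNIV" for x v
    by (auto simp: smooth_on_def)
  have "\<exists>C\<ge>0. \<forall>x y. \<bar>fd F x b - fd F y b\<bar> \<le> C * norm (x - y)" for b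
  proof -
    let ?G = "\<lambda>x. fd F x b"
    obtain C where C: "C \<ge> 0" "\<And>x v. \<bar>fd ?G x v\<bar> \<le> C * norm v"
    proof -
      have 1: "?G (x + \<tau>) = ?G x" if "\<tau> \<in> \<Lambda>" for \<tau> x by (rule fun_cong[OF fdinv[OF inv[OF that] diff]])
      have 2: "?G x = 0" if "x \<in> Z" for x by (rule fdz[OF zero(2) that])
      from bd[of ?G, OF sm 1 2] show ?thesis using that by blast
    qed
    have "Ck_on (Suc 0) ?G UNIV" using sm by (simp only: smooth_on_def)
    then have Gd: "(?G has_derivative fd ?G x) (at x)" for x using fd_works by auto
    have "norm (?G x - ?G y) \<le> C * norm (x - y)" for x y
    proof (rule differentiable_bound[where S = UNIV and f' = "fd ?G"])
      show "onorm (fd ?G x) \<le> C" for x by (rule onorm_le) (use C in auto)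
    qed (auto intro: Gd)
    then show ?thesis using C by auto
  qed
  then obtain c where c: "\<And>b. c b \<ge> 0" "\<And>b x y. \<bar>fd F x b - fd F y b\<bar> \<le> c b * norm (x - y)" by metis
  define C2 where "C2 = (\<Sum>b\<in>Basis. c b)"
  have C20: "C2 \<ge> 0" unfolding C2_def using c(1) by (intro sum_nonneg)
  have C2: "\<bar>fd F x v - fd F y v\<bar> \<le> C2 * norm (x - y) * norm v" for x y v
  proof -
    have lin: "linear (fd F x)" for x using has_derivative_linear[OF fd_works[OF diff]] .
    have e: "fd F x v = (\<Sum>b\<in>Basis. (v \<bullet> b) * fd F x b)" for x
    proof -
      have "fd F x v = fd F x (\<Sum>b\<in>Basis. (v \<bullet> b) *\<^sub>R b)" by (simp add: euclidean_representation)
      then show ?thesis by (simp add: linear_sum[OF lin] linear_scale[OF lin])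
    qed
    have "fd F x v - fd F y v = (\<Sum>b\<in>Basis. (v \<bullet> b) * (fd F x b - fd F y b))"
      unfolding e[of x] e[of y] by (simp add: sum_subtractf right_diff_distrib)
    also have "\<bar>\<dots>\<bar> \<le> (\<Sum>b\<in>Basis. \<bar>(v \<bullet> b) * (fd F x b - fd F y b)\<bar>)" by (rule sum_abs)
    also have "\<dots> \<le> (\<Sum>b\<in>Basis. norm v * (c b * norm (x - y)))"
      unfolding abs_mult by (intro sum_mono mult_mono c Basis_le_norm) auto
    also have "\<dots> = C2 * norm (x - y) * norm v" by (simp add: C2_def sum_distrib_left sum_distrib_right algebra_simps)
    finally show ?thesis .
  qed
  define C where "C = C0 + C1 + C2"
  have "C \<ge> 0" "C0 \<le> C" "C1 \<le> C" "C2 \<le> C" using C0 C1 C20 by (auto simp: C_def)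
  moreover have "\<bar>F x\<bar> \<le> C" for x using C0(2)[of x] \<open>C0 \<le> C\<close> by linarith
  moreover have "\<bar>fd F x v\<bar> \<le> C * norm v" for x v
    using C1(2)[of x v] mult_right_mono[OF \<open>C1 \<le> C\<close> norm_ge_zero[of v]] by linarith
  moreover have "\<bar>fd F x v - fd F y v\<bar> \<le> C * norm (x - y) * norm v" for x y v
    using C2[of x v y] mult_right_mono[OF mult_right_mono[OF \<open>C2 \<le> C\<close> norm_ge_zero[of "x - y"]] norm_ge_zero[of v]] by linarith
  ultimately show ?thesis by blast
qed

section \<open>Coordinates, deck transformations and Stokes' theorem\<close>

lemma to_circle1_eq_iff: "to_circle1 x = to_circle1 y \<longleftrightarrow> x - y \<in> \<int>"
  by (auto simp: circle1.abs_eq_iff elim!: Ints_cases)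

lemma to_circle2_eq_iff: "to_circle2 x = to_circle2 y \<longleftrightarrow> (x - y) / 2 \<in> \<int>"
  by (auto simp: circle2.abs_eq_iff elim!: Ints_cases intro!: exI[of _ "floor ((x - y) / 2)"])

lemma to_circle1_rep [simp]: "to_circle1 (rep_circle1 c) = c"
  by (rule Quotient3_abs_rep[OF Quotient3_circle1])

lemma continuous_on_to_circle1:
  assumes "continuous_on S f" shows "continuous_on S (\<lambda>x. to_circle1 (f x))"
proof (rule continuous_on_compose2[OF _ assms])
  show "continuous_on UNIV to_circle1" by (auto simp: continuous_on_open_vimage open_circle1_def)
qed simp

lemma continuous_on_to_circle2:
  assumes "continuous_on S f" shows "continuous_on S (\<lambda>x. to_circle2 (f x))"
proof (rule continuous_on_compose2[OF _ assms])
  show "continuous_on UNIV to_circle2" by (auto simp: continuous_on_open_vimage open_circle2_def)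
qed simp

lemma open_image_to_circle1:
  assumes "open U" shows "open (to_circle1 ` U)"
proof -
  have "to_circle1 -` (to_circle1 ` U) = (\<Union>k::int. (\<lambda>x. x + of_int k) -` U)"
  proof (intro set_eqI iffI)
    fix x assume "x \<in> to_circle1 -` (to_circle1 ` U)"
    then obtain y where y: "y \<in> U" "to_circle1 y = to_circle1 x" by force
    then obtain k where "y - x = of_int k" by (auto simp: to_circle1_eq_iff elim: Ints_cases)
    then have "x + of_int k = y" by simp
    then show "x \<in> (\<Union>k::int. (\<lambda>x. x + of_int k) -` U)" using y by auto
  next
    fix x assume "x \<in> (\<Union>k::int. (\<lambda>x. x + of_int k) -` U)"
    then obtain k :: int where "x + of_int k \<in> U" by auto
    moreover have "to_circle1 (x + of_int k) = to_circle1 x" by (simp add: to_circle1_eq_iff)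
    ultimately show "x \<in> to_circle1 -` (to_circle1 ` U)" by (metis image_eqI vimageI)
  qed
  moreover have "open (\<Union>k::int. (\<lambda>x. x + of_int k) -` U)"
    by (intro open_UN ballI open_vimage assms continuous_intros)
  ultimately show ?thesis by (simp add: open_circle1_def)
qed

text \<open>The product of a quotient map with an identity can fail to be a quotient map; here it is
  one because \<open>to_circle1\<close> is open.\<close>

lemma continuous_on_circle_param:
  fixes g :: "real \<times> circle1 \<Rightarrow> 'm::topological_space"
  assumes "continuous_on UNIV (\<lambda>(s, t). g (s, to_circle1 t))"
  shows "continuous_on UNIV g"
  unfolding continuous_on_open_vimage[OF open_UNIV]
proof (intro allI impI)
  fix B :: "'m set" assume B: "open B"
  let ?O = "(\<lambda>(s, t). g (s, to_circle1 t)) -` B"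
  have O: "open ?O" using assms B by (simp add: continuous_on_open_vimage)
  have "open (g -` B)"
    unfolding open_prod_def
  proof
    fix z assume "z \<in> g -` B"
    then have "(fst z, rep_circle1 (snd z)) \<in> ?O" by simp
    with O obtain A C where AC0: "open A" "open C" "(fst z, rep_circle1 (snd z)) \<in> A \<times> C" "A \<times> C \<subseteq> ?O"
      unfolding open_prod_def by (elim ballE exE conjE) auto
    then have AC: "open A" "open C" "fst z \<in> A" "rep_circle1 (snd z) \<in> C" "A \<times> C \<subseteq> ?O" by auto
    have "snd z \<in> to_circle1 ` C" using imageI[OF AC(4), of to_circle1] by simp
    moreover have "A \<times> to_circle1 ` C \<subseteq> g -` B" using AC(5) by auto
    ultimately show "\<exists>A C. open A \<and> open C \<and> z \<in> A \<times> C \<and> A \<times> C \<subseteq> g -` B"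
      using AC(1,3) open_image_to_circle1[OF AC(2)]
      by (intro exI[of _ A] exI[of _ "to_circle1 ` C"]) (simp add: mem_Times_iff)
  qed
  then show "open (g -` B \<inter> UNIV)" by simp
qed

lemma integer_valued_constant:
  fixes f :: "'a::topological_space \<Rightarrow> real"
  assumes "connected S" "continuous_on S f" "\<And>s. s \<in> S \<Longrightarrow> f s \<in> \<int>" "s \<in> S" "t \<in> S"
  shows "f s = f t"
proof -
  have "f constant_on S"
  proof (rule continuous_discrete_range_constant[OF assms(1,2)])
    fix x assume x: "x \<in> S"
    have "1 \<le> norm (f y - f x)" if "y \<in> S" "f y \<noteq> f x" for y
      using assms(3)[OF x] assms(3)[OF that(1)] that(2) by (auto elim!: Ints_cases simp flip: of_int_diff of_int_abs)
    then show "\<exists>e>0. \<forall>y. y \<in> S \<and> f y \<noteq> f x \<longrightarrow> e \<le> norm (f y - f x)" by (intro exI[of _ 1]) auto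
  qed
  then show ?thesis using assms(4,5) unfolding constant_on_def by metis
qed

section \<open>The phase space and its deck lattice\<close>

type_synonym 'n phase = "(real \<times> real) \<times> (real \<times> real, 'n) vec"
type_synonym 'n phase_points = "(real \<times> circle1) \<times> (circle2 \<times> circle1, 'n) vec"
type_synonym 'n coords = "real \<times> (real, 'n) vec"

abbreviation phase_mfd :: "real \<Rightarrow> ('n phase, 'n::finite phase_points) flat_mfd" where
  "phase_mfd R \<equiv> prod_mfd (annulus R) torus"

text \<open>Separates the momenta \<open>(p\<^sub>0, \<dots>, p\<^sub>n)\<close> from the positions \<open>(q\<^sub>0, \<dots>, q\<^sub>n)\<close>.\<close>

definition to_pq :: "'n phase \<Rightarrow> 'n coords \<times> ('n::finite coords)" where
  "to_pq x = ((fst (fst x), \<chi> i. fst (snd x $ i)), (snd (fst x), \<chi> i. snd (snd x $ i)))"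

definition of_pq :: "'n coords \<times> 'n coords \<Rightarrow> 'n::finite phase" where
  "of_pq z = ((fst (fst z), fst (snd z)), \<chi> i. (snd (fst z) $ i, snd (snd z) $ i))"

lemma to_pq_of_pq [simp]: "to_pq (of_pq z) = z" by (simp add: to_pq_def of_pq_def vec_eq_iff prod_eq_iff)
lemma of_pq_to_pq [simp]: "of_pq (to_pq x) = x" by (simp add: to_pq_def of_pq_def vec_eq_iff prod_eq_iff)

lemma bounded_linear_to_pq: "bounded_linear to_pq"
  unfolding linear_conv_bounded_linear[symmetric]
  by (rule linearI) (auto simp: to_pq_def vec_eq_iff prod_eq_iff)

lemma bounded_linear_of_pq: "bounded_linear of_pq"
  unfolding linear_conv_bounded_linear[symmetric]
  by (rule linearI) (auto simp: of_pq_def vec_eq_iff prod_eq_iff)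

text \<open>The primitive \<open>p dq\<close> of the symplectic form.\<close>

definition liouville :: "'n phase \<Rightarrow> 'n::finite phase \<Rightarrow> real" where
  "liouville x y = fst (to_pq x) \<bullet> snd (to_pq y)"

lemma liouville_alt: "liouville x y = fst (fst x) * snd (fst y) + (\<Sum>i\<in>UNIV. fst (snd x $ i) * snd (snd y $ i))"
  by (simp add: liouville_def to_pq_def inner_prod_def inner_vec_def)

lemma bounded_bilinear_liouville: "bounded_bilinear liouville"
proof -
  have "bounded_bilinear (\<lambda>x y. fst (to_pq x) \<bullet> snd (to_pq y))"
    by (rule bounded_bilinear.comp[OF bounded_bilinear_inner
          bounded_linear_compose[OF bounded_linear_fst bounded_linear_to_pq]
          bounded_linear_compose[OF bounded_linear_snd bounded_linear_to_pq]])
  then show ?thesis by (simp add: liouville_def[abs_def])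
qed

text \<open>The primitive depends linearly on the base point, so its exterior derivative is its
  antisymmetrisation.\<close>

lemma form_phase: "form (phase_mfd R) x y = liouville x y - liouville y x"
  by (simp add: prod_mfd_def annulus_def torus_def dp_dq_def liouville_alt sum_subtractf mult.commute)

lemma cover_phase: "cover (phase_mfd R) x = ((fst (fst x), to_circle1 (snd (fst x))),
    \<chi> i. (to_circle2 (fst (snd x $ i)), to_circle1 (snd (snd x $ i))))"
  by (simp add: prod_mfd_def annulus_def torus_def map_prod_def split_beta)

lemma points_phase: "y \<in> points (phase_mfd R) \<longleftrightarrow> \<bar>fst (fst y)\<bar> < R"
  by (cases y) (auto simp: prod_mfd_def annulus_def torus_def)

definition deck :: "'n::finite phase set" where
  "deck = {x. fst (fst x) = 0 \<and> snd (fst x) \<in> \<int> \<and> (\<forall>i. fst (snd x $ i) / 2 \<in> \<int> \<and> snd (snd x $ i) \<in> \<int>)}"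

lemma cover_eq_iff: "cover (phase_mfd R) x = cover (phase_mfd R) y \<longleftrightarrow> x - y \<in> deck"
  by (auto simp: cover_phase deck_def to_circle1_eq_iff to_circle2_eq_iff vec_eq_iff)

lemma continuous_on_cover:
  assumes "continuous_on S f" shows "continuous_on S (\<lambda>x. cover (phase_mfd R) (f x))"
  unfolding cover_phase
  by (intro continuous_intros continuous_on_to_circle1 continuous_on_to_circle2 assms)

text \<open>A continuous map from a connected set into a lattice. It shows that two lifts of one map
  differ by a fixed translation, and that periods of lifts do not vary in a homotopy.\<close>

lemma deck_valued_constant:
  assumes "connected S" "continuous_on S f" "\<And>s. s \<in> S \<Longrightarrow> f s \<in> deck" "s \<in> S" "t \<in> S"
  shows "f s = (f t :: 'n::finite phase)"
proof -
  have 1: "fst (fst (f s)) = fst (fst (f t))" using assms by (simp add: deck_def)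
  have 2: "snd (fst (f s)) = snd (fst (f t))"
    by (rule integer_valued_constant[OF assms(1) _ _ assms(4,5)]) (use assms in \<open>auto simp: deck_def intro!: continuous_intros\<close>)
  have 3: "fst (snd (f s) $ i) / 2 = fst (snd (f t) $ i) / 2" for i
    by (rule integer_valued_constant[OF assms(1) _ _ assms(4,5)]) (use assms in \<open>auto simp: deck_def intro!: continuous_intros\<close>)
  have 4: "snd (snd (f s) $ i) = snd (snd (f t) $ i)" for i
    by (rule integer_valued_constant[OF assms(1) _ _ assms(4,5)]) (use assms in \<open>auto simp: deck_def intro!: continuous_intros\<close>)
  show ?thesis using 1 2 3 4 by (simp add: prod_eq_iff vec_eq_iff)
qed

text \<open>\<open>ham_vf\<close> is a definite description, so the point is uniqueness.
  Nondegeneracy of the form is tested with vectors that have only positions or only momenta.\<close>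

lemma ham_vf_eqI:
  assumes "\<And>w. form (phase_mfd R) X w = - fd (\<lambda>v. H (to_circle1 t, cover (phase_mfd R) v)) v w"
  shows "ham_vf (phase_mfd R) H t v = X"
  unfolding ham_vf_def
proof (rule the_equality)
  fix Y assume Y: "\<forall>w. form (phase_mfd R) Y w = - fd (\<lambda>v. H (to_circle1 t, cover (phase_mfd R) v)) v w"
  define Z where "Z = to_pq Y - to_pq X"
  have *: "fst Z \<bullet> snd (to_pq w) = snd Z \<bullet> fst (to_pq w)" for w
    using Y[rule_format, of w] assms[of w]
    by (simp add: form_phase liouville_def Z_def inner_diff_left inner_commute algebra_simps)
  have "fst Z \<bullet> fst Z = 0" using *[of "of_pq (0, fst Z)"] by simp
  moreover have "snd Z \<bullet> snd Z = 0" using *[of "of_pq (snd Z, 0)"] by simp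
  ultimately have "Z = 0" by (simp add: prod_eq_iff)
  then have "to_pq Y = to_pq X" by (simp add: Z_def)
  then show "Y = X" by (metis of_pq_to_pq)
qed (use assms in auto)

text \<open>The function \<open>\<Theta> s\<close>, the integral of the primitive along the path at
  s, is differentiated under the integral sign; integration by parts in t turns its derivative into
  the area integrand. The sides t = 0 and t = 1 cancel because \<open>W\<close> closes up to a
  constant \<gamma> at which, as a base point, the primitive vanishes.\<close>

lemma stokes_square:
  fixes W :: "real \<times> real \<Rightarrow> 'v::euclidean_space" and lam :: "'v \<Rightarrow> 'v \<Rightarrow> real"
  assumes lam: "bounded_bilinear lam"
    and U: "open U" "{0..1} \<times> {0..1} \<subseteq> U" and W: "smooth_on W U"
    and per: "\<And>s. s \<in> {0..1} \<Longrightarrow> W (s, 1) = W (s, 0) + \<gamma>" and \<gamma>: "\<And>w. lam \<gamma> w = 0"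
  shows "integral ({0..1} \<times> {0..1}) (\<lambda>z. lam (fd W z (1, 0)) (fd W z (0, 1)) - lam (fd W z (0, 1)) (fd W z (1, 0)))
    = integral {0..1} (\<lambda>t. lam (W (1, t)) (fd W (1, t) (0, 1))) - integral {0..1} (\<lambda>t. lam (W (0, t)) (fd W (0, t) (0, 1)))"
proof -
  interpret lam: bounded_bilinear lam by fact
  define A where "A z = fd W z (1, 0)" for z
  define B where "B z = fd W z (0, 1)" for z
  define Bs where "Bs z = fd B z (1, 0)" for z
  have CkW: "Ck_on (Suc (Suc 0)) W U" using W by (simp only: smooth_on_def)
  then have Wd: "W differentiable (at z)" and Bd: "B differentiable (at z)" if "z \<in> U" for z
    using that by (auto simp: B_def[abs_def])
  from CkW have C1: "Ck_on (Suc 0) A U" "Ck_on (Suc 0) B U" by (auto simp: A_def[abs_def] B_def[abs_def])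
  then have contA: "continuous_on U A" and contB: "continuous_on U B" using Ck_on_imp_continuous_on C1 by blast+
  have contW: "continuous_on U W" using CkW by (rule Ck_on_imp_continuous_on)
  have contBs: "continuous_on U Bs" using C1(2) by (simp add: Bs_def[abs_def])
  have inU: "(s, t) \<in> U" if "s \<in> {0..1}" "t \<in> {0..1}" for s t using U(2) that by auto
  have ds: "((\<lambda>s. G (s, t)) has_vector_derivative fd G (s, t) (1, 0)) (at s within S)"
    and dt: "((\<lambda>t. G (s, t)) has_vector_derivative fd G (s, t) (0, 1)) (at t within S)"
    if G: "G differentiable (at (s, t))" for G :: "real \<times> real \<Rightarrow> 'v" and s t S
  proof -
    have lin: "linear (fd G (s, t))" by (rule has_derivative_linear[OF fd_works[OF G]])
    have 1: "((\<lambda>s. (s, t)) has_derivative (\<lambda>h. (h, 0))) (at s)" by (auto intro!: derivative_eq_intros)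
    have 2: "((\<lambda>t. (s, t)) has_derivative (\<lambda>h. (0, h))) (at t)" by (auto intro!: derivative_eq_intros)
    have "((\<lambda>s. G (s, t)) has_derivative (\<lambda>h. h *\<^sub>R fd G (s, t) (1, 0))) (at s)"
    proof -
      have e: "fd G (s, t) (h, 0) = h *\<^sub>R fd G (s, t) (1, 0)" for h using linear_scale[OF lin, of h "(1, 0)"] by simp
      have "fd G (s, t) \<circ> (\<lambda>h. (h, 0)) = (\<lambda>h. h *\<^sub>R fd G (s, t) (1, 0))" by (rule ext, simp only: o_apply, rule e)
      with diff_chain_at[OF 1 fd_works[OF G]] show ?thesis by (simp add: o_def)
    qed
    then show "((\<lambda>s. G (s, t)) has_vector_derivative fd G (s, t) (1, 0)) (at s within S)"
      by (simp add: has_vector_derivative_def has_derivative_at_withinI)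
    have "((\<lambda>t. G (s, t)) has_derivative (\<lambda>h. h *\<^sub>R fd G (s, t) (0, 1))) (at t)"
    proof -
      have e: "fd G (s, t) (0, h) = h *\<^sub>R fd G (s, t) (0, 1)" for h using linear_scale[OF lin, of h "(0, 1)"] by simp
      have "fd G (s, t) \<circ> (\<lambda>h. (0, h)) = (\<lambda>h. h *\<^sub>R fd G (s, t) (0, 1))" by (rule ext, simp only: o_apply, rule e)
      with diff_chain_at[OF 2 fd_works[OF G]] show ?thesis by (simp add: o_def)
    qed
    then show "((\<lambda>t. G (s, t)) has_vector_derivative fd G (s, t) (0, 1)) (at t within S)"
      by (simp add: has_vector_derivative_def has_derivative_at_withinI)
  qed
  have dsW: "((\<lambda>s. W (s, t)) has_vector_derivative A (s, t)) (at s within S)"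
    and dtW: "((\<lambda>t. W (s, t)) has_vector_derivative B (s, t)) (at t within S)"
    and dsB: "((\<lambda>s. B (s, t)) has_vector_derivative Bs (s, t)) (at s within S)"
    if "s \<in> {0..1}" "t \<in> {0..1}" for s t S
    unfolding A_def B_def[of "(s,t)"] Bs_def using ds dt Wd Bd inU[OF that] by auto
  have sub: "continuous_on T (\<lambda>x. G (a x, b x))"
    if "continuous_on U G" "continuous_on T a" "continuous_on T b" "\<And>x. x \<in> T \<Longrightarrow> a x \<in> {0..1} \<and> b x \<in> {0..1}"
    for G :: "real \<times> real \<Rightarrow> 'v" and T :: "'t::topological_space set" and a b
    by (rule continuous_on_compose2[OF that(1)]) (use that inU in \<open>auto intro!: continuous_intros\<close>)
  have nontriv: "at s within {0..1} \<noteq> bot" if "s \<in> {0..1}" for s :: real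
    using that by (simp add: trivial_limit_within islimpt_Icc)
  \<comment> \<open>Equality of the mixed partial derivatives, by differentiating \<open>W (s, t) - W (s, 0) = \<integral>\<^sub>0\<^sup>t B (s, \<tau>) d\<tau>\<close> in \<open>s\<close>.\<close>
  have dtA: "((\<lambda>t. A (s, t)) has_vector_derivative Bs (s, t)) (at t within {0..1})"
    if s: "s \<in> {0..1}" and t: "t \<in> {0..1}" for s t
  proof -
    have eq: "A (s, t) = A (s, 0) + integral {0..t} (\<lambda>\<tau>. Bs (s, \<tau>))" if t: "t \<in> {0..1}" for t
    proof -
      have tt: "\<tau> \<in> {0..1}" if "\<tau> \<in> {0..t}" for \<tau> using that t by auto
      have D: "((\<lambda>s. integral (cbox 0 t) (\<lambda>\<tau>. B (s, \<tau>))) has_vector_derivative integral (cbox 0 t) (\<lambda>\<tau>. Bs (s, \<tau>))) (at s within {0..1})"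
      proof (rule leibniz_rule_vector_derivative)
        show "((\<lambda>s. B (s, \<tau>)) has_vector_derivative Bs (s, \<tau>)) (at s within {0..1})" if "s \<in> {0..1}" "\<tau> \<in> cbox 0 t" for s \<tau>
          using dsB that tt by auto
        show "(\<lambda>\<tau>. B (s, \<tau>)) integrable_on cbox 0 t" if "s \<in> {0..1}" for s
          by (rule integrable_continuous, rule sub[OF contB]) (use that tt in \<open>auto intro!: continuous_intros\<close>)
        show "continuous_on ({0..1} \<times> cbox 0 t) (\<lambda>(s, \<tau>). Bs (s, \<tau>))"
          unfolding split_beta by (rule sub[OF contBs]) (use tt in \<open>auto intro!: continuous_intros\<close>)
      qed (use s in auto)
      have E: "integral (cbox 0 t) (\<lambda>\<tau>. B (s, \<tau>)) = W (s, t) - W (s, 0)" if "s \<in> {0..1}" for s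
      proof -
        have "((\<lambda>\<tau>. B (s, \<tau>)) has_integral W (s, t) - W (s, 0)) {0..t}"
          by (rule fundamental_theorem_of_calculus) (use t dtW[OF that tt] in auto)
        then show ?thesis by (simp add: integral_unique)
      qed
      have "((\<lambda>s. W (s, t) - W (s, 0)) has_vector_derivative integral (cbox 0 t) (\<lambda>\<tau>. Bs (s, \<tau>))) (at s within {0..1})"
        by (rule has_vector_derivative_transform[OF s _ D]) (rule E[symmetric])
      moreover have "((\<lambda>s. W (s, t) - W (s, 0)) has_vector_derivative A (s, t) - A (s, 0)) (at s within {0..1})"
        by (intro has_vector_derivative_diff dsW s t) auto
      ultimately have "integral (cbox 0 t) (\<lambda>\<tau>. Bs (s, \<tau>)) = A (s, t) - A (s, 0)"
        by (rule vector_derivative_unique_within[OF nontriv[OF s]])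
      then show ?thesis by simp
    qed
    have "continuous_on {0..1} (\<lambda>\<tau>. Bs (s, \<tau>))"
      by (rule sub[OF contBs]) (use s in \<open>auto intro!: continuous_intros\<close>)
    from has_vector_derivative_add[OF has_vector_derivative_const integral_has_vector_derivative[OF this t]]
    have "((\<lambda>t. A (s, 0) + integral {0..t} (\<lambda>\<tau>. Bs (s, \<tau>))) has_vector_derivative Bs (s, t)) (at t within {0..1})" by simp
    then show ?thesis by (rule has_vector_derivative_transform[OF t, rotated]) (rule eq)
  qed
  define \<Theta> where "\<Theta> s = integral {0..1} (\<lambda>t. lam (W (s, t)) (B (s, t)))" for s
  have A10: "A (s, 1) = A (s, 0)" if s: "s \<in> {0..1}" for s
  proof -
    have "((\<lambda>s. W (s, 0) + \<gamma>) has_vector_derivative A (s, 1)) (at s within {0..1})"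
      by (rule has_vector_derivative_transform[OF s _ dsW[OF s]]) (use per in auto)
    moreover have "((\<lambda>s. W (s, 0) + \<gamma>) has_vector_derivative A (s, 0) + 0) (at s within {0..1})"
      by (intro has_vector_derivative_add dsW s has_vector_derivative_const) auto
    ultimately show ?thesis using vector_derivative_unique_within[OF nontriv[OF s]] by force
  qed
  have d\<Theta>: "(\<Theta> has_vector_derivative integral {0..1} (\<lambda>t. lam (A (s, t)) (B (s, t)) - lam (B (s, t)) (A (s, t)))) (at s within {0..1})"
    if s: "s \<in> {0..1}" for s
  proof -
    have "((\<lambda>s. integral (cbox 0 1) (\<lambda>t. lam (W (s, t)) (B (s, t)))) has_vector_derivative
       integral (cbox 0 1) (\<lambda>t. lam (W (s, t)) (Bs (s, t)) + lam (A (s, t)) (B (s, t)))) (at s within {0..1})"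
    proof (rule leibniz_rule_vector_derivative)
      show "((\<lambda>s. lam (W (s, t)) (B (s, t))) has_vector_derivative lam (W (s, t)) (Bs (s, t)) + lam (A (s, t)) (B (s, t))) (at s within {0..1})"
        if "s \<in> {0..1}" "t \<in> cbox 0 1" for s t
        by (rule lam.has_vector_derivative[OF dsW dsB]) (use that in auto)
      show "(\<lambda>t. lam (W (s, t)) (B (s, t))) integrable_on cbox 0 1" if "s \<in> {0..1}" for s
        by (intro integrable_continuous lam.continuous_on sub[OF contB] sub[OF contW]) (use that in \<open>auto intro!: continuous_intros\<close>)
      show "continuous_on ({0..1} \<times> cbox 0 1) (\<lambda>(s, t). lam (W (s, t)) (Bs (s, t)) + lam (A (s, t)) (B (s, t)))"
        unfolding split_beta
        by (intro continuous_on_add lam.continuous_on sub[OF contB] sub[OF contW] sub[OF contBs] sub[OF contA]) (auto intro!: continuous_intros)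
    qed (use s in auto)
    then have 1: "(\<Theta> has_vector_derivative integral {0..1} (\<lambda>t. lam (W (s, t)) (Bs (s, t)) + lam (A (s, t)) (B (s, t)))) (at s within {0..1})"
      by (simp add: \<Theta>_def[abs_def])
    \<comment> \<open>Integration by parts: the integrand is the t-derivative of
      \<open>lam (W (s, t)) (A (s, t))\<close>, which takes the same value at t = 0 and t =
      1.\<close>
    have "((\<lambda>t. lam (W (s, t)) (Bs (s, t)) + lam (B (s, t)) (A (s, t))) has_integral lam (W (s, 1)) (A (s, 1)) - lam (W (s, 0)) (A (s, 0))) {0..1}"
      by (rule fundamental_theorem_of_calculus) (auto intro!: lam.has_vector_derivative[OF dtW dtA] s)
    moreover have "lam (W (s, 1)) (A (s, 1)) - lam (W (s, 0)) (A (s, 0)) = 0"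
      using per[OF s] A10[OF s] \<gamma> by (simp add: lam.add_left)
    ultimately have "((\<lambda>t. lam (W (s, t)) (Bs (s, t)) + lam (B (s, t)) (A (s, t))) has_integral 0) {0..1}" by simp
    moreover have "(\<lambda>t. lam (W (s, t)) (Bs (s, t)) + lam (A (s, t)) (B (s, t))) integrable_on {0..1}"
      by (intro integrable_continuous_interval continuous_on_add lam.continuous_on sub[OF contB] sub[OF contW] sub[OF contBs] sub[OF contA])
        (use s in \<open>auto intro!: continuous_intros\<close>)
    ultimately have "integral {0..1} (\<lambda>t. lam (W (s, t)) (Bs (s, t)) + lam (A (s, t)) (B (s, t)))
       = integral {0..1} (\<lambda>t. (lam (W (s, t)) (Bs (s, t)) + lam (A (s, t)) (B (s, t))) - (lam (W (s, t)) (Bs (s, t)) + lam (B (s, t)) (A (s, t))))"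
      by (subst integral_diff) (auto simp: integral_unique intro: has_integral_integrable)
    then show ?thesis using 1 by simp
  qed
  have "((\<lambda>s. integral {0..1} (\<lambda>t. lam (A (s, t)) (B (s, t)) - lam (B (s, t)) (A (s, t)))) has_integral \<Theta> 1 - \<Theta> 0) {0..1}"
    by (rule fundamental_theorem_of_calculus) (use d\<Theta> in auto)
  moreover have "integral (cbox (0, 0) (1, 1)) (\<lambda>z. lam (A z) (B z) - lam (B z) (A z))
     = integral (cbox 0 1) (\<lambda>s. integral (cbox 0 1) (\<lambda>t. lam (A (s, t)) (B (s, t)) - lam (B (s, t)) (A (s, t))))"
  proof (rule integral_prod_continuous)
    have "cbox (0, 0) (1, 1) \<subseteq> U" using U(2) by (simp add: cbox_Pair_eq)
    then show "continuous_on (cbox (0, 0) (1, 1)) (\<lambda>z. lam (A z) (B z) - lam (B z) (A z))"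
      by (intro continuous_on_diff lam.continuous_on continuous_on_subset[OF contA] continuous_on_subset[OF contB])
  qed
  ultimately show ?thesis
    by (simp add: integral_unique cbox_Pair_eq \<Theta>_def A_def B_def)
qed

section \<open>Loops, winding numbers and the action\<close>

lemma homotopic_canon_iff:
  fixes f g :: "'a::topological_space \<Rightarrow> 'b::topological_space"
  shows "homotopic_with_canon (\<lambda>_. True) UNIV T f g \<longleftrightarrow>
   (\<exists>h. continuous_on ({0..1::real} \<times> UNIV) h \<and> (\<forall>s\<in>{0..1}. \<forall>c. h (s, c) \<in> T) \<and> (\<forall>c. h (0, c) = f c) \<and> (\<forall>c. h (1, c) = g c))"
proof -
  have "continuous_map (prod_topology (top_of_set {0..1}) (top_of_set UNIV)) (top_of_set T) h
      \<longleftrightarrow> continuous_on ({0..1} \<times> UNIV) h \<and> (\<forall>s\<in>{0..1}. \<forall>c. h (s, c) \<in> T)" for h :: "real \<times> 'a \<Rightarrow> 'b"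
    unfolding prod_topology_subtopology_eu continuous_map_subtopology_eu by (auto simp: Pi_iff)
  then show ?thesis unfolding homotopic_with_def by simp
qed

definition winding_vec :: "int \<Rightarrow> 'n::finite phase" where
  "winding_vec l = ((0, of_int l), 0)"

definition ref_lift :: "int \<Rightarrow> real \<Rightarrow> 'n::finite phase" where
  "ref_lift l t = t *\<^sub>R winding_vec l"

abbreviation ref_loop :: "int \<Rightarrow> circle1 \<Rightarrow> 'n::finite phase_points" where
  "ref_loop l \<equiv> \<lambda>t. (alpha_loop l t, torus_origin)"

lemma ref_loop_cover: "ref_loop l (to_circle1 t) = cover (phase_mfd R) (ref_lift l t)"
  by (simp add: alpha_loop_def wind.abs_eq cover_phase ref_lift_def winding_vec_def torus_origin_def mult.commute)

lemma liouville_winding_vec [simp]: "liouville (winding_vec l) w = 0"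
  by (simp add: liouville_alt winding_vec_def)

lemma liouville_deck_winding_vec: "d \<in> deck \<Longrightarrow> liouville d (winding_vec l) = 0"
  by (simp add: liouville_alt winding_vec_def deck_def)

lemma winding_vec_deck: "k \<in> \<int> \<Longrightarrow> k *\<^sub>R winding_vec l \<in> deck"
  by (simp add: winding_vec_def deck_def)

lemma quasi_periodic_int:
  assumes "\<And>t. X (t + 1) = X t + (\<gamma> :: 'a::real_vector)" and "k \<in> \<int>"
  shows "X (t + k) = X t + k *\<^sub>R \<gamma>"
proof -
  have nat: "X (t + real n) = X t + real n *\<^sub>R \<gamma>" for n t
  proof (induction n)
    case (Suc n)
    have "X (t + real (Suc n)) = X ((t + real n) + 1)" by (simp add: add.assoc add.commute[of 1])
    also have "\<dots> = X t + real n *\<^sub>R \<gamma> + \<gamma>" using assms(1) Suc by simp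
    finally show ?case by (simp add: algebra_simps)
  qed simp
  obtain j :: int where j: "k = of_int j" using assms(2) by (auto elim: Ints_cases)
  show ?thesis
  proof (cases "j \<ge> 0")
    case True
    then show ?thesis using nat[of t "nat j"] j by simp
  next
    case False
    then have "X t = X (t + k) - k *\<^sub>R \<gamma>" using nat[of "t + k" "nat (- j)"] j by simp
    then show ?thesis by simp
  qed
qed

text \<open>The straight-line homotopy of lifts from the reference loop to X. Both ends shift by the
  same \<open>winding_vec l\<close> over one period, so it descends to the circle whatever
  representative is chosen, and convexity of (-R, R) keeps it in the annulus.\<close>

definition loop_path :: "real \<Rightarrow> int \<Rightarrow> (real \<Rightarrow> 'n phase) \<Rightarrow> real \<times> circle1
    \<Rightarrow> 'n::finite phase_points" where
  "loop_path R l X z = cover (phase_mfd R)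
     ((1 - fst z) *\<^sub>R ref_lift l (rep_circle1 (snd z)) + fst z *\<^sub>R X (rep_circle1 (snd z)))"

locale quasi_periodic_lift =
  fixes R :: real and l :: int and X :: "real \<Rightarrow> 'n::finite phase"
    and x :: "circle1 \<Rightarrow> 'n phase_points"
  assumes cont: "continuous_on UNIV X"
    and per: "\<And>t. X (t + 1) = X t + winding_vec l"
    and inside: "\<And>t. \<bar>fst (fst (X t))\<bar> < R"
    and x: "\<And>t. x (to_circle1 t) = cover (phase_mfd R) (X t)"
begin

lemma loop_path_param: "loop_path R l X (s, to_circle1 t) = cover (phase_mfd R) ((1 - s) *\<^sub>R ref_lift l t + s *\<^sub>R X t)"
proof -
  define r where "r = rep_circle1 (to_circle1 t)"
  define k where "k = r - t"
  have "to_circle1 r = to_circle1 t" by (simp add: r_def)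
  then have k: "k \<in> \<int>" by (simp add: k_def to_circle1_eq_iff)
  have a: "X r = X t + k *\<^sub>R winding_vec l" using quasi_periodic_int[of X "winding_vec l", OF per k, of t] by (simp add: k_def)
  have b: "ref_lift l r = ref_lift l t + k *\<^sub>R winding_vec l" by (simp add: ref_lift_def k_def algebra_simps)
  have "((1 - s) *\<^sub>R ref_lift l r + s *\<^sub>R X r) - ((1 - s) *\<^sub>R ref_lift l t + s *\<^sub>R X t) = k *\<^sub>R winding_vec l"
    unfolding a b by (simp add: algebra_simps)
  then show ?thesis unfolding loop_path_def fst_conv snd_conv cover_eq_iff r_def[symmetric]
    using winding_vec_deck[OF k] by simp
qed

lemma loop_path_continuous: "continuous_on UNIV (loop_path R l X)"
proof (rule continuous_on_circle_param)
  have "continuous_on UNIV (\<lambda>z::real\<times>real. cover (phase_mfd R) ((1 - fst z) *\<^sub>R ref_lift l (snd z) + fst z *\<^sub>R X (snd z)))"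
    unfolding ref_lift_def
    by (intro continuous_on_cover continuous_intros continuous_on_compose2[OF cont]) auto
  then show "continuous_on UNIV (\<lambda>(s, t). loop_path R l X (s, to_circle1 t))"
    by (simp add: loop_path_param split_beta)
qed

lemma loop_path_0: "loop_path R l X (0, c) = ref_loop l c"
proof -
  have "loop_path R l X (0, to_circle1 (rep_circle1 c)) = ref_loop l (to_circle1 (rep_circle1 c))"
    unfolding loop_path_param ref_loop_cover[of l "rep_circle1 c" R] by simp
  then show ?thesis by simp
qed

lemma loop_path_1: "loop_path R l X (1, c) = x c"
proof -
  have "loop_path R l X (1, to_circle1 (rep_circle1 c)) = x (to_circle1 (rep_circle1 c))"
    unfolding loop_path_param x by simp
  then show ?thesis by simp
qed

lemma loop_path_inside:
  assumes "s \<in> {0..1}" shows "loop_path R l X (s, c) \<in> points (phase_mfd R)"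
proof -
  have "\<bar>s * fst (fst (X (rep_circle1 c)))\<bar> \<le> 1 * \<bar>fst (fst (X (rep_circle1 c)))\<bar>"
    unfolding abs_mult using assms by (intro mult_right_mono) auto
  then show ?thesis unfolding points_phase
    using inside[of "rep_circle1 c"] by (simp add: loop_path_def cover_phase ref_lift_def winding_vec_def)
qed

lemma in_class: "x \<in> pair_class (alpha_class R l) (trivial_class torus)"
proof -
  have "continuous_on ({0..1} \<times> UNIV) (\<lambda>z. fst (loop_path R l X z))" "continuous_on ({0..1} \<times> UNIV) (\<lambda>z. snd (loop_path R l X z))"
    using loop_path_continuous by (auto intro!: continuous_intros continuous_on_subset[of UNIV])
  moreover have "fst (loop_path R l X (s, c)) \<in> points (annulus R)" if "s \<in> {0..1}" for s c
    using loop_path_inside[OF that, of c] by (auto simp: prod_mfd_def)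
  ultimately have "freely_homotopic (annulus R) (alpha_loop l) (fst \<circ> x)"
    unfolding freely_homotopic_def homotopic_canon_iff
    by (intro exI[of _ "\<lambda>z. fst (loop_path R l X z)"]) (simp add: loop_path_0 loop_path_1)
  moreover have "freely_homotopic torus (\<lambda>_. torus_origin) (snd \<circ> x)"
    unfolding freely_homotopic_def homotopic_canon_iff
    by (intro exI[of _ "\<lambda>z. snd (loop_path R l X z)"])
      (simp add: loop_path_0 loop_path_1 torus_def \<open>continuous_on ({0..1} \<times> UNIV) (\<lambda>z. snd (loop_path R l X z))\<close>)
  ultimately have "freely_homotopic (annulus R) (alpha_loop l) (fst \<circ> x)"
    "freely_homotopic torus (\<lambda>_. torus_origin) (snd \<circ> x)" by auto
  then show ?thesis by (auto simp: pair_class_def alpha_class_def free_class_def trivial_class_def torus_def)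
qed

text \<open>\<open>action\<close> picks an arbitrary path of loops and \<open>symp_area\<close> an
  arbitrary lift of it. Up to constant deck translations the lift runs from the reference lift to X,
  so Stokes' theorem leaves boundary terms. The one at the reference loop is 0, and translations
  contribute nothing: they do not shift p_0, the only momentum paired with
  \<open>winding_vec l\<close>.\<close>

lemma action_eq:
  assumes smooth: "smooth_on X UNIV" and X': "\<And>t. (X has_vector_derivative X' t) (at t)"
  shows "action (phase_mfd R) (ref_loop l) H x
    = - integral {0..1} (\<lambda>t. liouville (X t) (X' t)) + integral {0..1} (\<lambda>t. H (to_circle1 t, x (to_circle1 t)))"
proof -
  interpret lam: bounded_bilinear "liouville :: 'n phase \<Rightarrow> _" by (rule bounded_bilinear_liouville)
  let ?M = "phase_mfd R :: ('n phase, 'n phase_points) flat_mfd"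
  \<comment> \<open>The straight-line homotopy shows that the choice made in \<open>action\<close>
    ranges over a nonempty set.\<close>
  have "loop_path R l X \<in> paths_of_loops ?M (ref_loop l) x"
    unfolding paths_of_loops_def is_lift_def
  proof (intro CollectI conjI exI allI ballI)
    show "open UNIV" "{0..1} \<times> UNIV \<subseteq> (UNIV :: (real \<times> real) set)" by auto
    show "smooth_on (\<lambda>z::real\<times>real. (1 - fst z) *\<^sub>R (snd z *\<^sub>R winding_vec l) + fst z *\<^sub>R X (snd z)) UNIV"
      unfolding smooth_on_def
    proof
      fix k
      have 1: "Ck_on k (\<lambda>z::real\<times>real. 1 - fst z) UNIV"
        using Ck_on_add[OF open_UNIV Ck_on_const[of k 1] Ck_on_linear[OF bounded_linear_minus[OF bounded_linear_fst]]]
        by simp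
      show "Ck_on k (\<lambda>z::real\<times>real. (1 - fst z) *\<^sub>R (snd z *\<^sub>R winding_vec l) + fst z *\<^sub>R X (snd z)) UNIV"
      proof (intro Ck_on_add Ck_on_scaleR 1 Ck_on_const open_UNIV)
        show "Ck_on k (\<lambda>z::real\<times>real. fst z) UNIV" "Ck_on k (\<lambda>z::real\<times>real. snd z) UNIV"
          by (intro Ck_on_linear bounded_linear_fst bounded_linear_snd)+
        then show "Ck_on k (\<lambda>z::real\<times>real. X (snd z)) UNIV"
          using smooth by (intro Ck_on_compose[of UNIV k snd X]) (auto simp: smooth_on_def)
      qed
    qed
    show "loop_path R l X (s, to_circle1 t) \<in> points ?M" if "s \<in> {0..1}" for s t by (rule loop_path_inside[OF that])
    show "loop_path R l X (s, to_circle1 t) = cover ?M ((1 - fst (s, t)) *\<^sub>R (snd (s, t) *\<^sub>R winding_vec l) + fst (s, t) *\<^sub>R X (snd (s, t)))" for s t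
      by (simp add: loop_path_param ref_lift_def)
  qed (simp_all add: loop_path_0 loop_path_1)
  then have some: "(SOME y. y \<in> paths_of_loops ?M (ref_loop l) x) \<in> paths_of_loops ?M (ref_loop l) x"
    by (rule someI[of "\<lambda>y. y \<in> paths_of_loops ?M (ref_loop l) x"])
  define y where "y = (SOME y. y \<in> paths_of_loops ?M (ref_loop l) x)"
  have y: "\<exists>W. is_lift ?M y W" "\<And>t. y (0, t) = ref_loop l t" "\<And>t. y (1, t) = x t"
    using some unfolding y_def[symmetric] unfolding paths_of_loops_def by auto
  define W where "W = (SOME W. is_lift ?M y W)"
  have "is_lift ?M y W" unfolding W_def by (rule someI_ex[OF y(1)])
  then obtain U where U: "open U" "{0..1} \<times> UNIV \<subseteq> U" "smooth_on W U"
    and yW: "\<And>s t. s \<in> {0..1} \<Longrightarrow> y (s, to_circle1 t) = cover ?M (W (s, t))"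
    unfolding is_lift_def by blast
  have "Ck_on (Suc 0) W U" using U(3) by (simp only: smooth_on_def)
  then have Wd: "W differentiable (at z)" if "z \<in> U" for z using that by simp
  have contW: "continuous_on U W" using \<open>Ck_on (Suc 0) W U\<close> by (rule Ck_on_imp_continuous_on)
  have contWt: "continuous_on UNIV (\<lambda>t. W (s, t))" if "s \<in> {0..1}" for s
    by (rule continuous_on_compose2[OF contW]) (use U(2) that in \<open>auto intro!: continuous_intros\<close>)
  have deck0: "W (0, s) - ref_lift l s \<in> deck" for s
  proof -
    have "cover ?M (W (0, s)) = y (0, to_circle1 s)" by (rule yW[symmetric]) simp
    also have "\<dots> = cover ?M (ref_lift l s)" unfolding y(2) by (rule ref_loop_cover)
    finally show ?thesis by (simp only: cover_eq_iff)
  qed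
  have diff0: "W (0, s) - ref_lift l s = W (0, t) - ref_lift l t" for s t
  proof (rule deck_valued_constant[where S = UNIV and f = "\<lambda>s. W (0, s) - ref_lift l s"])
    show "continuous_on UNIV (\<lambda>s. W (0, s) - ref_lift l s)"
      unfolding ref_lift_def by (intro continuous_intros contWt) auto
    show "W (0, s) - ref_lift l s \<in> deck" for s by (rule deck0)
  qed auto
  have diff1: "W (1, s) - X s = W (1, t) - X t" and deck1: "W (1, s) - X s \<in> deck" for s t
  proof -
    show d: "W (1, s) - X s \<in> deck" for s
    proof -
      have "cover ?M (W (1, s)) = y (1, to_circle1 s)" by (rule yW[symmetric]) simp
      also have "\<dots> = cover ?M (X s)" unfolding y(3) by (rule x)
      finally show ?thesis by (simp only: cover_eq_iff)
    qed
    show "W (1, s) - X s = W (1, t) - X t"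
      by (rule deck_valued_constant[where S = UNIV and f = "\<lambda>s. W (1, s) - X s"]) (auto intro!: continuous_intros contWt cont d)
  qed
  \<comment> \<open>The increment of W over one period lies in the lattice, hence does not depend on
    s; at s = 0 it is read off from the reference loop.\<close>
  have Wper: "W (s, 1) = W (s, 0) + winding_vec l" if s: "s \<in> {0..1}" for s
  proof -
    have "W (s, 1) - W (s, 0) = W (0, 1) - W (0, 0)"
    proof (rule deck_valued_constant[where S = "{0..1}" and f = "\<lambda>s. W (s, 1) - W (s, 0)"])
      show "continuous_on {0..1} (\<lambda>s. W (s, 1) - W (s, 0))"
        by (intro continuous_intros continuous_on_compose2[OF contW]) (use U(2) in auto)
      show "W (s, 1) - W (s, 0) \<in> deck" if "s \<in> {0..1}" for s
      proof -
        have "to_circle1 1 = to_circle1 0" by (simp add: to_circle1_eq_iff)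
        then have "cover ?M (W (s, 1)) = cover ?M (W (s, 0))" using yW[OF that, of 1] yW[OF that, of 0] by simp
        then show ?thesis by (simp add: cover_eq_iff)
      qed
    qed (use s in auto)
    also have "\<dots> = winding_vec l" using diff0[of 1 0] by (simp add: ref_lift_def algebra_simps)
    finally show ?thesis by (simp add: algebra_simps)
  qed
  have dtW: "((\<lambda>t. W (s, t)) has_vector_derivative fd W (s, t) (0, 1)) (at t)" if "s \<in> {0..1}" for s t
  proof -
    have G: "W differentiable (at (s, t))" by (rule Wd, rule subsetD[OF U(2)]) (use that in simp)
    have 2: "((\<lambda>t. (s, t)) has_derivative (\<lambda>h. (0, h))) (at t)" by (auto intro!: derivative_eq_intros)
    have e: "fd W (s, t) (0, h) = h *\<^sub>R fd W (s, t) (0, 1)" for h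
      using linear_scale[OF has_derivative_linear[OF fd_works[OF G]], of h "(0, 1)"] by simp
    have "fd W (s, t) \<circ> (\<lambda>h. (0, h)) = (\<lambda>h. h *\<^sub>R fd W (s, t) (0, 1))" by (rule ext, simp only: o_apply, rule e)
    with diff_chain_at[OF 2 fd_works[OF G]] show ?thesis by (simp add: o_def has_vector_derivative_def)
  qed
  have W0': "fd W (0, t) (0, 1) = winding_vec l" for t
  proof -
    have "(\<lambda>t. W (0, t)) = (\<lambda>t. ref_lift l t + (W (0, 0) - ref_lift l 0))"
    proof
      fix t show "W (0, t) = ref_lift l t + (W (0, 0) - ref_lift l 0)" using diff0[of t 0] by (simp add: algebra_simps)
    qed
    moreover have "((\<lambda>t. ref_lift l t + (W (0, 0) - ref_lift l 0)) has_vector_derivative winding_vec l) (at t)"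
      unfolding ref_lift_def by (auto intro!: derivative_eq_intros)
    ultimately show ?thesis using vector_derivative_unique_at[OF dtW[of 0 t]] by simp
  qed
  have W1: "W (1, t) = X t + (W (1, 0) - X 0)" for t using diff1[of t 0] by (simp add: algebra_simps)
  have W1': "fd W (1, t) (0, 1) = X' t" for t
  proof -
    have "(\<lambda>t. W (1, t)) = (\<lambda>t. X t + (W (1, 0) - X 0))" using W1 by (rule ext)
    moreover have "((\<lambda>t. X t + (W (1, 0) - X 0)) has_vector_derivative X' t) (at t)"
      by (auto intro!: derivative_eq_intros X')
    ultimately show ?thesis using vector_derivative_unique_at[OF dtW[of 1 t]] by simp
  qed
  have contX': "continuous_on {0..1} X'"
  proof -
    have "Ck_on (Suc 0) X UNIV" using smooth by (simp only: smooth_on_def)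
    then have "continuous_on UNIV (\<lambda>t. fd X t 1)" by simp
    moreover have "fd X t = (\<lambda>h. h *\<^sub>R X' t)" for t using X'[of t] by (intro fd_eqI) (simp add: has_vector_derivative_def)
    ultimately show ?thesis by (auto intro: continuous_on_subset)
  qed
  have "symp_area ?M y = integral ({0..1} \<times> {0..1}) (\<lambda>z. liouville (fd W z (1, 0)) (fd W z (0, 1)) - liouville (fd W z (0, 1)) (fd W z (1, 0)))"
    unfolding symp_area_def Let_def W_def[symmetric] form_phase ..
  also have "\<dots> = integral {0..1} (\<lambda>t. liouville (W (1, t)) (fd W (1, t) (0, 1))) - integral {0..1} (\<lambda>t. liouville (W (0, t)) (fd W (0, t) (0, 1)))"
    by (rule stokes_square[OF bounded_bilinear_liouville U(1) _ U(3) Wper]) (use U(2) in auto)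
  also have "integral {0..1} (\<lambda>t. liouville (W (0, t)) (fd W (0, t) (0, 1))) = 0"
  proof -
    have "liouville (W (0, t)) (fd W (0, t) (0, 1)) = 0" for t
    proof -
      have "liouville (ref_lift l t + (W (0, t) - ref_lift l t)) (winding_vec l) = 0"
        by (simp only: lam.add_left liouville_deck_winding_vec[OF deck0]) (simp add: ref_lift_def lam.scaleR_left)
      then show ?thesis unfolding W0' by simp
    qed
    then show ?thesis by simp
  qed
  also have "integral {0..1} (\<lambda>t. liouville (W (1, t)) (fd W (1, t) (0, 1))) = integral {0..1} (\<lambda>t. liouville (X t) (X' t))"
  proof -
    define d where "d = W (1, 0) - X 0"
    have d: "d \<in> deck" using deck1 by (simp add: d_def)
    have "((\<lambda>t. liouville d (X' t)) has_integral liouville d (X 1) - liouville d (X 0)) {0..1}"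
      by (rule fundamental_theorem_of_calculus)
        (auto intro!: bounded_linear.has_vector_derivative[OF lam.bounded_linear_right] has_vector_derivative_at_within[OF X'])
    moreover have "liouville d (X 1) - liouville d (X 0) = 0"
      using per[of 0] liouville_deck_winding_vec[OF d] by (simp add: lam.add_right)
    ultimately have I: "((\<lambda>t. liouville d (X' t)) has_integral 0) {0..1}" by simp
    have J: "(\<lambda>t. liouville (X t) (X' t)) integrable_on {0..1}"
      by (intro integrable_continuous_interval lam.continuous_on contX' continuous_on_subset[OF cont]) auto
    have "integral {0..1} (\<lambda>t. liouville (W (1, t)) (fd W (1, t) (0, 1))) = integral {0..1} (\<lambda>t. liouville (X t) (X' t) + liouville d (X' t))"
    proof -
      have "liouville (W (1, t)) (fd W (1, t) (0, 1)) = liouville (X t) (X' t) + liouville d (X' t)" for t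
        unfolding W1' d_def W1[of t] by (rule lam.add_left)
      then show ?thesis by (simp only:)
    qed
    also have "\<dots> = integral {0..1} (\<lambda>t. liouville (X t) (X' t)) + integral {0..1} (\<lambda>t. liouville d (X' t))"
      by (rule integral_add[OF J]) (use I in \<open>auto intro: has_integral_integrable\<close>)
    finally show ?thesis using I by (simp add: integral_unique)
  qed
  finally have "symp_area ?M y = integral {0..1} (\<lambda>t. liouville (X t) (X' t))" by simp
  then show ?thesis unfolding action_def y_def[symmetric] by simp
qed

end

section \<open>Winding numbers through the complex exponential\<close>

definition circle_exp :: "circle1 \<Rightarrow> complex" where "circle_exp c = cis (2 * pi * rep_circle1 c)"

lemma circle_exp: "circle_exp (to_circle1 t) = exp (2 * pi * t * \<i>)"
proof -
  have "rep_circle1 (to_circle1 t) - t \<in> \<int>" using to_circle1_eq_iff[of "rep_circle1 (to_circle1 t)" t] by simp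
  then obtain k :: int where "rep_circle1 (to_circle1 t) = t + of_int k" by (metis Ints_cases add.commute diff_add_cancel)
  then have "circle_exp (to_circle1 t) = cis (2 * pi * t + 2 * pi * of_int k)" by (simp add: circle_exp_def algebra_simps)
  also have "\<dots> = cis (2 * pi * t) * cis (2 * pi * of_int k)" by (rule cis_mult[symmetric])
  also have "cis (2 * pi * of_int k) = 1" by (simp add: cis_multiple_2pi)
  finally show ?thesis by (simp add: cis_conv_exp mult.commute)
qed

lemma continuous_on_circle_exp: "continuous_on UNIV circle_exp"
  unfolding continuous_on_open_vimage[OF open_UNIV]
proof (intro allI impI)
  fix B :: "complex set" assume B: "open B"
  have "to_circle1 -` (circle_exp -` B) = (\<lambda>t. exp (2 * pi * t * \<i>)) -` B" by (auto simp: circle_exp)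
  moreover have "open ((\<lambda>t::real. exp (2 * pi * t * \<i>)) -` B)" by (intro open_vimage B continuous_intros)
  ultimately show "open (circle_exp -` B \<inter> UNIV)" by (simp add: open_circle1_def)
qed

lemma exp_lift_constant:
  assumes "connected S" "continuous_on S f" "continuous_on S g" "\<And>s. s \<in> S \<Longrightarrow> exp (f s) = exp (g s)" "s \<in> S" "t \<in> S"
  shows "f s - g s = f t - (g t :: complex)"
proof -
  have k: "\<exists>n::int. f s - g s = of_int (2 * n) * pi * \<i>" if "s \<in> S" for s
    using assms(4)[OF that] by (auto simp: exp_eq)
  have Re: "Re (f s - g s) = 0" if s: "s \<in> S" for s
  proof -
    obtain n :: int where n: "f s - g s = of_int (2 * n) * pi * \<i>" using k[OF s] by blast
    show ?thesis unfolding n by simp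
  qed
  have "Im (f s - g s) / (2 * pi) = Im (f t - g t) / (2 * pi)"
  proof (rule integer_valued_constant[OF assms(1) _ _ assms(5,6)])
    show "continuous_on S (\<lambda>s. Im (f s - g s) / (2 * pi))" by (intro continuous_intros assms(2,3)) auto
    show "Im (f s - g s) / (2 * pi) \<in> \<int>" if s: "s \<in> S" for s
    proof -
      obtain n :: int where n: "f s - g s = of_int (2 * n) * pi * \<i>" using k[OF s] by blast
      show ?thesis unfolding n by simp
    qed
  qed
  then show ?thesis using Re[OF assms(5)] Re[OF assms(6)] by (intro complex_eqI) auto
qed

text \<open>All that is known is some continuous homotopy from the reference loop. Its circle
  component, mapped to the unit circle, has a continuous logarithm on the square. The increment of
  this logarithm in t does not depend on s; divided by 2 pi i, it is l at s = 0 and the increment of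
  q_0 along the lift at s = 1.\<close>

lemma winding_lift:
  assumes x: "x \<in> pair_class (alpha_class R l) \<beta>" and cont: "continuous_on UNIV X"
    and lift: "\<And>t. x (to_circle1 t) = cover (phase_mfd R) (X t)"
  shows "snd (fst (X 1)) - snd (fst (X 0)) = of_int l"
proof -
  have "freely_homotopic (annulus R) (alpha_loop l) (fst \<circ> x)"
    using x by (simp add: pair_class_def alpha_class_def free_class_def)
  then obtain h where h: "continuous_on ({0..1::real} \<times> UNIV) h" "\<And>c. h (0, c) = alpha_loop l c" "\<And>c. h (1, c) = fst (x c)"
    unfolding freely_homotopic_def homotopic_canon_iff by auto
  define g where "g z = circle_exp (snd (h (fst z, to_circle1 (snd z))))" for z :: "real \<times> real"
  have gcont: "continuous_on ({0..1} \<times> {0..1}) g"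
    unfolding g_def
    by (intro continuous_on_compose2[OF continuous_on_circle_exp] continuous_on_snd continuous_on_compose2[OF h(1)]
        continuous_on_Pair continuous_on_fst continuous_on_to_circle1 continuous_on_id) auto
  have "contractible ({0..1::real} \<times> {0..1::real})" by (intro convex_imp_contractible convex_Times) auto
  moreover have "g z \<noteq> 0" for z by (simp add: g_def circle_exp_def)
  ultimately obtain G where G: "continuous_on ({0..1} \<times> {0..1}) G" "\<And>z. z \<in> {0..1} \<times> {0..1} \<Longrightarrow> g z = exp (G z)"
    using continuous_logarithm_on_contractible[OF gcont] by metis
  have 10: "to_circle1 1 = to_circle1 0" by (simp add: to_circle1_eq_iff)
  have Gc: "continuous_on T (\<lambda>t. G (a t, b t))" if "continuous_on T a" "continuous_on T b" "\<And>t. t \<in> T \<Longrightarrow> a t \<in> {0..1} \<and> b t \<in> {0..1}"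
    for T :: "real set" and a b
    by (rule continuous_on_compose2[OF G(1)]) (use that in \<open>auto intro!: continuous_intros\<close>)
  have A: "G (0, 1) - G (0, 0) = G (1, 1) - G (1, 0)"
  proof (rule exp_lift_constant[of "{0..1}" "\<lambda>s. G (s, 1)" "\<lambda>s. G (s, 0)" 0 1])
    show "exp (G (s, 1)) = exp (G (s, 0))" if "s \<in> {0..1}" for s
    proof -
      have "g (s, 1) = g (s, 0)" by (simp add: g_def 10)
      then show ?thesis using G(2)[of "(s, 1)"] G(2)[of "(s, 0)"] that by simp
    qed
  qed (auto intro!: Gc continuous_intros)
  have B: "G (0, 0) - 2 * pi * (of_int l * 0) * \<i> = G (0, 1) - 2 * pi * (of_int l * 1) * \<i>"
  proof (rule exp_lift_constant[of "{0..1}" "\<lambda>t. G (0, t)" "\<lambda>t. 2 * pi * (of_int l * t) * \<i>" 0 1, simplified of_real_0 of_real_1])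
    show "exp (G (0, t)) = exp (2 * pi * (of_int l * t) * \<i>)" if "t \<in> {0..1}" for t
    proof -
      have "g (0, t) = circle_exp (to_circle1 (of_int l * t))" by (simp add: g_def h(2) alpha_loop_def wind.abs_eq)
      then show ?thesis using G(2)[of "(0, t)"] that by (simp add: circle_exp)
    qed
  qed (auto intro!: Gc continuous_intros)
  have C: "G (1, 0) - 2 * pi * snd (fst (X 0)) * \<i> = G (1, 1) - 2 * pi * snd (fst (X 1)) * \<i>"
  proof (rule exp_lift_constant[of "{0..1}" "\<lambda>t. G (1, t)" "\<lambda>t. 2 * pi * snd (fst (X t)) * \<i>" 0 1])
    show "exp (G (1, t)) = exp (2 * pi * snd (fst (X t)) * \<i>)" if "t \<in> {0..1}" for t
    proof -
      have "g (1, t) = circle_exp (to_circle1 (snd (fst (X t))))" by (simp add: g_def h(3) lift cover_phase)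
      then show ?thesis using G(2)[of "(1, t)"] that by (simp add: circle_exp)
    qed
    show "continuous_on {0..1} (\<lambda>t. 2 * pi * snd (fst (X t)) * \<i>)"
      by (intro continuous_intros continuous_on_subset[OF cont]) auto
  qed (auto intro!: Gc continuous_intros)
  have "2 * pi * of_int l * \<i> = G (0, 1) - G (0, 0)" using B by (simp add: algebra_simps)
  also have "\<dots> = 2 * pi * snd (fst (X 1)) * \<i> - 2 * pi * snd (fst (X 0)) * \<i>" unfolding A using C by algebra
  finally have "2 * pi * of_int l * \<i> = 2 * pi * (snd (fst (X 1)) - snd (fst (X 0))) * \<i>"
    by (simp add: algebra_simps)
  then have "of_int l = complex_of_real (snd (fst (X 1)) - snd (fst (X 0)))" by simp
  then show ?thesis by (metis of_real_eq_iff of_real_of_int_eq)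
qed

section \<open>Hamiltonians depending on \<open>p\<^sub>0\<close> only\<close>

lemma to_circle2_rep [simp]: "to_circle2 (rep_circle2 c) = c"
  by (rule Quotient3_abs_rep[OF Quotient3_circle2])

text \<open>The powers in the denominator make the family closed under differentiation up to linear
  combinations, so one derivative formula yields smoothness of every order. Small \<delta> brings
  the function close to 1 at any given positive point when m = 0.\<close>

definition flat_exp :: "real \<Rightarrow> nat \<Rightarrow> real \<Rightarrow> real" where
  "flat_exp \<delta> m x = (if x > 0 then exp (- \<delta> / x) / x ^ m else 0)"

text \<open>With y = \<delta> / x, the value at x > 0 is a constant times y^m / exp y, and y tends
  to infinity.\<close>

lemma flat_exp_tendsto_0:
  assumes "\<delta> > 0" shows "(flat_exp \<delta> m \<longlongrightarrow> 0) (at 0)"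
proof -
  have "((\<lambda>x. (x ^ m / exp x) / \<delta> ^ m) \<longlongrightarrow> 0 / \<delta> ^ m) at_top"
    by (intro tendsto_divide tendsto_power_div_exp_0 tendsto_const) (use assms in auto)
  moreover have "filterlim (\<lambda>x. \<delta> / x) at_top (at_right 0)"
    using assms by (auto simp: divide_inverse intro!: filterlim_tendsto_pos_mult_at_top[OF tendsto_const] filterlim_inverse_at_top_right)
  ultimately have "((\<lambda>x. ((\<delta> / x) ^ m / exp (\<delta> / x)) / \<delta> ^ m) \<longlongrightarrow> 0) (at_right 0)"
    using filterlim_compose by fastforce
  moreover have "eventually (\<lambda>x. ((\<delta> / x) ^ m / exp (\<delta> / x)) / \<delta> ^ m = flat_exp \<delta> m x) (at_right 0)"
    unfolding eventually_at_right_field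
    using assms by (intro exI[of _ 1]) (auto simp: flat_exp_def power_divide exp_minus field_simps)
  ultimately have "(flat_exp \<delta> m \<longlongrightarrow> 0) (at_right 0)" by (rule Lim_transform_eventually)
  moreover have "(flat_exp \<delta> m \<longlongrightarrow> 0) (at_left 0)"
  proof (rule Lim_transform_eventually[OF tendsto_const])
    show "eventually (\<lambda>x. 0 = flat_exp \<delta> m x) (at_left 0)"
      unfolding eventually_at_left_field by (intro exI[of _ "-1"]) (auto simp: flat_exp_def)
  qed
  ultimately show ?thesis by (simp add: filterlim_split_at)
qed

lemma flat_exp_deriv:
  assumes \<delta>: "\<delta> > 0"
  shows "(flat_exp \<delta> m has_real_derivative \<delta> * flat_exp \<delta> (m + 2) x - real m * flat_exp \<delta> (m + 1) x) (at x)"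
proof -
  consider "x > 0" | "x < 0" | "x = 0" by linarith
  then show ?thesis
  proof cases
    case 1
    have "((\<lambda>x. exp (- \<delta> / x) / x ^ m) has_real_derivative \<delta> * flat_exp \<delta> (m + 2) x - real m * flat_exp \<delta> (m + 1) x) (at x)"
    proof (cases m)
      case 0
      then show ?thesis using 1 by (auto intro!: derivative_eq_intros simp: flat_exp_def power2_eq_square)
    next
      case (Suc k)
      have e: "exp (- \<delta> / x) * (\<delta> / (x * x)) * x ^ m - exp (- \<delta> / x) * (real m * x ^ k) =
         (\<delta> * (exp (- \<delta> / x) / x ^ (m + 2)) - real m * (exp (- \<delta> / x) / x ^ (m + 1))) * (x ^ m * x ^ m)"
        using 1 Suc by (simp add: field_simps)
      have "((\<lambda>x. exp (- \<delta> / x) / x ^ m) has_real_derivative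
         (exp (- \<delta> / x) * (\<delta> / (x * x)) * x ^ m - exp (- \<delta> / x) * (real m * x ^ k)) / (x ^ m * x ^ m)) (at x)"
      proof -
        have "((\<lambda>x. exp (- \<delta> / x)) has_real_derivative exp (- \<delta> / x) * (\<delta> / (x * x))) (at x)"
          using 1 by (auto intro!: derivative_eq_intros)
        moreover have "((\<lambda>x. x ^ m) has_real_derivative real m * x ^ k) (at x)"
          using DERIV_pow[of m x] Suc by simp
        moreover have "x ^ m \<noteq> 0" using 1 by simp
        ultimately show ?thesis by (rule DERIV_divide[THEN DERIV_cong]) simp
      qed
      then show ?thesis unfolding e using 1 by (simp add: flat_exp_def)
    qed
    then show ?thesis
      by (rule has_field_derivative_transform_within_open[where S = "{0<..}"]) (use 1 in \<open>auto simp: flat_exp_def\<close>)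
  next
    case 2
    have "((\<lambda>_. 0) has_real_derivative \<delta> * flat_exp \<delta> (m + 2) x - real m * flat_exp \<delta> (m + 1) x) (at x)"
      using 2 by (simp add: flat_exp_def)
    then show ?thesis
      by (rule has_field_derivative_transform_within_open[where S = "{..<0}"]) (use 2 in \<open>auto simp: flat_exp_def\<close>)
  next
    case 3
    \<comment> \<open>At 0 the difference quotient of a member of the family is the next member,
      whose limit is known.\<close>
    have "(\<lambda>h. (flat_exp \<delta> m (0 + h) - flat_exp \<delta> m 0) / h) = flat_exp \<delta> (m + 1)"
      by (auto simp: flat_exp_def fun_eq_iff)
    then show ?thesis using 3 flat_exp_tendsto_0[OF \<delta>, of "m + 1"] by (simp add: DERIV_def flat_exp_def)
  qed
qed

lemma fd_real: "(f has_real_derivative d) (at x) \<Longrightarrow> fd f x = (\<lambda>h. d * h)"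
  by (rule fd_eqI) (simp add: has_field_derivative_def)

lemma Ck_on_flat_exp:
  assumes \<delta>: "\<delta> > 0" shows "Ck_on k (flat_exp \<delta> m) UNIV"
proof (induction k arbitrary: m)
  case 0
  show ?case using DERIV_isCont[OF flat_exp_deriv[OF \<delta>]] by (auto intro: continuous_at_imp_continuous_on)
next
  case (Suc k)
  have "Ck_on k (\<lambda>x. fd (flat_exp \<delta> m) x v) UNIV" for v
  proof -
    have "fd (flat_exp \<delta> m) x v = (v * \<delta>) *\<^sub>R flat_exp \<delta> (m + 2) x + (- v * real m) *\<^sub>R flat_exp \<delta> (m + 1) x" for x
      unfolding fd_real[OF flat_exp_deriv[OF \<delta>]] by (simp add: algebra_simps)
    then show ?thesis by (simp only:) (intro Ck_on_add Ck_on_scaleR Ck_on_const Suc open_UNIV)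
  qed
  then show ?case using flat_exp_deriv[OF \<delta>] by (auto simp: differentiable_def has_field_derivative_def)
qed

lemma Ck_on_affine: "Ck_on k (\<lambda>x::real. a * x + b) UNIV"
  by (intro Ck_on_add Ck_on_const Ck_on_linear bounded_linear_mult_right open_UNIV)

lemma flat_exp_bounds:
  assumes "\<delta> > 0"
  shows "0 \<le> flat_exp \<delta> m x" "flat_exp \<delta> 0 x \<le> 1"
  using assms by (auto simp: flat_exp_def)

lemma Ck_on_bump:
  assumes "\<delta> > 0" shows "Ck_on k (\<lambda>p. flat_exp \<delta> 0 (p - \<alpha>) * flat_exp \<delta> 0 (\<beta> - p)) UNIV"
proof -
  have 1: "Ck_on k (\<lambda>p. flat_exp \<delta> 0 (1 * p + - \<alpha>)) UNIV"
    by (rule Ck_on_compose[OF open_UNIV Ck_on_affine Ck_on_flat_exp[OF assms]])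
  have 2: "Ck_on k (\<lambda>p. flat_exp \<delta> 0 (-1 * p + \<beta>)) UNIV"
    by (rule Ck_on_compose[OF open_UNIV Ck_on_affine Ck_on_flat_exp[OF assms]])
  show ?thesis using Ck_on_scaleR[OF open_UNIV 1 2] by simp
qed

lemma small_flat_exp:
  assumes "\<theta> < 1" "A > 0" shows "\<exists>\<delta>>0. exp (- \<delta> * A) > (\<theta>::real)"
proof -
  define \<delta> where "\<delta> = (1 - \<theta>) / (2 * A)"
  have "\<delta> > 0" "\<delta> * A = (1 - \<theta>) / 2" using assms by (auto simp: \<delta>_def)
  moreover have "exp (- \<delta> * A) \<ge> 1 + (- \<delta> * A)" by (rule exp_ge_add_one_self)
  ultimately show ?thesis using assms by (intro exI[of _ \<delta>]) auto
qed

text \<open>Both exponential factors are at most 1 and equal exp(- \<delta> / \<eta>) at u. Hence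
  the height M exp(- 2 \<delta> / \<eta>) at u passes c for small \<delta>, while M remains a global
  bound.\<close>

lemma narrow_bump:
  fixes \<eta> c M u :: real
  assumes "\<eta> > 0" "0 < c" "c < M"
  shows "\<exists>f. smooth_on f UNIV \<and> (\<forall>p. f p \<le> M) \<and> (\<forall>p. \<bar>p - u\<bar> \<ge> \<eta> \<longrightarrow> f p = 0) \<and> f u \<ge> c"
proof -
  obtain \<delta> where \<delta>: "\<delta> > 0" "exp (- \<delta> * (2 / \<eta>)) > c / M"
    using small_flat_exp[of "c / M" "2 / \<eta>"] assms by auto
  define f where "f p = M * (flat_exp \<delta> 0 (p - (u - \<eta>)) * flat_exp \<delta> 0 ((u + \<eta>) - p))" for p
  have "smooth_on f UNIV" unfolding smooth_on_def f_def[abs_def]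
    using Ck_on_scaleR[OF open_UNIV Ck_on_const Ck_on_bump[OF \<delta>(1)]] by simp
  moreover have "f p \<le> M" for p
    using flat_exp_bounds[OF \<delta>(1)] assms by (simp add: f_def mult_left_le mult_le_one)
  moreover have "f p = 0" if "\<bar>p - u\<bar> \<ge> \<eta>" for p using that by (auto simp: f_def flat_exp_def)
  moreover have "f u = M * exp (- \<delta> * (2 / \<eta>))" using assms by (simp add: f_def flat_exp_def flip: exp_add)
  then have "f u \<ge> c" using \<delta>(2) assms by (simp add: field_simps)
  ultimately show ?thesis by blast
qed

text \<open>With \<open>y = \<delta> / x\<close>, the derivative of \<open>x exp (- \<delta> / x)\<close> is \<open>(1 + y) exp (- y) \<le> 1\<close>, and the cutoff on
  the right is decreasing, so the slope stays below \<open>C\<close> although the function nearly reaches \<open>C (u + r)\<close>.\<close>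

lemma gentle_bump:
  assumes u: "\<bar>u\<bar> < R" and L: "L > 0" and c: "0 < c" "c < (R + u) * L"
  shows "\<exists>f r. smooth_on f UNIV \<and> r < R \<and> 0 \<le> r \<and> (\<forall>p. \<bar>p\<bar> \<ge> r \<longrightarrow> f p = 0) \<and> f u \<ge> c \<and>
     (\<forall>p d. (f has_real_derivative d) (at p) \<longrightarrow> d < L)"
proof -
  have Ru: "R + u > 0" "R - u > 0" using u by auto
  \<comment> \<open>The strict inequality c < (R + u) L leaves room for a smaller slope C and a
    smaller radius r with c < (r + u) C; the remaining slack pays for the cutoffs.\<close>
  obtain C where C: "c / (R + u) < C" "C < L" using dense[of "c / (R + u)" L] c(2) Ru by (auto simp: field_simps)
  have "c / (R + u) > 0" using c Ru by simp
  then have C0: "C > 0" using C by linarith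
  have "c / C - u < R" using C C0 Ru by (simp add: field_simps)
  then obtain r where r: "max (c / C - u) \<bar>u\<bar> < r" "r < R" using dense[of "max (c / C - u) \<bar>u\<bar>" R] u by auto
  have ru: "r + u > 0" "r - u > 0" using r by auto
  have cC: "c < C * (r + u)" using r(1) C0 by (simp add: field_simps)
  obtain \<delta> where \<delta>: "\<delta> > 0" "exp (- \<delta> * (1 / (r + u) + 1 / (r - u))) > c / (C * (r + u))"
    using small_flat_exp[of "c / (C * (r + u))" "1 / (r + u) + 1 / (r - u)"] cC C0 ru c by (auto simp: add_pos_pos)
  define f where "f p = (C * p + C * r) * (flat_exp \<delta> 0 (p - (- r)) * flat_exp \<delta> 0 (r - p))" for p
  have smooth: "smooth_on f UNIV" unfolding smooth_on_def f_def[abs_def]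
    using Ck_on_scaleR[OF open_UNIV Ck_on_affine[of _ C "C * r"] Ck_on_bump[OF \<delta>(1), of _ "- r" r]]
    by (simp only: real_scaleR_def) simp
  have zero: "f p = 0" if "\<bar>p\<bar> \<ge> r" for p using that by (auto simp: f_def flat_exp_def)
  have "f u = C * (r + u) * exp (- \<delta> * (1 / (r + u) + 1 / (r - u)))"
    using ru by (simp add: f_def flat_exp_def algebra_simps flip: exp_add)
  also have "\<dots> > C * (r + u) * (c / (C * (r + u)))"
    using \<delta>(2) C0 ru by (intro mult_strict_left_mono) auto
  finally have fu: "f u \<ge> c" using C0 ru by simp
  have slope: "d < L" if "(f has_real_derivative d) (at p)" for p d
  proof -
    define y z where "y = p - (- r)" and "z = r - p"
    have d0: "(flat_exp \<delta> 0 has_real_derivative \<delta> * flat_exp \<delta> 2 x) (at x)" for x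
      using flat_exp_deriv[OF \<delta>(1), of 0 x] by (simp add: numeral_2_eq_2)
    have dy: "((\<lambda>p. flat_exp \<delta> 0 (p - (- r))) has_real_derivative \<delta> * flat_exp \<delta> 2 y * 1) (at p)"
      unfolding y_def by (rule DERIV_chain2[OF d0]) (auto intro!: derivative_eq_intros)
    have dz: "((\<lambda>p. flat_exp \<delta> 0 (r - p)) has_real_derivative \<delta> * flat_exp \<delta> 2 z * (-1)) (at p)"
      unfolding z_def by (rule DERIV_chain2[OF d0]) (auto intro!: derivative_eq_intros)
    have "(f has_real_derivative C * (flat_exp \<delta> 0 y * flat_exp \<delta> 0 z) + (\<delta> * flat_exp \<delta> 2 y * 1 * flat_exp \<delta> 0 z +
        \<delta> * flat_exp \<delta> 2 z * (-1) * flat_exp \<delta> 0 y) * (C * y)) (at p)"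
      unfolding f_def[abs_def]
      by (rule DERIV_cong[OF DERIV_mult[OF _ DERIV_mult[OF dy dz]]])
        (auto intro!: derivative_eq_intros simp: y_def z_def algebra_simps)
    from DERIV_unique[OF that this]
    have d: "d = C * ((flat_exp \<delta> 0 y + y * (\<delta> * flat_exp \<delta> 2 y)) * flat_exp \<delta> 0 z) - C * (\<delta> * flat_exp \<delta> 2 z * (y * flat_exp \<delta> 0 y))"
      by (simp add: algebra_simps)
    have 1: "flat_exp \<delta> 0 y + y * (\<delta> * flat_exp \<delta> 2 y) \<le> 1"
    proof (cases "y > 0")
      case True
      have "flat_exp \<delta> 0 y + y * (\<delta> * flat_exp \<delta> 2 y) = (1 + \<delta> / y) * exp (- (\<delta> / y))"
        using True by (simp add: flat_exp_def power2_eq_square field_simps)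
      also have "\<dots> \<le> exp (\<delta> / y) * exp (- (\<delta> / y))" by (intro mult_right_mono exp_ge_add_one_self) auto
      also have "\<dots> = 1" by (simp flip: exp_add)
      finally show ?thesis .
    qed (simp add: flat_exp_def)
    have "(flat_exp \<delta> 0 y + y * (\<delta> * flat_exp \<delta> 2 y)) * flat_exp \<delta> 0 z \<le> 1 * flat_exp \<delta> 0 z"
      by (rule mult_right_mono[OF 1 flat_exp_bounds(1)[OF \<delta>(1)]])
    also have "\<dots> \<le> 1" using flat_exp_bounds[OF \<delta>(1)] by simp
    finally have "C * ((flat_exp \<delta> 0 y + y * (\<delta> * flat_exp \<delta> 2 y)) * flat_exp \<delta> 0 z) \<le> C * 1"
      using C0 by (intro mult_left_mono) auto
    moreover have y0: "0 \<le> y * flat_exp \<delta> 0 y" by (simp add: flat_exp_def)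
    have "0 \<le> C * (\<delta> * flat_exp \<delta> 2 z * (y * flat_exp \<delta> 0 y))"
      by (rule mult_nonneg_nonneg[OF less_imp_le[OF C0] mult_nonneg_nonneg[OF mult_nonneg_nonneg[OF
        less_imp_le[OF \<delta>(1)] flat_exp_bounds(1)[OF \<delta>(1)]] y0]])
    ultimately have "d \<le> C" unfolding d by linarith
    then show ?thesis using C by simp
  qed
  have "0 \<le> r" using r(1) by auto
  then show ?thesis using smooth zero fu slope r(2) by blast
qed

section \<open>Radial Hamiltonians and their orbits\<close>

definition fundamental_box :: "real \<Rightarrow> 'n::finite phase set" where
  "fundamental_box R = of_pq ` ((cbox (- R) R \<times> cbox 0 (\<chi> i. 2)) \<times> cbox 0 (1, \<chi> i. 1))"

lemma compact_fundamental_box: "compact (fundamental_box R)"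
  unfolding fundamental_box_def
  by (intro compact_continuous_image linear_continuous_on[OF bounded_linear_of_pq] compact_Times compact_cbox)

lemma deck_reduce:
  assumes "\<bar>fst (fst v)\<bar> \<le> R" shows "\<exists>d\<in>deck. v + d \<in> fundamental_box R"
proof -
  define d :: "'a phase" where "d = ((0, - of_int \<lfloor>snd (fst v)\<rfloor>), \<chi> i. (- 2 * of_int \<lfloor>fst (snd v $ i) / 2\<rfloor>, - of_int \<lfloor>snd (snd v $ i)\<rfloor>))"
  have d: "d \<in> deck" by (simp add: d_def deck_def)
  have "to_pq (v + d) \<in> (cbox (- R) R \<times> cbox 0 (\<chi> i. 2)) \<times> cbox 0 (1, \<chi> i. 1)"
  proof -
    have 1: "0 \<le> x - of_int \<lfloor>x\<rfloor>" "x - of_int \<lfloor>x\<rfloor> \<le> 1" for x :: real by linarith+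
    have 2: "0 \<le> x - 2 * of_int \<lfloor>x / 2\<rfloor>" "x - 2 * of_int \<lfloor>x / 2\<rfloor> \<le> 2" for x :: real by linarith+
    show ?thesis using assms 1 2
      by (auto simp: to_pq_def d_def cbox_Pair_eq zero_prod_def mem_box_cart)
  qed
  then have "of_pq (to_pq (v + d)) \<in> fundamental_box R" unfolding fundamental_box_def by (rule imageI)
  then show ?thesis using d by auto
qed

text \<open>Neither \<open>cover\<close> nor \<open>periodic_trajectories\<close> refers to
  \<open>points\<close>; it is the homotopy behind the free class that keeps the loop in the
  annulus.\<close>

lemma phase_class_inside:
  assumes "x \<in> pair_class (alpha_class R l) \<beta>" "x (to_circle1 t) = cover (phase_mfd R) v"
  shows "\<bar>fst (fst v)\<bar> < R"
proof -
  have "freely_homotopic (annulus R) (alpha_loop l) (fst \<circ> x)"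
    using assms(1) by (simp add: pair_class_def alpha_class_def free_class_def)
  then obtain h where h: "\<forall>s\<in>{0..1::real}. \<forall>c. h (s, c) \<in> points (annulus R)" "\<forall>c. h (1, c) = (fst \<circ> x) c"
    unfolding freely_homotopic_def homotopic_canon_iff by blast
  have "(fst \<circ> x) c \<in> points (annulus R)" for c
    using h(1)[THEN bspec, of 1, THEN spec, of c] h(2)[THEN spec, of c] by simp
  from this[of "to_circle1 t"] have "(fst (fst v), to_circle1 (snd (fst v))) \<in> points (annulus R)"
    using assms(2) by (simp add: cover_phase)
  then show ?thesis by (auto simp: annulus_def)
qed

locale radial =
  fixes R r :: real and f :: "real \<Rightarrow> real"
  assumes r: "0 \<le> r" "r < R" and smooth: "smooth_on f UNIV" and supp: "\<And>p. \<bar>p\<bar> \<ge> r \<Longrightarrow> f p = 0"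
begin

definition H :: "circle1 \<times> 'n::finite phase_points \<Rightarrow> real" where
  "H z = f (fst (fst (snd z)))"

lemma H_cover: "H (t, cover (phase_mfd R) v) = f (fst (fst v))"
  by (simp add: H_def cover_phase)

lemma H_in_H_c:
  assumes "c \<le> f u"
  shows "(H :: circle1 \<times> 'n::finite phase_points \<Rightarrow> real) \<in> H_c (phase_mfd R) (({u} \<times> UNIV) \<times> X) c"
proof -
  let ?M = "phase_mfd R :: ('n phase, 'n phase_points) flat_mfd"
  have "Ck_on k (\<lambda>z::real \<times> ('n phase). f (fst (fst (snd z)))) UNIV" for k
    by (rule Ck_on_compose[OF open_UNIV Ck_on_linear])
      (use smooth in \<open>auto simp: smooth_on_def intro!: bounded_linear_intros\<close>)
  moreover have "(\<lambda>(t, v). H (to_circle1 t, cover ?M v)) = (\<lambda>z. f (fst (fst (snd z))))"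
    by (auto simp: H_cover fun_eq_iff)
  ultimately have "smooth_hamiltonian ?M H"
    unfolding smooth_hamiltonian_def smooth_on_def by (auto intro: Ck_on_subset[OF _ subset_UNIV])
  moreover have "compactly_supported ?M H"
    unfolding compactly_supported_def
  proof (intro exI conjI ballI)
    \<comment> \<open>The projection of a compact box over |p_0| <= r, which lies in the open
      annulus because r < R; deck translations bring every point with f different from 0 into
      it.\<close>
    let ?K = "(\<lambda>z. (to_circle1 (fst z), cover ?M (snd z))) ` ({0..1::real} \<times> fundamental_box r)"
    have domr: "\<bar>fst (fst v)\<bar> \<le> r" if "v \<in> fundamental_box r" for v :: "'n phase"
      using that by (auto simp: fundamental_box_def of_pq_def)
    show "?K \<subseteq> UNIV \<times> points ?M"
    proof (rule image_subsetI)
      fix z assume "z \<in> {0..1::real} \<times> (fundamental_box r :: 'n phase set)"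
      then have "\<bar>fst (fst (snd z))\<bar> < R" using domr[of "snd z"] r by auto
      then show "(to_circle1 (fst z), cover ?M (snd z)) \<in> UNIV \<times> points ?M"
        by (simp add: points_phase cover_phase del: split_paired_All)
    qed
    show "compact ?K"
      by (intro compact_continuous_image compact_Times compact_fundamental_box continuous_on_Pair continuous_on_to_circle1 continuous_on_cover)
        (auto intro!: continuous_intros)
    show "H y = 0" if y: "y \<in> UNIV \<times> points ?M - ?K" for y
    proof (rule ccontr)
      assume "H y \<noteq> 0"
      then have small: "\<bar>fst (fst (snd y))\<bar> \<le> r" using supp by (force simp: H_def)
      obtain v where v: "snd y = cover ?M v"
      proof -
        have "snd y = cover ?M ((fst (fst (snd y)), rep_circle1 (snd (fst (snd y)))), \<chi> i. (rep_circle2 (fst (snd (snd y) $ i)), rep_circle1 (snd (snd (snd y) $ i))))"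
          by (simp add: cover_phase prod_eq_iff vec_eq_iff)
        then show ?thesis by (rule that)
      qed
      obtain d where d: "d \<in> deck" "v + d \<in> fundamental_box r" using deck_reduce[of v r] small v by (auto simp: cover_phase)
      have cv: "cover ?M (v + d) = snd y" unfolding v cover_eq_iff using d(1) by simp
      define t where "t = rep_circle1 (fst y) - of_int \<lfloor>rep_circle1 (fst y)\<rfloor>"
      have "to_circle1 t = to_circle1 (rep_circle1 (fst y))" unfolding to_circle1_eq_iff t_def by simp
      then have "to_circle1 t = fst y" by simp
      moreover have "t \<in> {0..1}" unfolding t_def atLeastAtMost_iff by linarith
      ultimately have "y \<in> ?K" using d(2) cv by (intro image_eqI[of _ _ "(t, v + d)"]) (auto simp: prod_eq_iff)
      then show False using y by simp
    qed
  qed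
  moreover have "ereal c \<le> (INF y \<in> UNIV \<times> (({u} \<times> UNIV) \<times> X). ereal (H y))"
    using assms by (intro INF_greatest) (auto simp: H_def)
  ultimately show ?thesis by (simp add: H_c_def)
qed

text \<open>The flow preserves p_0 and moves q_0 with the constant speed f'(p_0), so the lift is a
  straight line. By \<open>winding_lift\<close> the speed is l, and both integrands of the action
  are constant.\<close>

lemma H_action:
  fixes x :: "circle1 \<Rightarrow> 'n::finite phase_points"
  assumes x: "x \<in> periodic_trajectories (phase_mfd R) H (pair_class (alpha_class R l) \<beta>)"
  shows "\<exists>p. \<bar>p\<bar> < R \<and> (f has_real_derivative of_int l) (at p) \<and> action (phase_mfd R) (ref_loop l) H x = f p - p * of_int l"
proof -
  let ?M = "phase_mfd R :: ('n phase, 'n phase_points) flat_mfd"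
  obtain X where cl: "x \<in> pair_class (alpha_class R l) \<beta>" and lift: "\<And>t. x (to_circle1 t) = cover ?M (X t)"
    and X: "\<And>t. (X has_vector_derivative ham_vf ?M H t (X t)) (at t)"
    using x unfolding periodic_trajectories_def by blast
  have inside: "\<bar>fst (fst (X t))\<bar> < R" for t by (rule phase_class_inside[OF cl lift])
  have "Ck_on (Suc 0) f UNIV" using smooth by (simp only: smooth_on_def)
  then have f: "(f has_real_derivative deriv f p) (at p)" for p
    by (simp add: DERIV_deriv_iff_real_differentiable)
  define e :: "'n phase" where "e = ((0, 1), 0)"
  have hv: "ham_vf ?M H t v = deriv f (fst (fst v)) *\<^sub>R e" for t v
  proof (rule ham_vf_eqI)
    fix w
    have "((\<lambda>v::'n phase. fst (fst v)) has_derivative (\<lambda>w. fst (fst w))) (at v)"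
      by (intro bounded_linear_imp_has_derivative bounded_linear_intros)
    from diff_chain_at[OF this f[of "fst (fst v)", unfolded has_field_derivative_def]]
    have "fd (\<lambda>v. H (to_circle1 t, cover ?M v)) v = (\<lambda>w. deriv f (fst (fst v)) * fst (fst w))"
      unfolding H_cover by (intro fd_eqI) (simp add: o_def)
    then show "form ?M (deriv f (fst (fst v)) *\<^sub>R e) w = - fd (\<lambda>v. H (to_circle1 t, cover ?M v)) v w"
      by (simp add: form_phase liouville_alt e_def)
  qed
  have X': "(X has_vector_derivative deriv f (fst (fst (X t))) *\<^sub>R e) (at t)" for t using X[of t] by (simp add: hv)
  have p0: "fst (fst (X t)) = fst (fst (X 0))" for t
  proof -
    have D: "((\<lambda>t. fst (fst (X t))) has_vector_derivative 0) (at t)" for t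
      using bounded_linear.has_vector_derivative[OF bounded_linear_compose[OF bounded_linear_fst bounded_linear_fst] X'[of t]]
      by (simp add: e_def)
    obtain c where "\<And>t. t \<in> UNIV \<Longrightarrow> fst (fst (X t)) = c"
      using has_vector_derivative_zero_constant[OF convex_UNIV D] by blast
    then show ?thesis by simp
  qed
  define p where "p = fst (fst (X 0))"
  have Xt: "X t = X 0 + t *\<^sub>R (deriv f p *\<^sub>R e)" for t
  proof -
    have D: "((\<lambda>t. X t - t *\<^sub>R (deriv f p *\<^sub>R e)) has_vector_derivative 0) (at t)" for t
      using X'[of t] p0[of t] by (auto simp: p_def intro!: derivative_eq_intros)
    obtain c where c: "\<And>t. t \<in> UNIV \<Longrightarrow> X t - t *\<^sub>R (deriv f p *\<^sub>R e) = c"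
      using has_vector_derivative_zero_constant[OF convex_UNIV D] by blast
    show ?thesis using c[of t] c[of 0] by (simp add: algebra_simps)
  qed
  have cont: "continuous_on UNIV X" using X by (auto intro!: continuous_at_imp_continuous_on has_vector_derivative_continuous)
  have dl: "deriv f p = of_int l"
    using winding_lift[OF cl cont lift] Xt[of 1] by (simp add: e_def)
  have el: "of_int l *\<^sub>R e = winding_vec l" by (simp add: e_def winding_vec_def)
  have Xt': "X t = X 0 + t *\<^sub>R winding_vec l" for t using Xt[of t] unfolding dl el .
  interpret quasi_periodic_lift R l X x
  proof
    show "X (t + 1) = X t + winding_vec l" for t using Xt'[of "t + 1"] Xt'[of t] by (simp add: algebra_simps)
  qed (use cont inside lift in auto)
  have "smooth_on X UNIV"
    unfolding smooth_on_def
  proof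
    fix k
    have "X = (\<lambda>t. X 0 + t *\<^sub>R winding_vec l)" using Xt' by (rule ext)
    moreover have "Ck_on k (\<lambda>t::real. X 0 + t *\<^sub>R winding_vec l) UNIV"
      by (intro Ck_on_add Ck_on_scaleR Ck_on_const Ck_on_linear[OF bounded_linear_ident] open_UNIV)
    ultimately show "Ck_on k X UNIV" by simp
  qed
  moreover have "(X has_vector_derivative winding_vec l) (at t)" for t
    using X'[of t] p0[of t] by (simp add: p_def[symmetric] dl el)
  ultimately have "action ?M (ref_loop l) H x = - integral {0..1} (\<lambda>t. liouville (X t) (winding_vec l)) + integral {0..1} (\<lambda>t. H (to_circle1 t, x (to_circle1 t)))"
    by (rule action_eq)
  also have "(\<lambda>t. liouville (X t) (winding_vec l)) = (\<lambda>t. p * of_int l)"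
    using p0 by (auto simp: liouville_alt winding_vec_def p_def)
  also have "(\<lambda>t. H (to_circle1 t, x (to_circle1 t))) = (\<lambda>t. f p)"
    unfolding lift H_cover p_def by (rule ext, rule arg_cong[where f = f], rule p0)
  finally have "action ?M (ref_loop l) H x = f p - p * of_int l" by simp
  moreover have "(f has_real_derivative of_int l) (at p)" using f[of p] dl by simp
  moreover have "\<bar>p\<bar> < R" using inside[of 0] by (simp add: p_def)
  ultimately show ?thesis by blast
qed

end

section \<open>Orbits of large action\<close>

text \<open>Serves to glue at the integers, where the one-sided derivatives come from two adjacent
  unit intervals.\<close>

lemma has_vector_derivative_within_Un:
  assumes "(f has_vector_derivative d) (at x within S)" "(f has_vector_derivative d) (at x within T)"
  shows "(f has_vector_derivative d) (at x within (S \<union> T))"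
  using assms unfolding has_vector_derivative_def has_derivative_within
  by (auto simp: at_within_union filterlim_sup)

text \<open>Invariance of the field under simultaneous shifts of time by k and of position by k
  \<gamma> turns shifted copies of Y into solutions, and \<open>Y1\<close> makes them fit together
  at the integers.\<close>

lemma quasi_periodic_extension:
  fixes Y :: "real \<Rightarrow> 'v::real_normed_vector" and g :: "real \<Rightarrow> 'v \<Rightarrow> 'v"
  assumes Y: "\<And>t. t \<in> {0..1} \<Longrightarrow> (Y has_vector_derivative g t (Y t)) (at t within {0..1})"
    and Y1: "Y 1 = Y 0 + \<gamma>"
    and g: "\<And>t k v. k \<in> \<int> \<Longrightarrow> g (t + k) (v + k *\<^sub>R \<gamma>) = g t v"
  defines "X \<equiv> \<lambda>t. Y (t - of_int \<lfloor>t\<rfloor>) + of_int \<lfloor>t\<rfloor> *\<^sub>R \<gamma>"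
  shows "(X has_vector_derivative g t (X t)) (at t)"
proof -
  have seg: "X t = Y (t - of_int n) + of_int n *\<^sub>R \<gamma>" if "t \<in> {of_int n..of_int n + 1}" for t and n :: int
  proof (cases "t = of_int n + 1")
    case True
    then have "\<lfloor>t\<rfloor> = n + 1" by simp
    then show ?thesis using Y1 True by (simp add: X_def algebra_simps)
  next
    case False
    then have "\<lfloor>t\<rfloor> = n" using that by (intro floor_unique) auto
    then show ?thesis by (simp add: X_def)
  qed
  have dseg: "(X has_vector_derivative g t (X t)) (at t within {of_int n..of_int n + 1})"
    if t: "t \<in> {of_int n..of_int n + 1}" for t and n :: int
  proof -
    have im: "(\<lambda>t. t - of_int n) ` {of_int n..of_int n + 1} = {0..1::real}" by (simp add: image_diff_atLeastAtMost)
    have 1: "((\<lambda>t::real. t - of_int n) has_vector_derivative 1) (at t within {of_int n..of_int n + 1})"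
      by (auto intro!: derivative_eq_intros)
    have "(Y has_vector_derivative g (t - of_int n) (Y (t - of_int n))) (at (t - of_int n) within (\<lambda>t. t - of_int n) ` {of_int n..of_int n + 1})"
      unfolding im by (rule Y) (use t in auto)
    from vector_diff_chain_within[OF 1 this]
    have "((\<lambda>t. Y (t - of_int n)) has_vector_derivative g (t - of_int n) (Y (t - of_int n))) (at t within {of_int n..of_int n + 1})"
      by (simp add: o_def)
    moreover have "g (t - of_int n) (Y (t - of_int n)) = g t (X t)"
      using g[of "of_int n" "t - of_int n" "Y (t - of_int n)"] seg[OF t] by simp
    ultimately have "((\<lambda>t. Y (t - of_int n) + of_int n *\<^sub>R \<gamma>) has_vector_derivative g t (X t) + 0) (at t within {of_int n..of_int n + 1})"
      by (intro has_vector_derivative_add has_vector_derivative_const) simp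
    then have "((\<lambda>t. Y (t - of_int n) + of_int n *\<^sub>R \<gamma>) has_vector_derivative g t (X t)) (at t within {of_int n..of_int n + 1})" by simp
    then show ?thesis by (rule has_vector_derivative_transform[OF t, rotated]) (rule seg)
  qed
  define n where "n = \<lfloor>t\<rfloor>"
  have n: "of_int n \<le> t" "t < of_int n + 1" by (auto simp: n_def)
  show ?thesis
  proof (cases "t = of_int n")
    case True
    have "(X has_vector_derivative g t (X t)) (at t within ({of_int (n - 1)..of_int (n - 1) + 1} \<union> {of_int n..of_int n + 1}))"
      by (rule has_vector_derivative_within_Un; rule dseg) (use True in auto)
    also have "{of_int (n - 1)..of_int (n - 1) + 1} \<union> {of_int n..of_int n + 1} = {t - 1..t + 1}" using True by auto
    also have "at t within {t - 1..t + 1} = at t" by (rule at_within_Icc_at) auto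
    finally show ?thesis .
  next
    case False
    then have "at t within {of_int n..of_int n + 1} = at t" using n by (intro at_within_Icc_at) auto
    then show ?thesis using dseg[of t n] n by auto
  qed
qed

text \<open>The Riesz representative of a linear functional, which turns Frechet derivatives into
  the vectors that the ascent follows.\<close>

definition grad :: "('e::euclidean_space \<Rightarrow> real) \<Rightarrow> 'e" where "grad \<phi> = (\<Sum>b\<in>Basis. \<phi> b *\<^sub>R b)"

lemma grad_inner: "linear \<phi> \<Longrightarrow> grad \<phi> \<bullet> a = \<phi> a"
proof -
  assume lin: "linear \<phi>"
  have "\<phi> a = \<phi> (\<Sum>b\<in>Basis. (a \<bullet> b) *\<^sub>R b)" by (simp add: euclidean_representation)
  also have "\<dots> = (\<Sum>b\<in>Basis. (a \<bullet> b) * \<phi> b)" by (simp add: linear_sum[OF lin] linear_scale[OF lin])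
  also have "\<dots> = (\<Sum>b\<in>Basis. (\<phi> b *\<^sub>R b) \<bullet> a)"
    by (rule sum.cong[OF refl]) (simp add: inner_commute[of a])
  finally show ?thesis by (simp only: grad_def inner_sum_left)
qed

lemma norm_grad_le:
  assumes "linear \<phi>" "\<And>a. \<bar>\<phi> a\<bar> \<le> C * norm a"
  shows "norm (grad \<phi>) \<le> C"
proof (cases "grad \<phi> = 0")
  case True
  have "0 \<le> C * norm (SOME b :: 'a. b \<in> Basis)" using assms(2)[of "SOME b. b \<in> Basis"] by linarith
  then show ?thesis using True norm_some_Basis by simp
next
  case False
  have "norm (grad \<phi>) * norm (grad \<phi>) = \<phi> (grad \<phi>)"
    using grad_inner[OF assms(1), of "grad \<phi>"] dot_square_norm[of "grad \<phi>"] by (simp add: power2_eq_square)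
  also have "\<dots> \<le> C * norm (grad \<phi>)" using assms(2)[of "grad \<phi>"] by linarith
  finally show ?thesis using False by simp
qed

lemma grad_diff: "grad \<phi> - grad \<psi> = grad (\<lambda>a. \<phi> a - \<psi> a)"
  by (simp add: grad_def sum_subtractf scaleR_diff_left)

text \<open>Reduction to \<open>hamiltonian_orbit\<close>: H is pulled back to the covering space
  and extended by 0, periodicity supplies uniform bounds, and the orbit found over [0, 1] is
  continued to all times and projected.\<close>

lemma orbit_of_large_action:
  fixes H :: "circle1 \<times> 'n::finite phase_points \<Rightarrow> real" and l :: int
  assumes u: "\<bar>u\<bar> < R" and H: "H \<in> H_c (phase_mfd R) (({u} \<times> UNIV) \<times> zero_torus) c"
    and c: "c - u * of_int l > R * \<bar>of_int l\<bar>"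
  shows "\<exists>x\<in>periodic_trajectories (phase_mfd R) H (pair_class (alpha_class R l) (trivial_class torus)).
    action (phase_mfd R) (ref_loop l) H x \<ge> c - u * of_int l"
proof -
  let ?M = "phase_mfd R :: ('n phase, 'n phase_points) flat_mfd"
  have R0: "R > 0" using u by linarith
  have smoothH: "smooth_hamiltonian ?M H" and suppH: "compactly_supported ?M H"
    and infH: "ereal c \<le> (INF y \<in> UNIV \<times> (({u} \<times> UNIV) \<times> zero_torus). ereal (H y))"
    using H by (auto simp: H_c_def)
  have Hc: "c \<le> H y" if "y \<in> UNIV \<times> (({u} \<times> UNIV) \<times> zero_torus)" for y
    using order_trans[OF infH INF_lower[OF that]] by simp
  \<comment> \<open>A compact support in the open annulus leaves a margin r < |p_0| < R on which H
    vanishes.\<close>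
  obtain r where r: "0 \<le> r" "r < R" and rsupp: "\<And>y. y \<in> UNIV \<times> points ?M \<Longrightarrow> \<bar>fst (fst (snd y))\<bar> > r \<Longrightarrow> H y = 0"
  proof -
    obtain K where K: "K \<subseteq> UNIV \<times> points ?M" "compact K" "\<And>y. y \<in> UNIV \<times> points ?M - K \<Longrightarrow> H y = 0"
      using suppH unfolding compactly_supported_def by blast
    show ?thesis
    proof (cases "K = {}")
      case True
      then show ?thesis using K(3) R0 by (intro that[of 0]) auto
    next
      case False
      have "continuous_on K (\<lambda>y. \<bar>fst (fst (snd y))\<bar>)" by (intro continuous_intros)
      from continuous_attains_sup[OF K(2) False this]
      obtain k where k: "k \<in> K" "\<And>y. y \<in> K \<Longrightarrow> \<bar>fst (fst (snd y))\<bar> \<le> \<bar>fst (fst (snd k))\<bar>" by blast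
      show ?thesis
      proof (rule that)
        show "0 \<le> \<bar>fst (fst (snd k))\<bar>" by simp
        have "snd k \<in> points ?M" using k(1) K(1) by auto
        then show "\<bar>fst (fst (snd k))\<bar> < R" by (simp add: points_phase)
        fix y :: "circle1 \<times> ('n phase_points)"
        assume y: "y \<in> UNIV \<times> points ?M" "\<bar>fst (fst (snd y))\<bar> > \<bar>fst (fst (snd k))\<bar>"
        then have "y \<notin> K" using k(2)[of y] by linarith
        then show "H y = 0" using K(3) y(1) by blast
      qed
    qed
  qed
  \<comment> \<open>Smooth in spite of the case distinction: the open sets \<open>S1\<close> and
    \<open>Z\<close> overlap in the margin, cover everything, and F is smooth on each.\<close>
  define F :: "real \<times> 'n phase \<Rightarrow> real"
    where "F z = (if \<bar>fst (fst (snd z))\<bar> < R then H (to_circle1 (fst z), cover ?M (snd z)) else 0)" for z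
  define S1 where "S1 = {z :: real \<times> ('n phase). \<bar>fst (fst (snd z))\<bar> < R}"
  define Z where "Z = {z :: real \<times> ('n phase). \<bar>fst (fst (snd z))\<bar> > r}"
  have openS1: "open S1" unfolding S1_def by (intro open_Collect_less continuous_intros)
  have openZ: "open Z" unfolding Z_def by (intro open_Collect_less continuous_intros)
  have FZ: "F z = 0" if "z \<in> Z" for z
    using that rsupp[of "(to_circle1 (fst z), cover ?M (snd z))"] by (auto simp: F_def Z_def points_phase cover_phase)
  have smoothF: "smooth_on F UNIV"
    unfolding smooth_on_def
  proof
    fix k
    have "UNIV \<times> cover ?M -` points ?M = S1" by (auto simp: S1_def points_phase cover_phase)
    then have "Ck_on k (\<lambda>(t, v). H (to_circle1 t, cover ?M v)) S1"
      using smoothH unfolding smooth_hamiltonian_def smooth_on_def by simp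
    moreover have "Ck_on k (\<lambda>(t, v). H (to_circle1 t, cover ?M v)) S1 \<longleftrightarrow> Ck_on k F S1"
      by (rule Ck_on_cong[OF openS1]) (auto simp: F_def S1_def)
    moreover have "Ck_on k (\<lambda>_. 0 :: real) Z \<longleftrightarrow> Ck_on k F Z" by (rule Ck_on_cong[OF openZ]) (simp add: FZ)
    ultimately have "Ck_on k F (S1 \<union> Z)" by (intro Ck_on_Un openS1 openZ) (auto simp: Ck_on_const)
    moreover have "S1 \<union> Z = UNIV" using r by (auto simp: S1_def Z_def)
    ultimately show "Ck_on k F UNIV" by simp
  qed
  \<comment> \<open>Time translations are included, so that the box of representatives is compact in
    time as well.\<close>
  define \<Lambda> where "\<Lambda> = (\<int> :: real set) \<times> (deck :: 'n phase set)"
  have Finv: "F (z + \<tau>) = F z" if "\<tau> \<in> \<Lambda>" for z \<tau>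
  proof -
    have d: "snd \<tau> \<in> deck" "fst \<tau> \<in> \<int>" using that by (auto simp: \<Lambda>_def)
    have "to_circle1 (fst z + fst \<tau>) = to_circle1 (fst z)" using d(2) by (simp add: to_circle1_eq_iff)
    moreover have "cover ?M (snd z + snd \<tau>) = cover ?M (snd z)" using d(1) by (simp add: cover_eq_iff)
    moreover have "fst (fst (snd \<tau>)) = 0" using d(1) by (simp add: deck_def)
    ultimately show ?thesis by (simp add: F_def)
  qed
  have CkS: "Ck_on (Suc k) F UNIV" for k using smoothF by (simp only: smooth_on_def)
  have Fd: "F differentiable (at z)" for z using iffD1[OF Ck_on.simps(2) CkS[of 0]] by blast
  have Ckfd: "Ck_on k (\<lambda>z. fd F z v) UNIV" for v k using iffD1[OF Ck_on.simps(2) CkS[of k]] by blast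
  have fdinv: "fd F (z + \<tau>) = fd F z" if "\<tau> \<in> \<Lambda>" for z \<tau> by (rule fd_periodic[OF Finv[OF that] Fd])
  have fdZ: "fd F z v = 0" if "z \<in> Z" for z v by (rule fd_zero_open[OF openZ FZ that])
  have fdlin: "linear (fd F z)" for z by (rule has_derivative_linear[OF fd_works[OF Fd]])
  have "\<exists>C\<ge>0. (\<forall>x. \<bar>F x\<bar> \<le> C) \<and> (\<forall>x v. \<bar>fd F x v\<bar> \<le> C * norm v) \<and>
      (\<forall>x y v. \<bar>fd F x v - fd F y v\<bar> \<le> C * norm (x - y) * norm v)"
  proof (rule periodic_smooth_bounds[OF smoothF Finv openZ FZ])
    show "compact ({0..1::real} \<times> fundamental_box R)" by (intro compact_Times compact_fundamental_box) simp
    show "z \<in> Z \<or> (\<exists>\<tau>\<in>\<Lambda>. z + \<tau> \<in> {0..1::real} \<times> fundamental_box R)" for z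
    proof (cases "z \<in> Z")
      case False
      then have "\<bar>fst (fst (snd z))\<bar> \<le> R" using r by (simp add: Z_def)
      then obtain d where d: "d \<in> deck" "snd z + d \<in> fundamental_box R" using deck_reduce by blast
      have "0 \<le> fst z - of_int \<lfloor>fst z\<rfloor>" "fst z - of_int \<lfloor>fst z\<rfloor> \<le> 1" by linarith+
      then have "z + (- of_int \<lfloor>fst z\<rfloor>, d) \<in> {0..1::real} \<times> fundamental_box R" using d(2) by (cases z) auto
      moreover have "(- of_int \<lfloor>fst z\<rfloor>, d) \<in> \<Lambda>" using d(1) by (simp add: \<Lambda>_def)
      ultimately show ?thesis by (intro disjI2 bexI[of _ "(- of_int \<lfloor>fst z\<rfloor>, d)"])
    qed simp
  qed
  then obtain C where C: "C \<ge> 0" "\<And>x. \<bar>F x\<bar> \<le> C" "\<And>x v. \<bar>fd F x v\<bar> \<le> C * norm v"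
      "\<And>x y v. \<bar>fd F x v - fd F y v\<bar> \<le> C * norm (x - y) * norm v" by blast

  \<comment> \<open>Gradients in momentum and position coordinates\<close>
  interpret of_pq: bounded_linear "of_pq :: _ \<Rightarrow> 'n phase" by (rule bounded_linear_of_pq)
  obtain B where B: "B > 0" "\<And>z :: 'n coords \<times> ('n coords). norm (of_pq z) \<le> B * norm z"
    using of_pq.pos_bounded by (auto simp: mult.commute)
  define jp where "jp a = (0 :: real, of_pq (a, 0 :: 'n coords))" for a :: "'n coords"
  define jq where "jq a = (0 :: real, of_pq (0 :: 'n coords, a))" for a :: "'n coords"
  have lj: "linear jp" "linear jq"
    by (auto intro!: linearI simp: jp_def jq_def of_pq.add[symmetric] of_pq.scaleR[symmetric])
  have nj: "norm (jp a) \<le> B * norm a" "norm (jq a) \<le> B * norm a" for a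
    using B(2)[of "(a, 0)"] B(2)[of "(0, a)"] by (auto simp: jp_def jq_def norm_Pair)
  have ljF: "linear (\<lambda>a. fd F z (jp a))" "linear (\<lambda>a. fd F z (jq a))" for z
    using linear_compose[OF lj(1) fdlin] linear_compose[OF lj(2) fdlin] by (simp_all add: o_def)
  define gp where "gp z = grad (\<lambda>a. fd F z (jp a))" for z
  define gq where "gq z = grad (\<lambda>a. fd F z (jq a))" for z
  have gsplit: "gp z \<bullet> fst x + gq z \<bullet> snd x = fd F z (0, of_pq x)" for z x
  proof -
    have "of_pq (fst x, 0) + of_pq (0, snd x) = of_pq x" unfolding of_pq.add[symmetric] by simp
    then have "jp (fst x) + jq (snd x) = (0, of_pq x)" by (simp add: jp_def jq_def)
    then show ?thesis unfolding gp_def gq_def grad_inner[OF ljF(1)] grad_inner[OF ljF(2)]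
      using linear_add[OF fdlin, of z "jp (fst x)" "jq (snd x)"] by simp
  qed
  have gbound: "norm (gp z) \<le> C * B" "norm (gq z) \<le> C * B" for z
    unfolding gp_def gq_def
    by (rule norm_grad_le[OF ljF(1)] norm_grad_le[OF ljF(2)],
        rule order_trans[OF C(3)], use nj C(1) in \<open>auto simp: mult.assoc intro!: mult_left_mono\<close>)+
  have glip: "norm (gp z - gp z') \<le> C * norm (z - z') * B" "norm (gq z - gq z') \<le> C * norm (z - z') * B" for z z'
  proof -
    have "norm (gp z - gp z') \<le> C * norm (z - z') * B"
      unfolding gp_def grad_diff
    proof (rule norm_grad_le)
      show "linear (\<lambda>a. fd F z (jp a) - fd F z' (jp a))" by (intro linear_compose_sub ljF)
      show "\<bar>fd F z (jp a) - fd F z' (jp a)\<bar> \<le> C * norm (z - z') * B * norm a" for a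
        using order_trans[OF C(4) mult_left_mono[OF nj(1)[of a], of "C * norm (z - z')"]] C(1) by (simp add: mult.assoc)
    qed
    moreover have "norm (gq z - gq z') \<le> C * norm (z - z') * B"
      unfolding gq_def grad_diff
    proof (rule norm_grad_le)
      show "linear (\<lambda>a. fd F z (jq a) - fd F z' (jq a))" by (intro linear_compose_sub ljF)
      show "\<bar>fd F z (jq a) - fd F z' (jq a)\<bar> \<le> C * norm (z - z') * B * norm a" for a
        using order_trans[OF C(4) mult_left_mono[OF nj(2)[of a], of "C * norm (z - z')"]] C(1) by (simp add: mult.assoc)
    qed
    ultimately show "norm (gp z - gp z') \<le> C * norm (z - z') * B" "norm (gq z - gq z') \<le> C * norm (z - z') * B" by auto
  qed
  have ginv: "gp (z + \<tau>) = gp z" "gq (z + \<tau>) = gq z" if "\<tau> \<in> \<Lambda>" for z \<tau>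
    unfolding gp_def gq_def fdinv[OF that] by (rule refl)+
  have gzero: "gp z = 0" "gq z = 0" if "z \<in> Z" for z
    unfolding gp_def gq_def grad_def fdZ[OF that] by simp_all
  have Ckg: "Ck_on k gp UNIV" "Ck_on k gq UNIV" for k
    unfolding gp_def[abs_def] gq_def[abs_def] grad_def
    by (intro Ck_on_sum Ck_on_scaleR Ckfd Ck_on_const open_UNIV)+
  \<comment> \<open>The deck lattice splits into translations of p_1, ..., p_n and translations of
    all positions; p_0 admits none.\<close>
  define \<Lambda>p where "\<Lambda>p = {a :: real ^ 'n. \<forall>i. a $ i / 2 \<in> \<int>}"
  define \<Lambda>q where "\<Lambda>q = {b :: 'n coords. fst b \<in> \<int> \<and> (\<forall>i. snd b $ i \<in> \<int>)}"
  have lat: "(0, of_pq ((0, a), b)) \<in> \<Lambda>" if "a \<in> \<Lambda>p" "b \<in> \<Lambda>q" for a b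
    using that by (auto simp: \<Lambda>_def deck_def of_pq_def \<Lambda>p_def \<Lambda>q_def)
  have latadd: "(t, of_pq (p + (0, a), q + b)) = (t, of_pq (p, q)) + (0, of_pq ((0, a), b))" for t :: real and p q :: "'n coords" and a b
    by (simp add: of_pq.add[symmetric])
  have sel: "continuous_on UNIV (\<lambda>x::real \<times> 'n coords \<times> ('n coords). (fst x, of_pq (fst (snd x), snd (snd x))))"
    by (intro continuous_intros of_pq.continuous_on)
  have cc: "continuous_on UNIV (\<lambda>(t, p, q). G (t, of_pq (p, q)))" if "continuous_on UNIV G"
    for G :: "real \<times> 'n phase \<Rightarrow> 'z::topological_space"
    using continuous_on_compose2[OF that sel] by (simp add: split_beta)
  have dist: "norm ((t, of_pq (p, q)) - (t, of_pq (p', q'))) \<le> B * (norm (p - p') + norm (q - q'))"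
    for t :: real and p q p' q' :: "'n coords"
  proof -
    have "norm ((t, of_pq (p, q)) - (t, of_pq (p', q'))) = norm (of_pq ((p, q) - (p', q')))"
      unfolding of_pq.diff by (simp add: norm_Pair)
    also have "\<dots> \<le> B * norm (p - p', q - q')" using B(2)[of "(p - p', q - q')"] by simp
    also have "\<dots> \<le> B * (norm (p - p') + norm (q - q'))" using B(1) by (intro mult_left_mono norm_Pair_le) auto
    finally show ?thesis .
  qed
  define l' where "l' = real_of_int l"
  have "\<exists>P Q. (\<forall>t\<in>{0..1}. (P has_vector_derivative - gq (t, of_pq (P t, Q t))) (at t within {0..1}) \<and>
       (Q has_vector_derivative gp (t, of_pq (P t, Q t))) (at t within {0..1}) \<and> \<bar>fst (P t)\<bar> < R) \<and>
     P 1 = P 0 \<and> Q 1 = Q 0 + (l', 0) \<and>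
     integral {0..1} (\<lambda>t. F (t, of_pq (P t, Q t)) - P t \<bullet> gp (t, of_pq (P t, Q t))) \<ge> c - u * l'"
  \<comment> \<open>\<open>B\<close> is the norm of the change of coordinates and enters the
    Lipschitz constant twice, through the points and through the gradients. \<open>D\<close> bounds
    the l^1 norm on a fundamental cell: 2 n for the momenta, n + 1 for the positions.\<close>
  proof (rule hamiltonian_orbit[where F = "\<lambda>t p q. F (t, of_pq (p, q))" and Fp = "\<lambda>t p q. gp (t, of_pq (p, q))" and Fq = "\<lambda>t p q. gq (t, of_pq (p, q))"
      and L = "C * B * B" and C = "C + C * B" and \<Lambda>p = \<Lambda>p and \<Lambda>q = \<Lambda>q and D = "2 * real CARD('n) + 1" and r = r])
    fix t :: real and p q p' q' :: "'n coords"
    have "((\<lambda>z. (t, of_pq z)) has_derivative (\<lambda>z. (0, of_pq z))) (at (p, q))"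
      by (intro has_derivative_Pair has_derivative_const bounded_linear_imp_has_derivative[OF bounded_linear_of_pq])
    from diff_chain_at[OF this fd_works[OF Fd]]
    have "((\<lambda>z. F (t, of_pq z)) has_derivative (\<lambda>z. fd F (t, of_pq (p, q)) (0, of_pq z))) (at (p, q))" by (simp add: o_def)
    then show "((\<lambda>z. F (t, of_pq (fst z, snd z))) has_derivative (\<lambda>z. gp (t, of_pq (p, q)) \<bullet> fst z + gq (t, of_pq (p, q)) \<bullet> snd z)) (at (p, q))"
      by (simp add: gsplit)
    have "C * norm ((t, of_pq (p, q)) - (t, of_pq (p', q'))) * B \<le> C * (B * (norm (p - p') + norm (q - q'))) * B"
      using dist C(1) B(1) by (intro mult_right_mono mult_left_mono) auto
    then have "C * norm ((t, of_pq (p, q)) - (t, of_pq (p', q'))) * B \<le> C * B * B * (norm (p - p') + norm (q - q'))"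
      by (simp add: algebra_simps)
    then show "norm (gp (t, of_pq (p, q)) - gp (t, of_pq (p', q'))) \<le> C * B * B * (norm (p - p') + norm (q - q'))"
      "norm (gq (t, of_pq (p, q)) - gq (t, of_pq (p', q'))) \<le> C * B * B * (norm (p - p') + norm (q - q'))"
      using glip[of "(t, of_pq (p, q))" "(t, of_pq (p', q'))"] by linarith+
    have "C * B \<ge> 0" using C(1) B(1) by simp
    then show "norm (gp (t, of_pq (p, q))) \<le> C + C * B" "norm (gq (t, of_pq (p, q))) \<le> C + C * B" "\<bar>F (t, of_pq (p, q))\<bar> \<le> C + C * B"
      using gbound[of "(t, of_pq (p, q))"] C(1) C(2)[of "(t, of_pq (p, q))"] by linarith+
    assume "\<bar>fst p\<bar> > r"
    then have "(t, of_pq (p, q)) \<in> Z" by (simp add: Z_def of_pq_def)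
    then show "F (t, of_pq (p, q)) = 0 \<and> gp (t, of_pq (p, q)) = 0 \<and> gq (t, of_pq (p, q)) = 0" using FZ gzero by simp
  next
    show "C * B * B \<ge> 0" using C(1) B(1) by simp
  next
    show "continuous_on UNIV (\<lambda>(t, p, q). F (t, of_pq (p, q)))" "continuous_on UNIV (\<lambda>(t, p, q). gp (t, of_pq (p, q)))"
      "continuous_on UNIV (\<lambda>(t, p, q). gq (t, of_pq (p, q)))"
      using cc Ck_on_imp_continuous_on Ckg[of 0] smoothF[unfolded smooth_on_def, THEN spec, of 0] by blast+
  next
    fix t :: real and p q a b assume "a \<in> \<Lambda>p" "b \<in> \<Lambda>q"
    note \<tau> = lat[OF this]
    show "F (t, of_pq (p + (0, a), q + b)) = F (t, of_pq (p, q))" "gp (t, of_pq (p + (0, a), q + b)) = gp (t, of_pq (p, q))"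
      "gq (t, of_pq (p + (0, a), q + b)) = gq (t, of_pq (p, q))"
      unfolding latadd by (rule Finv[OF \<tau>] ginv(1)[OF \<tau>] ginv(2)[OF \<tau>])+
  next
    fix x :: "real ^ 'n"
    define a :: "real ^ 'n" where "a = (\<chi> i. - 2 * of_int \<lfloor>x $ i / 2\<rfloor>)"
    have "a \<in> \<Lambda>p" by (simp add: \<Lambda>p_def a_def)
    moreover have "norm (x + a) \<le> (\<Sum>i\<in>UNIV. \<bar>(x + a) $ i\<bar>)" by (rule norm_le_l1_cart)
    moreover have "(\<Sum>i\<in>UNIV. \<bar>(x + a) $ i\<bar>) \<le> (\<Sum>i\<in>(UNIV :: 'n set). 2)"
    proof (rule sum_mono)
      fix i
      have "0 \<le> x $ i - 2 * of_int \<lfloor>x $ i / 2\<rfloor>" "x $ i - 2 * of_int \<lfloor>x $ i / 2\<rfloor> \<le> 2" by linarith+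
      then show "\<bar>(x + a) $ i\<bar> \<le> 2" by (simp add: a_def)
    qed
    ultimately show "\<exists>a\<in>\<Lambda>p. norm (x + a) \<le> 2 * real CARD('n) + 1" by (intro bexI[of _ a]) auto
  next
    fix y :: "'n coords"
    define b :: "'n coords" where "b = (- of_int \<lfloor>fst y\<rfloor>, \<chi> i. - of_int \<lfloor>snd y $ i\<rfloor>)"
    have b: "b \<in> \<Lambda>q" by (simp add: \<Lambda>q_def b_def)
    have "norm (y + b) \<le> \<bar>fst (y + b)\<bar> + norm (snd (y + b))" using norm_Pair_le[of "fst (y + b)" "snd (y + b)"] by (simp only: prod.collapse real_norm_def)
    also have "\<bar>fst (y + b)\<bar> \<le> 1"
    proof -
      have "0 \<le> fst y - of_int \<lfloor>fst y\<rfloor>" "fst y - of_int \<lfloor>fst y\<rfloor> \<le> 1" by linarith+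
      then show ?thesis by (simp add: b_def)
    qed
    also have "norm (snd (y + b)) \<le> (\<Sum>i\<in>UNIV. \<bar>snd (y + b) $ i\<bar>)" by (rule norm_le_l1_cart)
    also have "\<dots> \<le> (\<Sum>i\<in>(UNIV :: 'n set). 1)"
    proof (rule sum_mono)
      fix i
      have "0 \<le> snd y $ i - of_int \<lfloor>snd y $ i\<rfloor>" "snd y $ i - of_int \<lfloor>snd y $ i\<rfloor> \<le> 1" by linarith+
      then show "\<bar>snd (y + b) $ i\<bar> \<le> 1" by (simp add: b_def)
    qed
    finally show "\<exists>b\<in>\<Lambda>q. norm (y + b) \<le> 2 * real CARD('n) + 1" using b by (intro bexI[of _ b]) auto
  next
    fix t :: real and q :: "'n coords"
    have "(to_circle1 t, cover ?M (of_pq ((u, 0), q))) \<in> UNIV \<times> (({u} \<times> UNIV) \<times> zero_torus)"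
      by (simp add: cover_phase of_pq_def zero_torus_def)
    from Hc[OF this] show "F (t, of_pq ((u, 0), q)) \<ge> c" using u by (simp add: F_def of_pq_def)
  qed (use r u c in \<open>auto simp: l'_def\<close>)
  then obtain P Q where dP: "\<And>t. t\<in>{0..1} \<Longrightarrow> (P has_vector_derivative - gq (t, of_pq (P t, Q t))) (at t within {0..1})"
    and dQ: "\<And>t. t\<in>{0..1} \<Longrightarrow> (Q has_vector_derivative gp (t, of_pq (P t, Q t))) (at t within {0..1})"
    and PR: "\<And>t. t\<in>{0..1} \<Longrightarrow> \<bar>fst (P t)\<bar> < R" and P1: "P 1 = P 0" and Q1: "Q 1 = Q 0 + (l', 0)"
    and act: "integral {0..1} (\<lambda>t. F (t, of_pq (P t, Q t)) - P t \<bullet> gp (t, of_pq (P t, Q t))) \<ge> c - u * l'" by blast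

  \<comment> \<open>From the lifted orbit to a trajectory\<close>
  define V where "V z = of_pq (- gq z, gp z)" for z
  define Y where "Y t = of_pq (P t, Q t)" for t
  define \<gamma> :: "'n phase" where "\<gamma> = winding_vec l"
  have V\<Lambda>: "V (z + \<tau>) = V z" if "\<tau> \<in> \<Lambda>" for z \<tau> unfolding V_def ginv[OF that] ..
  have dY: "(Y has_vector_derivative V (t, Y t)) (at t within {0..1})" if "t \<in> {0..1}" for t
    unfolding Y_def[abs_def] V_def
    by (rule of_pq.has_vector_derivative[OF has_vector_derivative_Pair[OF dP dQ]]) (use that in auto)
  have Y1: "Y 1 = Y 0 + \<gamma>"
  proof -
    have "of_pq ((0, 0), (l', 0)) = \<gamma>" by (simp add: of_pq_def \<gamma>_def winding_vec_def l'_def zero_prod_def vec_eq_iff)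
    moreover have "Y 1 = Y 0 + of_pq ((0, 0), (l', 0))" unfolding Y_def P1 Q1 of_pq.add[symmetric] by (simp add: zero_prod_def[symmetric])
    ultimately show ?thesis by simp
  qed
  define X where "X t = Y (t - of_int \<lfloor>t\<rfloor>) + of_int \<lfloor>t\<rfloor> *\<^sub>R \<gamma>" for t
  have dX: "(X has_vector_derivative V (t, X t)) (at t)" for t
    unfolding X_def[abs_def]
  proof (rule quasi_periodic_extension[where g = "\<lambda>t v. V (t, v)", OF dY Y1])
    fix t k :: real and v assume k: "k \<in> \<int>"
    then have "(k, k *\<^sub>R \<gamma>) \<in> \<Lambda>" by (simp add: \<Lambda>_def \<gamma>_def winding_vec_deck)
    from V\<Lambda>[OF this, of "(t, v)"] show "V (t + k, v + k *\<^sub>R \<gamma>) = V (t, v)" by simp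
  qed
  have Xper: "X (t + 1) = X t + \<gamma>" for t by (simp add: X_def algebra_simps)
  have XY: "X t = Y t" if "t \<in> {0..1}" for t
  proof (cases "t = 1")
    case True
    then show ?thesis using Y1 by (simp add: X_def)
  next
    case False
    then have "\<lfloor>t\<rfloor> = 0" using that by (intro floor_unique) auto
    then show ?thesis by (simp add: X_def)
  qed
  have inside: "\<bar>fst (fst (X t))\<bar> < R" for t
  proof -
    have "t - of_int \<lfloor>t\<rfloor> \<in> {0..1}" unfolding atLeastAtMost_iff by linarith
    from PR[OF this] show ?thesis by (simp add: X_def Y_def of_pq_def \<gamma>_def winding_vec_def)
  qed
  \<comment> \<open>The choice of representative is immaterial, because X changes by a deck
    translation over each period.\<close>
  define x where "x c = cover ?M (X (rep_circle1 c))" for c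
  have lift: "x (to_circle1 t) = cover ?M (X t)" for t
  proof -
    define k where "k = rep_circle1 (to_circle1 t) - t"
    have "to_circle1 (rep_circle1 (to_circle1 t)) = to_circle1 t" by simp
    then have k: "k \<in> \<int>" unfolding k_def by (simp only: to_circle1_eq_iff)
    have "X (rep_circle1 (to_circle1 t)) = X t + k *\<^sub>R \<gamma>"
      using quasi_periodic_int[of X \<gamma>, OF Xper k, of t] by (simp add: k_def)
    then show ?thesis unfolding x_def cover_eq_iff using winding_vec_deck[OF k, of l] by (simp add: \<gamma>_def)
  qed
  have contX: "continuous_on UNIV X" using dX by (auto intro!: continuous_at_imp_continuous_on has_vector_derivative_continuous)
  interpret quasi_periodic_lift R l X x
    by standard (use contX Xper inside lift in \<open>auto simp: \<gamma>_def\<close>)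
  have smoothV: "smooth_on V UNIV"
    unfolding smooth_on_def
  proof
    fix k
    have "Ck_on k (\<lambda>z. (- gq z, gp z)) UNIV"
      by (intro Ck_on_Pair Ckg Ck_on_bounded_linear[OF bounded_linear_minus[OF bounded_linear_ident]] open_UNIV)
    then show "Ck_on k V UNIV" unfolding V_def[abs_def] by (rule Ck_on_bounded_linear[OF bounded_linear_of_pq open_UNIV])
  qed
  \<comment> \<open>The orbit stays in the open annulus, so F agrees with the pullback of H on a
    neighbourhood of \<open>X t\<close> and the two have the same derivative there.\<close>
  have hv: "ham_vf ?M H t (X t) = V (t, X t)" for t
  proof (rule ham_vf_eqI)
    fix w
    have "((\<lambda>v. (t, v)) has_derivative (\<lambda>w. (0, w))) (at (X t))" by (auto intro!: derivative_eq_intros)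
    from diff_chain_at[OF this fd_works[OF Fd]]
    have "((\<lambda>v. F (t, v)) has_derivative (\<lambda>w. fd F (t, X t) (0, w))) (at (X t))" by (simp add: o_def)
    moreover have "open {v :: 'n phase. \<bar>fst (fst v)\<bar> < R}"
      by (intro open_Collect_less continuous_intros)
    ultimately have "((\<lambda>v. H (to_circle1 t, cover ?M v)) has_derivative (\<lambda>w. fd F (t, X t) (0, w))) (at (X t))"
      using inside[of t] by (elim has_derivative_transform_within_open) (auto simp: F_def)
    then have "fd (\<lambda>v. H (to_circle1 t, cover ?M v)) (X t) w = fd F (t, X t) (0, w)" by (simp add: fd_eqI)
    also have "\<dots> = gp (t, X t) \<bullet> fst (to_pq w) + gq (t, X t) \<bullet> snd (to_pq w)" by (simp add: gsplit)
    finally show "form ?M (V (t, X t)) w = - fd (\<lambda>v. H (to_circle1 t, cover ?M v)) (X t) w"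
      by (simp add: form_phase liouville_def V_def inner_commute)
  qed
  have traj: "x \<in> periodic_trajectories ?M H (pair_class (alpha_class R l) (trivial_class torus))"
    unfolding periodic_trajectories_def
    using in_class lift dX hv by (intro CollectI conjI exI[of _ X]) auto
  have "action ?M (ref_loop l) H x = - integral {0..1} (\<lambda>t. liouville (X t) (V (t, X t))) + integral {0..1} (\<lambda>t. H (to_circle1 t, x (to_circle1 t)))"
    by (rule action_eq[OF smooth_ode_solution[OF smoothV dX] dX])
  also have "(\<lambda>t. H (to_circle1 t, x (to_circle1 t))) = (\<lambda>t. F (t, X t))"
    using inside by (simp add: lift F_def)
  also have "- integral {0..1} (\<lambda>t. liouville (X t) (V (t, X t))) + integral {0..1} (\<lambda>t. F (t, X t))
     = integral {0..1} (\<lambda>t. F (t, X t) - liouville (X t) (V (t, X t)))"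
  proof -
    have s: "continuous_on {0..1} (\<lambda>t. (t, X t))" by (intro continuous_intros continuous_on_subset[OF contX]) auto
    have cF: "continuous_on UNIV F" "continuous_on UNIV V"
      using smoothF smoothV Ck_on_imp_continuous_on unfolding smooth_on_def by blast+
    have 1: "(\<lambda>t. F (t, X t)) integrable_on {0..1}"
      by (intro integrable_continuous_interval continuous_on_compose2[OF cF(1) s]) auto
    have 2: "(\<lambda>t. liouville (X t) (V (t, X t))) integrable_on {0..1}"
      by (intro integrable_continuous_interval bounded_bilinear.continuous_on[OF bounded_bilinear_liouville]
          continuous_on_compose2[OF cF(2) s] continuous_on_subset[OF contX]) auto
    show ?thesis using integral_diff[OF 1 2] by simp
  qed
  also have "\<dots> = integral {0..1} (\<lambda>t. F (t, of_pq (P t, Q t)) - P t \<bullet> gp (t, of_pq (P t, Q t)))"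
    by (rule integral_cong) (simp add: XY Y_def liouville_def V_def)
  finally have "action ?M (ref_loop l) H x \<ge> c - u * of_int l" using act by (simp add: l'_def)
  then show ?thesis using traj by blast
qed

section \<open>The capacity\<close>

theorem theorem1p2:
  fixes R u :: real and l :: int and a :: ereal
  assumes "R > 0" and "u \<in> {-R<..<R}" and "a \<noteq> \<infinity>"
  shows "relative_capacity
           (torus :: ((real \<times> real) ^ 'n, (circle2 \<times> circle1) ^ 'n::finite) flat_mfd)
           torus_origin zero_torus R u l a
         = max (ereal (R * \<bar>of_int l\<bar> + u * of_int l)) (a + ereal (u * of_int l))"
proof -
  let ?M = "phase_mfd R :: ('n phase, 'n phase_points) flat_mfd"
  let ?A = "({u} \<times> UNIV) \<times> (zero_torus :: ((circle2 \<times> circle1) ^ 'n) set)"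
  let ?\<alpha> = "pair_class (alpha_class R l) (trivial_class (torus :: ((real \<times> real) ^ 'n, (circle2 \<times> circle1) ^ 'n) flat_mfd))"
  let ?act = "action ?M (ref_loop l)"
  define L where "L = real_of_int l"
  define good where "good c \<longleftrightarrow> c > 0 \<and> (\<forall>H \<in> H_c ?M ?A c. \<exists>x \<in> periodic_trajectories ?M H ?\<alpha>. ereal (?act H x) \<ge> a)" for c
  define m where "m = max (ereal (R * \<bar>L\<bar> + u * L)) (a + ereal (u * L))"
  have u: "\<bar>u\<bar> < R" using assms(2) by auto
  have cap: "relative_capacity (torus :: ((real \<times> real) ^ 'n, (circle2 \<times> circle1) ^ 'n) flat_mfd) torus_origin zero_torus R u l a
      = Inf {ereal c | c. good c}"
    by (simp add: relative_capacity_def C_BPS_def good_def)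
  \<comment> \<open>Admissible levels are positive by definition, so the maximum has to be at least
    0; this holds because |u| < R.\<close>
  have nonneg: "R * \<bar>L\<bar> + u * L \<ge> 0"
  proof -
    have "\<bar>u * L\<bar> \<le> R * \<bar>L\<bar>" unfolding abs_mult using u by (intro mult_right_mono) auto
    then show ?thesis by linarith
  qed
  have upper: "good c" if "m < ereal c" for c
  proof -
    have c1: "R * \<bar>L\<bar> + u * L < c" and c2: "a + ereal (u * L) < ereal c" using that by (auto simp: m_def)
    \<comment> \<open>For a = -\<infinity> this is trivial; for real a it says that the action
      guaranteed by the existence result is large enough.\<close>
    have ca: "a \<le> ereal (c - u * L)" using c2 assms(3) by (cases a) auto
    have "\<exists>x \<in> periodic_trajectories ?M H ?\<alpha>. ereal (?act H x) \<ge> a" if H: "H \<in> H_c ?M ?A c" for H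
    proof -
      have "c - u * of_int l > R * \<bar>of_int l\<bar>" using c1 by (simp add: L_def)
      from orbit_of_large_action[OF u H this] obtain x where "x \<in> periodic_trajectories ?M H ?\<alpha>" "?act H x \<ge> c - u * of_int l" by blast
      then show ?thesis using ca by (intro bexI[of _ x]) (auto simp: L_def intro: order_trans)
    qed
    then show ?thesis using c1 nonneg by (simp add: good_def)
  qed
  \<comment> \<open>A radial Hamiltonian excludes the level c if its orbits in the class all have
    action below a, in particular if the slope L never occurs.\<close>
  have no_orbit: "\<not> good c" if f: "radial R r f" "c \<le> f u"
    and act: "\<And>p. \<bar>p\<bar> < R \<Longrightarrow> (f has_real_derivative L) (at p) \<Longrightarrow> ereal (f p - p * L) < a" for c r f
  proof
    assume "good c"
    moreover have "radial.H f \<in> H_c ?M ?A c" by (rule radial.H_in_H_c[OF f])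
    ultimately obtain x where x: "x \<in> periodic_trajectories ?M (radial.H f) ?\<alpha>" "ereal (?act (radial.H f) x) \<ge> a"
      unfolding good_def by blast
    from radial.H_action[OF f(1) x(1)] obtain p where "\<bar>p\<bar> < R" "(f has_real_derivative L) (at p)" "?act (radial.H f) x = f p - p * L"
      unfolding L_def by blast
    then show False using act[of p] x(2) by simp
  qed
  have lower: "m \<le> ereal c" if "good c" for c
  proof (rule ccontr)
    assume "\<not> m \<le> ereal c"
    then have less: "ereal c < m" by simp
    have c0: "c > 0" using that by (simp add: good_def)
    show False
    proof (cases "c < R * \<bar>L\<bar> + u * L")
      case small: True
      then have "L \<noteq> 0" using c0 by auto
      show False
      proof (cases "L > 0")
        case True
        then have "c < (R + u) * L" using small by (simp add: algebra_simps)
        from gentle_bump[OF u True c0 this] obtain f r where f: "smooth_on f UNIV" "r < R" "0 \<le> r"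
          "\<And>p. \<bar>p\<bar> \<ge> r \<Longrightarrow> f p = 0" "f u \<ge> c" "\<And>p d. (f has_real_derivative d) (at p) \<Longrightarrow> d < L" by blast
        have "radial R r f" by standard (use f in auto)
        from no_orbit[OF this f(5)] that f(6) show False by blast
      next
        case False
        \<comment> \<open>The reflection of p in 0 exchanges the signs of L and u and reduces this
          case to the previous one.\<close>
        then have L: "- L > 0" using \<open>L \<noteq> 0\<close> by simp
        have "c < (R + - u) * - L" using small L by (simp add: algebra_simps)
        from gentle_bump[of "- u" R "- L" c] u L c0 this obtain f r where f: "smooth_on f UNIV" "r < R" "0 \<le> r"
          "\<And>p. \<bar>p\<bar> \<ge> r \<Longrightarrow> f p = 0" "f (- u) \<ge> c" "\<And>p d. (f has_real_derivative d) (at p) \<Longrightarrow> d < - L" by auto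
        have "Ck_on k (\<lambda>p. f (-1 * p + 0)) UNIV" for k
          using f(1) by (intro Ck_on_compose[OF open_UNIV Ck_on_affine]) (simp add: smooth_on_def)
        then have "smooth_on (\<lambda>p. f (- p)) UNIV" by (simp add: smooth_on_def)
        then have rad: "radial R r (\<lambda>p. f (- p))" by unfold_locales (use f in auto)
        have slope: "\<not> ((\<lambda>p. f (- p)) has_real_derivative L) (at p)" for p
        proof
          assume "((\<lambda>p. f (- p)) has_real_derivative L) (at p)"
          then have D: "((\<lambda>p. f (- p)) has_real_derivative L) (at (- (- p)))" by simp
          have "((\<lambda>q. f (- (- q))) has_real_derivative L * (- 1)) (at (- p))"
            by (rule DERIV_chain2[where f = "\<lambda>p. f (- p)" and g = "\<lambda>q. - q" and x = "- p", OF D]) (auto intro!: derivative_eq_intros)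
          then show False using f(6)[of "- L" "- p"] by simp
        qed
        from no_orbit[OF rad f(5)] that slope show False by blast
      qed
    next
      case False
      then have big: "R * \<bar>L\<bar> + u * L \<le> c" by simp
      have "ereal c < a + ereal (u * L)" using less big by (auto simp: m_def less_max_iff_disj)
      then obtain b where b: "a = ereal b" "c < b + u * L" using assms(3) by (cases a) auto
      define g where "g = b + u * L - c"
      have g: "g > 0" using b by (simp add: g_def)
      \<comment> \<open>The bump has to fit into the annulus, and across its half width the term p L
        may vary by a third of the gap g. The overshoot c + g / 3 of the bump takes another third,
        so a third remains.\<close>
      define \<eta> where "\<eta> = min ((R - \<bar>u\<bar>) / 2) (g / (3 * (\<bar>L\<bar> + 1)))"
      have \<eta>: "\<eta> > 0" "\<bar>u\<bar> + \<eta> < R" "\<eta> * \<bar>L\<bar> \<le> g / 3"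
      proof -
        show "\<eta> > 0" using u g by (simp add: \<eta>_def add_nonneg_pos)
        have "\<eta> \<le> (R - \<bar>u\<bar>) / 2" unfolding \<eta>_def by (rule min.cobounded1)
        also have "\<dots> < R - \<bar>u\<bar>" using u by (simp add: field_simps)
        finally show "\<bar>u\<bar> + \<eta> < R" by (simp add: less_diff_eq add.commute)
        have "\<eta> * (\<bar>L\<bar> + 1) \<le> g / (3 * (\<bar>L\<bar> + 1)) * (\<bar>L\<bar> + 1)"
          unfolding \<eta>_def by (intro mult_right_mono min.cobounded2) simp
        also have "\<dots> = g / 3"
        proof -
          have "\<bar>L\<bar> + 1 \<noteq> 0" by linarith
          then show ?thesis by (simp add: field_simps)
        qed
        finally show "\<eta> * \<bar>L\<bar> \<le> g / 3" using \<open>\<eta> > 0\<close> by (simp add: distrib_left)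
      qed
      have "c < c + g / 3" using g by simp
      from narrow_bump[OF \<eta>(1) c0 this, of u] obtain f where f: "smooth_on f UNIV" "\<And>p. f p \<le> c + g / 3"
        "\<And>p. \<bar>p - u\<bar> \<ge> \<eta> \<Longrightarrow> f p = 0" "f u \<ge> c" by blast
      have rad: "radial R (\<bar>u\<bar> + \<eta>) f" by unfold_locales (use f \<eta> in auto)
      have "ereal (f p - p * L) < a" if p: "\<bar>p\<bar> < R" for p
      proof (cases "\<bar>p - u\<bar> < \<eta>")
        case True
        have "\<bar>(u - p) * L\<bar> \<le> \<eta> * \<bar>L\<bar>" unfolding abs_mult using True by (intro mult_right_mono) auto
        then have "- (p * L) \<le> - (u * L) + g / 3" using \<eta>(3) by (simp add: left_diff_distrib abs_le_iff)
        moreover have "b = c - u * L + g" by (simp add: g_def)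
        ultimately have "f p - p * L \<le> b - g / 3" using f(2)[of p] by linarith
        then show ?thesis using g b by simp
      next
        case False
        \<comment> \<open>Outside the bump f is 0 and the action is - p L, at most R |L|, which
          \<open>big\<close> places below b.\<close>
        have "\<bar>p * L\<bar> \<le> R * \<bar>L\<bar>" unfolding abs_mult using p by (intro mult_right_mono) auto
        then have "- (p * L) \<le> R * \<bar>L\<bar>" by linarith
        also have "\<dots> < b" using big g by (simp add: g_def)
        finally show ?thesis using f(3)[of p] False b by simp
      qed
      from no_orbit[OF rad f(4) this] that show False by blast
    qed
  qed
  have "Inf {ereal c | c. good c} = m"
  proof (rule antisym)
    show "Inf {ereal c | c. good c} \<le> m"
    \<comment> \<open>Admissibility is known only strictly above m, so the infimum is compared with
      every y > m.\<close>
    proof (rule dense_ge)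
      fix y assume y: "m < y"
      show "Inf {ereal c | c. good c} \<le> y"
      proof (cases y)
        case (real c)
        then have "good c" using y by (intro upper) simp
        then show ?thesis unfolding real by (intro Inf_lower) auto
      qed (use y in auto)
    qed
    show "m \<le> Inf {ereal c | c. good c}" using lower by (intro Inf_greatest) auto
  qed
  then show ?thesis unfolding cap m_def L_def .
qed

end
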